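(* Let $X,Y$ be Banach spaces such that $X^*$ and $Y^*$ have the Radon-Nikod\'ym property and at least one of $X^*$, $Y^*$ has the approximation property. Then every tensor in $X^*\widehat{\otimes}_\pi Y^*$ can be approximated by tensors that attain their norms, that is, $\overline{\mathrm{NA}_\pi(X^*\widehat{\otimes}_\pi Y^* )}^{\|\cdot\|_\pi}=X^*\widehat{\otimes}_\pi Y^*$.
   Context: A Banach space $E$ has the approximation property if for every compact $K\subseteq E$ and $\varepsilon>0$ there is a finite-rank bounded operator $T:E\to E$ with $\|T(x)-x\|\leq\varepsilon$ for all $x\in K$. For Banach spaces $E,F$, $E\widehat{\otimes}_\pi F$ is the projective tensor product, the completion of $E\otimes F$ under $\|z\|_\pi=\inf\{\sum_{i=1}^n\|x_i\|\|y_i\|: z=\sum_{i=1}^n x_i\otimes y_i\}$. An element $z\in E\widehat{\otimes}_\pi F$ attains its projective norm if there is a bounded sequence $(x_n,y_n)_{n=1}^\infty\subseteq E\times F$ with $\sum_{n=1}^\infty\|x_n\|\|y_n\|<\infty$, $z=\sum_{n=1}^\infty x_n\otimes y_n$ and $\|z\|_\pi=\sum_{n=1}^\infty\|x_n\|\|y_n\|$; the set of all such $z$ is denoted $\mathrm{NA}_\pi(E\widehat{\otimes}_\pi F)$. *)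

theory Defs
  imports "HOL-Analysis.Analysis"
begin

text \<open>
  The scalar field is a type \<open>'k\<close> of sort \<open>{real_normed_field, euclidean_space}\<close>. Up to
  isometric isomorphism the only such fields are \<open>real\<close> and \<open>complex\<close>, so real and complex
  Banach spaces are treated simultaneously. A Banach space over \<open>'k\<close> is a type of class
  \<open>banach\<close> with a scalar multiplication by \<open>'k\<close> that extends the real one.
\<close>

locale banach_over = vector_space scale
  for scale :: "'k::{real_normed_field,euclidean_space} \<Rightarrow> 'a::banach \<Rightarrow> 'a" +
  assumes norm_scale: "norm (scale c x) = norm c * norm x"
    and scale_of_real: "scale (of_real r) x = r *\<^sub>R x"

text \<open>
  Type \<open>'a \<Rightarrow>\<^sub>L 'k\<close> consists of the bounded real-linear maps. The dual is the subset of those that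
  are linear over \<open>'k\<close>, with the operator norm. Because the dual is a subset rather than a type,
  the properties below are formulated for a closed subspace \<open>E\<close> of an ambient Banach space.
\<close>

definition dual_scale ::
    "'k::{real_normed_field,euclidean_space} \<Rightarrow> ('a::banach \<Rightarrow>\<^sub>L 'k) \<Rightarrow> ('a \<Rightarrow>\<^sub>L 'k)" where
  "dual_scale c f = blinfun_mult_right c o\<^sub>L f"

definition dual_space ::
    "('k::{real_normed_field,euclidean_space} \<Rightarrow> 'a::banach \<Rightarrow> 'a) \<Rightarrow> ('a \<Rightarrow>\<^sub>L 'k) set" where
  "dual_space s = {f. \<forall>c x. blinfun_apply f (s c x) = c * blinfun_apply f x}"

lemma dual_scale_apply: "blinfun_apply (dual_scale c f) x = c * blinfun_apply f x"
  by (simp add: dual_scale_def)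

lemma banach_over_dual_scale:
  "banach_over (dual_scale :: 'k::{real_normed_field,euclidean_space} \<Rightarrow> ('a::banach \<Rightarrow>\<^sub>L 'k) \<Rightarrow> _)"
proof
  fix c :: 'k and f :: "'a \<Rightarrow>\<^sub>L 'k"
  have le: "norm (dual_scale d g) \<le> norm d * norm g" for d :: 'k and g :: "'a \<Rightarrow>\<^sub>L 'k"
  proof (rule norm_blinfun_bound)
    fix x
    have "norm d * norm (blinfun_apply g x) \<le> norm d * (norm g * norm x)"
      by (intro mult_left_mono norm_blinfun norm_ge_zero)
    then show "norm (blinfun_apply (dual_scale d g) x) \<le> norm d * norm g * norm x"
      by (simp add: dual_scale_apply norm_mult mult.assoc)
  qed simp
  show "norm (dual_scale c f) = norm c * norm f"
  proof (cases "c = 0")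
    case True
    then show ?thesis using le[of c f] by simp
  next
    case False
    have "dual_scale (inverse c) (dual_scale c f) = f"
      using False by (intro blinfun_eqI) (simp add: dual_scale_apply)
    then have "norm f \<le> norm (inverse c) * norm (dual_scale c f)"
      using le[of "inverse c" "dual_scale c f"] by simp
    then have "norm c * norm f \<le> norm (dual_scale c f)"
      using False by (simp add: norm_inverse norm_divide field_simps)
    then show ?thesis using le[of c f] by simp
  qed
qed (auto intro!: blinfun_eqI simp: dual_scale_apply blinfun.bilinear_simps algebra_simps scaleR_conv_of_real)

lemma subspace_dual_space:
  fixes s :: "'k::{real_normed_field,euclidean_space} \<Rightarrow> 'a::banach \<Rightarrow> 'a"
  shows "module.subspace dual_scale (dual_space s)"
proof -
  interpret banach_over "dual_scale :: 'k \<Rightarrow> ('a \<Rightarrow>\<^sub>L 'k) \<Rightarrow> ('a \<Rightarrow>\<^sub>L 'k)"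
    by (rule banach_over_dual_scale)
  show ?thesis
    by (auto simp: subspace_def dual_space_def dual_scale_apply blinfun.bilinear_simps algebra_simps)
qed

lemma closed_dual_space: "closed (dual_space s)"
proof -
  have "dual_space s = (\<Inter>c. \<Inter>x. {f. blinfun_apply f (s c x) = c * blinfun_apply f x})"
    by (auto simp: dual_space_def)
  then show ?thesis
    by (simp add: closed_INT closed_Collect_eq continuous_intros)
qed

lemma banach_over_scaleR: "banach_over ((*\<^sub>R) :: real \<Rightarrow> 'a::banach \<Rightarrow> 'a)"
  by standard (auto simp: algebra_simps)

lemma dual_space_scaleR: "dual_space ((*\<^sub>R) :: real \<Rightarrow> 'a::banach \<Rightarrow> 'a) = UNIV"
  by (auto simp: dual_space_def blinfun.bilinear_simps)

definition linear_map_on ::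
    "('k::field \<Rightarrow> 'e::ab_group_add \<Rightarrow> 'e) \<Rightarrow> ('k \<Rightarrow> 'f::ab_group_add \<Rightarrow> 'f) \<Rightarrow> 'e set \<Rightarrow> ('e \<Rightarrow> 'f) \<Rightarrow> bool"
  where
  "linear_map_on s s' E T \<longleftrightarrow>
     (\<forall>x\<in>E. \<forall>y\<in>E. T (x + y) = T x + T y) \<and> (\<forall>c. \<forall>x\<in>E. T (s c x) = s' c (T x))"

definition bilinear_map_on ::
    "('k::field \<Rightarrow> 'e::ab_group_add \<Rightarrow> 'e) \<Rightarrow> ('k \<Rightarrow> 'f::ab_group_add \<Rightarrow> 'f) \<Rightarrow> ('k \<Rightarrow> 'g::ab_group_add \<Rightarrow> 'g)
      \<Rightarrow> 'e set \<Rightarrow> 'f set \<Rightarrow> ('e \<Rightarrow> 'f \<Rightarrow> 'g) \<Rightarrow> bool" where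
  "bilinear_map_on sE sF sG E F b \<longleftrightarrow>
     (\<forall>x\<in>E. linear_map_on sF sG F (\<lambda>y. b x y)) \<and> (\<forall>y\<in>F. linear_map_on sE sG E (\<lambda>x. b x y))"

definition approximation_property ::
    "('k::{real_normed_field,euclidean_space} \<Rightarrow> 'e::banach \<Rightarrow> 'e) \<Rightarrow> 'e set \<Rightarrow> bool" where
  "approximation_property s E \<longleftrightarrow>
     (\<forall>K \<epsilon>. compact K \<and> K \<subseteq> E \<and> \<epsilon> > 0 \<longrightarrow>
       (\<exists>T. linear_map_on s s E T \<and> T ` E \<subseteq> E \<and>
            (\<exists>B. \<forall>x\<in>E. norm (T x) \<le> B * norm x) \<and>
            (\<exists>S. finite S \<and> T ` E \<subseteq> module.span s S) \<and>
            (\<forall>x\<in>K. norm (T x - x) \<le> \<epsilon>)))"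

text \<open>
  The library's \<open>has_bochner_integral\<close> is restricted to second countable spaces. The
  following is its definition without that restriction: since \<open>f\<close> is an \<open>L\<^sup>1\<close>-limit of simple
  functions, it is automatically strongly measurable up to a null set.
\<close>

definition has_bochner_integral_gen ::
    "'m measure \<Rightarrow> ('m \<Rightarrow> 'e::real_normed_vector) \<Rightarrow> 'e \<Rightarrow> bool" where
  "has_bochner_integral_gen M f x \<longleftrightarrow>
     f \<in> borel_measurable M \<and>
     (\<exists>s. (\<forall>i. Bochner_Integration.simple_bochner_integrable M (s i)) \<and>
          (\<lambda>i. \<integral>\<^sup>+\<omega>. ennreal (norm (f \<omega> - s i \<omega>)) \<partial>M) \<longlonglongrightarrow> 0 \<and>
          (\<lambda>i. Bochner_Integration.simple_bochner_integral M (s i)) \<longlonglongrightarrow> x)"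

definition vector_measure :: "'m measure \<Rightarrow> 'e::real_normed_vector set \<Rightarrow> ('m set \<Rightarrow> 'e) \<Rightarrow> bool" where
  "vector_measure M E G \<longleftrightarrow>
     (\<forall>A\<in>sets M. G A \<in> E) \<and>
     (\<forall>A :: nat \<Rightarrow> 'm set. range A \<subseteq> sets M \<and> disjoint_family A \<longrightarrow>
        (\<lambda>n. G (A n)) sums G (\<Union>n. A n))"

definition of_bounded_variation :: "'m measure \<Rightarrow> ('m set \<Rightarrow> 'e::real_normed_vector) \<Rightarrow> bool" where
  "of_bounded_variation M G \<longleftrightarrow>
     (\<exists>C. \<forall>P. finite P \<and> P \<subseteq> sets M \<and> disjoint P \<longrightarrow> (\<Sum>A\<in>P. norm (G A)) \<le> C)"

definition measure_continuous :: "'m measure \<Rightarrow> ('m set \<Rightarrow> 'e::real_normed_vector) \<Rightarrow> bool" where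
  "measure_continuous M G \<longleftrightarrow>
     (\<forall>\<epsilon>>0. \<exists>\<delta>>0. \<forall>A\<in>sets M. measure M A < \<delta> \<longrightarrow> norm (G A) < \<epsilon>)"

text \<open>
  The property with respect to all finite measure spaces. HOL does not allow quantifying over the
  type of points, so the underlying sets are subsets of \<open>real\<close>, with arbitrary \<open>\<sigma>\<close>-algebras. This
  loses nothing: the property with respect to Lebesgue measure on \<open>[0,1]\<close> alone already implies it
  for every finite measure space. It also makes the definition, which occurs only as a hypothesis,
  formally no stronger than the one quantifying over all measure spaces.
\<close>

definition radon_nikodym_property :: "'e::banach set \<Rightarrow> bool" where
  "radon_nikodym_property E \<longleftrightarrow>
     (\<forall>(M :: real measure) G.
        finite_measure M \<and> vector_measure M E G \<and> of_bounded_variation M G \<and> measure_continuous M G \<longrightarrow>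
        (\<exists>g. (\<forall>\<omega>\<in>space M. g \<omega> \<in> E) \<and>
             (\<exists>x. has_bochner_integral_gen M g x) \<and>
             (\<forall>A\<in>sets M. has_bochner_integral_gen M (\<lambda>\<omega>. indicator A \<omega> *\<^sub>R g \<omega>) (G A))))"

text \<open>
  \<open>t x y\<close> plays the role of \<open>x \<otimes> y\<close>. The algebraic tensor product \<open>E \<otimes> F\<close> is the span of the
  elementary tensors, characterised by its universal property: every bilinear form on \<open>E \<times> F\<close>
  factors through \<open>t\<close>. (Scalar targets suffice, since linear forms separate the points of a vector
  space; and a linear form on the span extends to the whole space, so \<open>\<phi>\<close> may be taken on all
  of \<open>'c\<close>.) The ambient norm on \<open>E \<otimes> F\<close> is required to be the projective norm, so that the
  completion of \<open>E \<otimes> F\<close> is its closure in the ambient Banach space.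
\<close>

definition algebraic_tensors ::
    "('k::{real_normed_field,euclidean_space} \<Rightarrow> 'c::banach \<Rightarrow> 'c) \<Rightarrow> 'e set \<Rightarrow> 'f set
      \<Rightarrow> ('e \<Rightarrow> 'f \<Rightarrow> 'c) \<Rightarrow> 'c set" where
  "algebraic_tensors sT E F t = module.span sT {t x y | x y. x \<in> E \<and> y \<in> F}"

definition projective_norm ::
    "'e::real_normed_vector set \<Rightarrow> 'f::real_normed_vector set \<Rightarrow> ('e \<Rightarrow> 'f \<Rightarrow> 'c::banach) \<Rightarrow> 'c \<Rightarrow> real"
  where
  "projective_norm E F t z =
     Inf {(\<Sum>i<n. norm (x i) * norm (y i)) | (n::nat) x y.
            (\<forall>i<n. x i \<in> E \<and> y i \<in> F) \<and> z = (\<Sum>i<n. t (x i) (y i))}"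

definition is_projective_tensor_product ::
    "('k::{real_normed_field,euclidean_space} \<Rightarrow> 'e::banach \<Rightarrow> 'e) \<Rightarrow> 'e set
      \<Rightarrow> ('k \<Rightarrow> 'f::banach \<Rightarrow> 'f) \<Rightarrow> 'f set
      \<Rightarrow> ('k \<Rightarrow> 'c::banach \<Rightarrow> 'c) \<Rightarrow> ('e \<Rightarrow> 'f \<Rightarrow> 'c) \<Rightarrow> bool" where
  "is_projective_tensor_product sE E sF F sT t \<longleftrightarrow>
     banach_over sT \<and>
     bilinear_map_on sE sF sT E F t \<and>
     (\<forall>b :: 'e \<Rightarrow> 'f \<Rightarrow> 'k. bilinear_map_on sE sF (*) E F b \<longrightarrow>
        (\<exists>\<phi>. Vector_Spaces.linear sT (*) \<phi> \<and> (\<forall>x\<in>E. \<forall>y\<in>F. \<phi> (t x y) = b x y))) \<and>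
     (\<forall>z\<in>algebraic_tensors sT E F t. norm z = projective_norm E F t z)"

definition projective_tensors ::
    "('k::{real_normed_field,euclidean_space} \<Rightarrow> 'c::banach \<Rightarrow> 'c) \<Rightarrow> 'e set \<Rightarrow> 'f set
      \<Rightarrow> ('e \<Rightarrow> 'f \<Rightarrow> 'c) \<Rightarrow> 'c set" where
  "projective_tensors sT E F t = closure (algebraic_tensors sT E F t)"

definition norm_attaining_tensors ::
    "('k::{real_normed_field,euclidean_space} \<Rightarrow> 'c::banach \<Rightarrow> 'c)
      \<Rightarrow> 'e::real_normed_vector set \<Rightarrow> 'f::real_normed_vector set \<Rightarrow> ('e \<Rightarrow> 'f \<Rightarrow> 'c) \<Rightarrow> 'c set" where
  "norm_attaining_tensors sT E F t =
     {z \<in> projective_tensors sT E F t.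
        \<exists>x y. (\<forall>n::nat. x n \<in> E \<and> y n \<in> F) \<and> bounded (range (\<lambda>n. (x n, y n))) \<and>
              summable (\<lambda>n. norm (x n) * norm (y n)) \<and>
              (\<lambda>n. t (x n) (y n)) sums z \<and>
              norm z = (\<Sum>n. norm (x n) * norm (y n))}"

end

theory Submission
  imports Defs "HOL-Probability.Discrete_Topology"
begin

text \<open>
  Let \<open>K\<close> be the product of the unit balls of \<open>X\<^sup>*\<close> and \<open>Y\<^sup>*\<close>, which is weak-star compact, and
  let \<open>V\<close> be the Banach space of uniform limits on \<open>K\<close> of (real parts of) weak-star continuous
  bilinear forms. A tensor \<open>z = \<Sum> c\<^sub>n f\<^sub>n \<otimes> g\<^sub>n\<close> acts on \<open>V\<close> by \<open>v \<mapsto> \<Sum> c\<^sub>n v(f\<^sub>n, g\<^sub>n)\<close>. By the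
  Bishop-Phelps theorem a small perturbation of this functional attains its norm at some \<open>v\<^sub>1\<close>,
  and it is then dominated by the supremum over the face \<open>{v\<^sub>1 = 1} \<subseteq> K\<close>. The Radon-Nikodym
  property makes the dual balls fragmented: every nonempty subset has nonempty relatively
  weak-star open subsets of small norm diameter. Exhausting the face by such pieces shows that the
  functional is, up to a small error in \<open>V\<^sup>*\<close>, a positive combination of evaluations at points
  of the face, that is, a finite tensor \<open>\<Sum> l\<^sub>i f\<^sub>i \<otimes> g\<^sub>i\<close> that attains its projective norm because
  \<open>v\<^sub>1\<close> norms it. The same exhaustion applied to all of \<open>K\<close>, together with the approximation
  property (a tensor vanishing on \<open>V\<close> is zero), bounds the projective norm by twice the norm in
  \<open>V\<^sup>*\<close>, so the approximation also holds in the projective norm.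
\<close>

subsection \<open>Sublinear functionals and the Bishop-Phelps theorem\<close>

text \<open>The perturbed functional produced by Bishop-Phelps lives on \<open>V\<close> and need
  not come from a tensor. Only the exhaustion turns it back into a finite tensor, and keeping to the
  face makes that tensor attain its norm. The exhaustion stands in for representing the functional
  by a measure on \<open>K\<close> and concentrating that measure, up to a small error, on pieces of
  small diameter. Equality of the projective norm with the norm in the dual of \<open>V\<close> is
  not established. It is enough that tensors acting weakly on \<open>V\<close> are small, and this
  is an open mapping argument: a tensor whose action on \<open>V\<close> is bounded by
  \<open>D\<close> is matched up to \<open>D / 2\<close> by one of norm at most \<open>D\<close>,
  and iteration gives the factor 2 = 1 + 1/2 + 1/4 + ... . The limit of the iteration differs from
  the given tensor by one that vanishes on \<open>V\<close>; removing this difference is the task of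
  the approximation property. Real-valued functions suffice for either scalar field because a scalar
  of modulus one can be moved into one factor.\<close>

definition sublinear :: "('w::real_vector \<Rightarrow> real) \<Rightarrow> bool" where
  "sublinear S \<longleftrightarrow> (\<forall>x y. S (x + y) \<le> S x + S y) \<and> (\<forall>c x. 0 < c \<longrightarrow> S (c *\<^sub>R x) \<le> c * S x) \<and> S 0 = 0"

lemma sublinearI:
  assumes "\<And>x y. S (x + y) \<le> S x + S y" "\<And>c x. 0 < c \<Longrightarrow> S (c *\<^sub>R x) \<le> c * S x" "S 0 = 0"
  shows "sublinear S"
  using assms by (simp add: sublinear_def)

lemma sublinear_add: "sublinear S \<Longrightarrow> S (x + y) \<le> S x + S y"
  by (simp add: sublinear_def)

text \<open>The reverse inequality is the defining one, applied to \<open>c *\<^sub>R x\<close> with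
  factor \<open>1 / c\<close>. One inequality is therefore all that a proof of sublinearity has to
  supply.\<close>

lemma sublinear_scaleR:
  assumes "sublinear S" "0 \<le> c"
  shows "S (c *\<^sub>R x) = c * S x"
proof (cases "c = 0")
  case False
  then have c: "0 < c" using assms by simp
  have "S ((1/c) *\<^sub>R (c *\<^sub>R x)) \<le> (1/c) * S (c *\<^sub>R x)"
    using c assms(1) unfolding sublinear_def by (meson divide_pos_pos zero_less_one)
  then have "c * S x \<le> S (c *\<^sub>R x)"
    using c by (simp add: field_simps)
  moreover have "S (c *\<^sub>R x) \<le> c * S x"
    using c assms(1) unfolding sublinear_def by blast
  ultimately show ?thesis by simp
qed (use assms in \<open>simp add: sublinear_def\<close>)

lemma sublinear_minus_le:
  assumes "sublinear S"
  shows "- S (- x) \<le> S x"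
  using sublinear_add[OF assms, of x "-x"] assms by (simp add: sublinear_def)

text \<open>Almost minimising indices for \<open>x\<close> and \<open>y\<close> are merged into one
  index for \<open>x + y\<close>. In the three uses the index set is a chain of functionals, a
  half-line of shifts, or a convex cone.\<close>

lemma sublinear_INF:
  fixes f :: "'i \<Rightarrow> 'w::real_vector \<Rightarrow> real"
  assumes ne: "I \<noteq> {}"
    and lb: "\<And>x. bdd_below ((\<lambda>i. f i x) ` I)"
    and add: "\<And>i j x y. i \<in> I \<Longrightarrow> j \<in> I \<Longrightarrow> \<exists>k\<in>I. f k (x + y) \<le> f i x + f j y"
    and scale: "\<And>i c x. i \<in> I \<Longrightarrow> 0 < c \<Longrightarrow> \<exists>k\<in>I. f k (c *\<^sub>R x) \<le> c * f i x"
    and zero: "(INF i\<in>I. f i 0) = 0"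
  shows "sublinear (\<lambda>x. INF i\<in>I. f i x)"
proof (rule sublinearI)
  fix x y
  have 1: "(INF k\<in>I. f k (x + y)) \<le> f i x + f j y" if "i \<in> I" "j \<in> I" for i j
    using add[OF that, of x y] cINF_lower2[OF lb] by blast
  have "(INF k\<in>I. f k (x + y)) - f j y \<le> (INF i\<in>I. f i x)" if "j \<in> I" for j
    using 1 that ne by (intro cINF_greatest) (auto simp: algebra_simps)
  then have "(INF k\<in>I. f k (x + y)) - (INF i\<in>I. f i x) \<le> (INF j\<in>I. f j y)"
    using ne by (intro cINF_greatest) (auto simp: algebra_simps)
  then show "(INF k\<in>I. f k (x + y)) \<le> (INF i\<in>I. f i x) + (INF j\<in>I. f j y)" by simp
next
  fix c :: real and x assume c: "0 < c"
  have "(INF k\<in>I. f k (c *\<^sub>R x)) \<le> c * f i x" if "i \<in> I" for i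
    using scale[OF that c, of x] cINF_lower2[OF lb] by blast
  then have "(INF k\<in>I. f k (c *\<^sub>R x)) / c \<le> (INF i\<in>I. f i x)"
    using ne c by (intro cINF_greatest) (auto simp: field_simps)
  then show "(INF k\<in>I. f k (c *\<^sub>R x)) \<le> c * (INF i\<in>I. f i x)"
    using c by (simp add: field_simps)
qed (rule zero)

text \<open>A sublinear functional that is minimal for the pointwise order is linear.\<close>

lemma sublinear_dominates_linear:
  fixes S :: "'w::real_vector \<Rightarrow> real"
  assumes "sublinear S"
  shows "\<exists>L. linear L \<and> (\<forall>x. L x \<le> S x)"
proof -
  define A where "A = {T. sublinear T \<and> (\<forall>x. T x \<le> S x)}"
  define P where "P f g \<longleftrightarrow> (\<forall>x. g x \<le> f x)" for f g :: "'w \<Rightarrow> real"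
  have po: "partial_order_on A (relation_of P A)"
    unfolding partial_order_on_def preorder_on_def refl_on_def trans_def antisym_def relation_of_def P_def
    by (auto intro: order_trans order_antisym intro!: ext)
  have "\<exists>m\<in>A. \<forall>a\<in>A. P m a \<longrightarrow> a = m"
  proof (rule predicate_Zorn[OF po])
    fix C assume C: "C \<in> Chains (relation_of P A)"
    then have CA: "C \<subseteq> A" and tot: "\<And>T T'. T \<in> C \<Longrightarrow> T' \<in> C \<Longrightarrow> P T T' \<or> P T' T"
      unfolding Chains_def relation_of_def by blast+
    show "\<exists>u\<in>A. \<forall>a\<in>C. P a u"
    proof (cases "C = {}")
      case True
      then show ?thesis using assms by (auto simp: A_def)
    next
      case False
      have lb: "bdd_below ((\<lambda>T. T x) ` C)" for x
      proof (rule bdd_belowI2[of _ "- S (- x)"])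
        fix T assume "T \<in> C"
        then have "sublinear T" "T (-x) \<le> S (-x)" using CA by (auto simp: A_def)
        then show "- S (- x) \<le> T x" using sublinear_minus_le[of T x] by linarith
      qed
      have "sublinear (\<lambda>x. INF T\<in>C. T x)"
      proof (rule sublinear_INF[OF False lb])
        fix T T' x y assume TT: "T \<in> C" "T' \<in> C"
        then have s: "sublinear T" "sublinear T'" using CA by (auto simp: A_def)
        from tot[OF TT] show "\<exists>k\<in>C. k (x + y) \<le> T x + T' y"
        proof
          assume "P T T'"
          then show ?thesis using TT sublinear_add[OF s(2), of x y] unfolding P_def
            by (meson add_right_mono order_trans)
        next
          assume "P T' T"
          then show ?thesis using TT sublinear_add[OF s(1), of x y] unfolding P_def
            by (meson add_left_mono order_trans)
        qed
      next
        fix T c x assume "T \<in> C" "0 < (c::real)"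
        then show "\<exists>k\<in>C. k (c *\<^sub>R x) \<le> c * T x"
          using CA sublinear_scaleR[of T c x] by (intro bexI[of _ T]) (auto simp: A_def)
      next
        have "T \<in> C \<Longrightarrow> T 0 = 0" for T using CA by (auto simp: A_def sublinear_def)
        then have "(\<lambda>T. T 0) ` C = {0}" using False by force
        then show "(INF T\<in>C. T 0) = 0" by simp
      qed
      moreover have "(INF T\<in>C. T x) \<le> S x" for x
      proof -
        obtain T where "T \<in> C" using False by blast
        then show ?thesis using CA by (intro cINF_lower2[OF lb]) (auto simp: A_def)
      qed
      ultimately have "(\<lambda>x. INF T\<in>C. T x) \<in> A" by (simp add: A_def)
      then show ?thesis unfolding P_def by (intro bexI) (auto intro: cINF_lower[OF lb])
    qed
  qed
  then obtain m where mA: "m \<in> A" and min: "\<And>a. a \<in> A \<Longrightarrow> P m a \<Longrightarrow> a = m" by blast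
  have sm: "sublinear m" and mS: "\<And>x. m x \<le> S x" using mA by (auto simp: A_def)
  have super: "m w + m y \<le> m (w + y)" for w y
  proof -
    \<comment> \<open>\<open>N\<close> is sublinear and below \<open>m\<close>, so minimality gives
      \<open>N = m\<close>; its bound at \<open>t = 1\<close> then reads
      \<open>m w \<le> m (w + y) - m y\<close>, the inequality missing for additivity.\<close>
    define N where "N = (\<lambda>w. INF t\<in>{0..}. m (w + t *\<^sub>R y) - t * m y)"
    have lb: "bdd_below ((\<lambda>t. m (w + t *\<^sub>R y) - t * m y) ` {0..})" for w
    proof (rule bdd_belowI2[of _ "- m (- w)"])
      fix t :: real assume "t \<in> {0..}"
      then have "t * m y = m ((w + t *\<^sub>R y) + (- w))" using sublinear_scaleR[OF sm] by simp
      also have "\<dots> \<le> m (w + t *\<^sub>R y) + m (- w)" by (rule sublinear_add[OF sm])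
      finally show "- m (- w) \<le> m (w + t *\<^sub>R y) - t * m y" by simp
    qed
    have "sublinear N" unfolding N_def
    proof (rule sublinear_INF[OF _ lb])
      fix i j :: real and x z assume ij: "i \<in> {0..}" "j \<in> {0..}"
      have "m (x + z + (i + j) *\<^sub>R y) \<le> m (x + i *\<^sub>R y) + m (z + j *\<^sub>R y)"
        using sublinear_add[OF sm, of "x + i *\<^sub>R y" "z + j *\<^sub>R y"] by (simp add: algebra_simps)
      then show "\<exists>k\<in>{0..}. m (x + z + k *\<^sub>R y) - k * m y
          \<le> m (x + i *\<^sub>R y) - i * m y + (m (z + j *\<^sub>R y) - j * m y)"
        using ij by (intro bexI[of _ "i + j"]) (auto simp: algebra_simps)
    next
      fix i c :: real and x assume ic: "i \<in> {0..}" "0 < c"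
      have "m (c *\<^sub>R x + (c * i) *\<^sub>R y) = c * m (x + i *\<^sub>R y)"
        using sublinear_scaleR[OF sm, of c "x + i *\<^sub>R y"] ic by (simp add: algebra_simps)
      then show "\<exists>k\<in>{0..}. m (c *\<^sub>R x + k *\<^sub>R y) - k * m y \<le> c * (m (x + i *\<^sub>R y) - i * m y)"
        using ic by (intro bexI[of _ "c * i"]) (auto simp: algebra_simps)
    next
      have "(\<lambda>t. m (0 + t *\<^sub>R y) - t * m y) ` {0..} = {0}"
        using sublinear_scaleR[OF sm] by (auto simp: image_def intro: exI[of _ 0])
      then show "(INF t\<in>{0..}. m (0 + t *\<^sub>R y) - t * m y) = 0" by simp
    qed simp
    moreover have Nm: "N x \<le> m x" for x
      unfolding N_def by (rule cINF_lower2[OF lb, of 0]) auto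
    ultimately have "N \<in> A" using mS order_trans by (fastforce simp: A_def)
    then have "N = m" using min Nm by (auto simp: P_def)
    moreover have "N w \<le> m (w + y) - m y"
      unfolding N_def by (rule cINF_lower2[OF lb, of 1]) auto
    ultimately show ?thesis by simp
  qed
  have add: "m (x + y) = m x + m y" for x y
    using super[of x y] sublinear_add[OF sm, of x y] by simp
  have neg: "m (- x) = - m x" for x
    using add[of x "- x"] sm by (simp add: sublinear_def)
  have "linear m"
  proof (rule linearI)
    fix c x
    show "m (c *\<^sub>R x) = c *\<^sub>R m x"
    proof (cases "0 \<le> c")
      case True then show ?thesis using sublinear_scaleR[OF sm] by simp
    next
      case False
      then show ?thesis using sublinear_scaleR[OF sm, of "-c" "x"] neg[of "c *\<^sub>R x"] by simp
    qed
  qed (rule add)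
  then show ?thesis using mS by blast
qed

text \<open>Any linear \<open>L\<close> below the infimum \<open>N w\<close> of
  \<open>S (w + c) - h c\<close> over \<open>C\<close> works: \<open>c = 0\<close> gives
  \<open>L \<le> S\<close>, and \<open>c = x\<close> gives \<open>N (- x) \<le> - h x\<close>, hence
  \<open>h x \<le> L x\<close>. For a cone \<open>C\<close> this is a separation theorem, for a
  subspace the Hahn-Banach extension theorem.\<close>

lemma mazur_orlicz:
  fixes S :: "'w::real_vector \<Rightarrow> real"
  assumes S: "sublinear S" and C0: "0 \<in> C"
    and Cadd: "\<And>x y. x \<in> C \<Longrightarrow> y \<in> C \<Longrightarrow> x + y \<in> C \<and> h x + h y \<le> h (x + y)"
    and Cscale: "\<And>c x. 0 \<le> c \<Longrightarrow> x \<in> C \<Longrightarrow> c *\<^sub>R x \<in> C \<and> c * h x \<le> h (c *\<^sub>R x)"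
    and hS: "\<And>x. x \<in> C \<Longrightarrow> h x \<le> S x"
  shows "\<exists>L. linear L \<and> (\<forall>x. L x \<le> S x) \<and> (\<forall>x\<in>C. h x \<le> L x)"
proof -
  define N where "N = (\<lambda>w. INF c\<in>C. S (w + c) - h c)"
  have h0: "h 0 = 0"
    using Cscale[of 0 0] hS[OF C0] C0 S by (auto simp: sublinear_def)
  have lb: "bdd_below ((\<lambda>c. S (w + c) - h c) ` C)" for w
  proof (rule bdd_belowI2[of _ "- S (- w)"])
    fix c assume "c \<in> C"
    then have "h c \<le> S ((w + c) + (- w))" using hS by simp
    also have "\<dots> \<le> S (w + c) + S (- w)" by (rule sublinear_add[OF S])
    finally show "- S (- w) \<le> S (w + c) - h c" by simp
  qed
  have "sublinear N" unfolding N_def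
  proof (rule sublinear_INF[OF _ lb])
    fix i j x y assume ij: "i \<in> C" "j \<in> C"
    have "S (x + y + (i + j)) \<le> S (x + i) + S (y + j)"
      using sublinear_add[OF S, of "x + i" "y + j"] by (simp add: algebra_simps)
    then show "\<exists>k\<in>C. S (x + y + k) - h k \<le> S (x + i) - h i + (S (y + j) - h j)"
      using Cadd[OF ij] by (intro bexI[of _ "i + j"]) auto
  next
    fix i x and c :: real assume ic: "i \<in> C" "0 < c"
    have "S (c *\<^sub>R x + c *\<^sub>R i) = c * S (x + i)"
      using sublinear_scaleR[OF S, of c "x + i"] ic by (simp add: algebra_simps)
    then show "\<exists>k\<in>C. S (c *\<^sub>R x + k) - h k \<le> c * (S (x + i) - h i)"
      using Cscale[of c i] ic by (intro bexI[of _ "c *\<^sub>R i"]) (auto simp: algebra_simps)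
  next
    show "(INF c\<in>C. S (0 + c) - h c) = 0"
    proof (rule antisym)
      show "(INF c\<in>C. S (0 + c) - h c) \<le> 0"
        by (rule cINF_lower2[OF lb C0]) (use S h0 in \<open>simp add: sublinear_def\<close>)
      show "0 \<le> (INF c\<in>C. S (0 + c) - h c)"
        using C0 hS by (intro cINF_greatest) auto
    qed
  qed (use C0 in auto)
  then obtain L where L: "linear L" "\<And>x. L x \<le> N x"
    using sublinear_dominates_linear by blast
  have "N x \<le> S x" for x
    unfolding N_def by (rule cINF_lower2[OF lb C0]) (use h0 in simp)
  moreover have "h x \<le> L x" if "x \<in> C" for x
  proof -
    have "N (- x) \<le> - h x"
      unfolding N_def by (rule cINF_lower2[OF lb that]) (use S in \<open>simp add: sublinear_def\<close>)
    then show ?thesis using L(2)[of "- x"] linear_neg[OF L(1), of x] by simp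
  qed
  ultimately show ?thesis using L order_trans by blast
qed

text \<open>Ekeland's variational principle. Points of \<open>T v\<close> improve on
  \<open>v\<close> at rate at least \<open>e\<close>. Repeatedly choosing an almost best point gives
  a Cauchy sequence whose limit lies in every \<open>T (V n)\<close>; a point improving on the limit
  would also lie in every \<open>T (V n)\<close> and so could not be better than the limit.\<close>

lemma ekeland_maximum:
  fixes p :: "'w::{real_normed_vector,complete_space} \<Rightarrow> real"
  assumes B: "closed B" "B \<noteq> {}" and cont: "continuous_on UNIV p"
    and bdd: "\<And>v. v \<in> B \<Longrightarrow> p v \<le> b" and e: "0 < e"
  shows "\<exists>v1\<in>B. \<forall>v\<in>B. p v \<le> p v1 + e * norm (v - v1)"
proof -
  define T where "T v = {w \<in> B. p v + e * norm (w - v) \<le> p w}" for v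
  have step: "\<exists>w. w \<in> T v \<and> (\<forall>u\<in>T v. p u \<le> p w + (1/2)^n)" if "v \<in> B" for v and n :: nat
  proof -
    have ne: "p ` T v \<noteq> {}" using that by (auto simp: T_def)
    have ba: "bdd_above (p ` T v)" using bdd by (auto simp: T_def intro!: bdd_aboveI2[of _ _ b])
    have "Sup (p ` T v) - (1/2)^n < Sup (p ` T v)" by simp
    then obtain w where "w \<in> T v" "Sup (p ` T v) - (1/2)^n < p w"
      using less_cSup_iff[OF ne ba] by auto
    moreover have "p u \<le> Sup (p ` T v)" if "u \<in> T v" for u
      using ba that by (intro cSup_upper) auto
    ultimately show ?thesis by (intro exI[of _ w]) (auto intro: order_trans[of _ "Sup (p ` T v)"])
  qed
  define nx where "nx n v = (SOME w. w \<in> T v \<and> (\<forall>u\<in>T v. p u \<le> p w + (1/2)^n))" for n :: nat and v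
  have nx: "nx n v \<in> T v" "\<And>u. u \<in> T v \<Longrightarrow> p u \<le> p (nx n v) + (1/2)^n" if "v \<in> B" for n v
    using someI_ex[OF step[OF that, of n]] unfolding nx_def by blast+
  obtain v0 where v0: "v0 \<in> B" using B by blast
  define V where "V = rec_nat v0 nx"
  have V0: "V 0 = v0" and VS: "V (Suc n) = nx n (V n)" for n by (simp_all add: V_def)
  have VB: "V n \<in> B" for n
    by (induct n) (use v0 nx(1) in \<open>auto simp: V0 VS T_def\<close>)
  have trans: "u \<in> T v" if "w \<in> T v" "u \<in> T w" for u v w
  proof -
    have "norm (u - v) \<le> norm (u - w) + norm (w - v)" by (metis diff_add_cancel add_diff_eq norm_triangle_ineq)
    then have "e * norm (u - v) \<le> e * norm (u - w) + e * norm (w - v)"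
      using e by (metis distrib_left mult_le_cancel_left_pos)
    then show ?thesis using that by (auto simp: T_def)
  qed
  have refl: "V n \<in> T (V n)" for n using VB by (auto simp: T_def)
  have VT: "V m \<in> T (V n)" if "n \<le> m" for n m
    using that by (induct rule: dec_induct) (use refl trans nx(1)[OF VB] in \<open>auto simp: VS\<close>)
  have inc: "incseq (\<lambda>n. p (V n))"
  proof (rule incseq_SucI)
    fix n have "V (Suc n) \<in> T (V n)" by (rule VT) simp
    moreover have "0 \<le> e * norm (V (Suc n) - V n)" using e by simp
    ultimately show "p (V n) \<le> p (V (Suc n))" unfolding T_def by auto
  qed
  have "convergent (\<lambda>n. p (V n))"
    using incseq_convergent[OF inc, of b] bdd[OF VB] convergent_def by metis
  then have Cp: "Cauchy (\<lambda>n. p (V n))" by (rule convergent_Cauchy)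
  have "Cauchy V"
  proof (rule CauchyI')
    fix d :: real assume "0 < d"
    then have "0 < e * d" using e by simp
    then obtain M where M: "\<And>m n. m \<ge> M \<Longrightarrow> n \<ge> M \<Longrightarrow> norm (p (V m) - p (V n)) < e * d"
      using CauchyD[OF Cp] by blast
    have "dist (V m) (V n) < d" if "m \<ge> M" "n > m" for m n
    proof -
      have "e * norm (V n - V m) \<le> p (V n) - p (V m)" using VT[of m n] that by (auto simp: T_def)
      also have "\<dots> < e * d" using M[of n m] that by auto
      finally show ?thesis using e by (simp add: dist_norm norm_minus_commute)
    qed
    then show "\<exists>M. \<forall>m\<ge>M. \<forall>n>m. dist (V m) (V n) < d" by blast
  qed
  then obtain v1 where v1: "V \<longlonglongrightarrow> v1" using Cauchy_convergent convergent_def by blast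
  have pv1: "(\<lambda>n. p (V n)) \<longlonglongrightarrow> p v1"
    using continuous_on_tendsto_compose[OF cont v1] by simp
  have v1B: "v1 \<in> B" using closed_sequentially[OF B(1)] VB v1 by blast
  have v1T: "v1 \<in> T (V n)" for n
  proof -
    have "p (V n) + e * norm (v1 - V n) \<le> p v1"
    proof (rule LIMSEQ_le)
      show "(\<lambda>m. p (V n) + e * norm (V m - V n)) \<longlonglongrightarrow> p (V n) + e * norm (v1 - V n)"
        by (intro tendsto_intros v1)
      show "\<exists>N. \<forall>m\<ge>N. p (V n) + e * norm (V m - V n) \<le> p (V m)"
        using VT[of n] by (intro exI[of _ n]) (auto simp: T_def)
    qed (rule pv1)
    then show ?thesis using v1B by (simp add: T_def)
  qed
  show ?thesis
  proof (rule bexI[OF _ v1B], intro ballI, rule ccontr)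
    fix v assume v: "v \<in> B" "\<not> p v \<le> p v1 + e * norm (v - v1)"
    then have "v \<in> T v1" by (auto simp: T_def)
    then have "v \<in> T (V n)" for n using trans v1T by blast
    then have le: "p v \<le> p (V (Suc n)) + (1/2)^n" for n using nx(2)[OF VB] by (simp add: VS)
    have "p v \<le> p v1 + 0"
    proof (rule LIMSEQ_le_const)
      show "(\<lambda>n. p (V (Suc n)) + (1/2)^n) \<longlonglongrightarrow> p v1 + 0"
        by (intro tendsto_add LIMSEQ_Suc pv1 LIMSEQ_power_zero) auto
    qed (use le in blast)
    moreover have "0 \<le> e * norm (v - v1)" using e by simp
    ultimately show False using v by linarith
  qed
qed

text \<open>At the Ekeland point \<open>v1\<close>, \<open>p\<close> is at most
  \<open>e * norm\<close> on the cone generated by \<open>B - v1\<close>. Mazur-Orlicz supplies a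
  linear \<open>q\<close> with \<open>p \<le> q\<close> on the cone and
  \<open>q \<le> e * norm\<close> everywhere, so \<open>p - q\<close> is maximal at
  \<open>v1\<close>.\<close>

lemma bishop_phelps:
  fixes p :: "'w::{real_normed_vector,complete_space} \<Rightarrow> real"
  assumes B: "closed B" "B \<noteq> {}" "convex B" and p: "bounded_linear p"
    and bdd: "\<And>v. v \<in> B \<Longrightarrow> p v \<le> b" and e: "0 < e"
  shows "\<exists>q v1. linear q \<and> (\<forall>w. \<bar>q w\<bar> \<le> e * norm w) \<and> v1 \<in> B \<and> (\<forall>v\<in>B. p v - q v \<le> p v1 - q v1)"
proof -
  interpret p: bounded_linear p by fact
  obtain v1 where v1: "v1 \<in> B" "\<And>v. v \<in> B \<Longrightarrow> p v \<le> p v1 + e * norm (v - v1)"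
    using ekeland_maximum[OF B(1,2) linear_continuous_on[OF p] bdd e] by auto
  define C where "C = {t *\<^sub>R (v - v1) |t v. 0 \<le> t \<and> v \<in> B}"
  have "\<exists>L. linear L \<and> (\<forall>x. L x \<le> e * norm x) \<and> (\<forall>x\<in>C. p x \<le> L x)"
  proof (rule mazur_orlicz)
    show "sublinear (\<lambda>x::'w. e * norm x)"
    proof (rule sublinearI)
      fix x y :: 'w show "e * norm (x + y) \<le> e * norm x + e * norm y"
        using e norm_triangle_ineq[of x y] by (metis distrib_left mult_le_cancel_left_pos)
    qed auto
    show "0 \<in> C" using v1(1) by (force simp: C_def)
    fix x assume "x \<in> C"
    then obtain t v where x: "x = t *\<^sub>R (v - v1)" "0 \<le> t" "v \<in> B" by (auto simp: C_def)
    show "p x \<le> e * norm x"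
    proof -
      have "p v - p v1 \<le> e * norm (v - v1)" using v1(2)[OF x(3)] by simp
      then have "t * (p v - p v1) \<le> t * (e * norm (v - v1))" using x(2) mult_left_mono by blast
      moreover have "p x = t * (p v - p v1)" "norm x = t * norm (v - v1)"
        using x(2) by (simp_all add: x(1) p.scaleR p.diff)
      ultimately show ?thesis by (simp add: algebra_simps)
    qed
    fix c :: real assume "0 \<le> c"
    then show "c *\<^sub>R x \<in> C \<and> c * p x \<le> p (c *\<^sub>R x)"
      using x by (auto simp: C_def p.scaleR intro!: exI[of _ "c * t"])
  next
    fix x y assume "x \<in> C" "y \<in> C"
    then obtain s u t v where x: "x = s *\<^sub>R (u - v1)" "0 \<le> s" "u \<in> B"
      and y: "y = t *\<^sub>R (v - v1)" "0 \<le> t" "v \<in> B" by (auto simp: C_def)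
    have "x + y \<in> C"
    proof (cases "s + t = 0")
      case True
      then have "s = 0" "t = 0" using x y by auto
      then show ?thesis using x y v1(1) by (force simp: C_def)
    next
      case False
      then have st: "0 < s + t" using x y by auto
      \<comment> \<open>Convexity of \<open>B\<close> enters here: the sum of two multiples of
        directions is \<open>s + t\<close> times the direction towards a weighted mean.\<close>
      define z where "z = (s / (s + t)) *\<^sub>R u + (t / (s + t)) *\<^sub>R v"
      have "z \<in> B" unfolding z_def using x y st B(3)
        by (intro convexD) (auto simp: add_divide_distrib[symmetric])
      moreover have "x + y = (s + t) *\<^sub>R (z - v1)"
        using st by (simp add: x y z_def scaleR_diff_right scaleR_add_right scaleR_add_left)
      ultimately show ?thesis using st by (force simp: C_def)
    qed
    then show "x + y \<in> C \<and> p x + p y \<le> p (x + y)" by (simp add: p.add)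
  qed
  then obtain q where q: "linear q" "\<And>x. q x \<le> e * norm x" "\<And>x. x \<in> C \<Longrightarrow> p x \<le> q x" by blast
  have "\<bar>q w\<bar> \<le> e * norm w" for w
    using q(2)[of w] q(2)[of "- w"] linear_neg[OF q(1), of w] by simp
  moreover have "p v - q v \<le> p v1 - q v1" if "v \<in> B" for v
  proof -
    have "v - v1 \<in> C" using that by (force simp: C_def intro: exI[of _ 1])
    then show ?thesis using q(3) linear_diff[OF q(1)] by (fastforce simp: p.diff)
  qed
  ultimately show ?thesis using q(1) v1(1) by blast
qed

subsection \<open>Functionals dominated on a fragmented compact set\<close>

text \<open>
  Passing to the discrete topology makes the type of bounded continuous functions the Banach space
  of all bounded functions. The topology of \<open>'p\<close> itself enters only through assumptions on \<open>K\<close>.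
\<close>

type_synonym 'p bfun = "'p discrete \<Rightarrow>\<^sub>C real"

definition ev :: "'p bfun \<Rightarrow> 'p \<Rightarrow> real" where
  "ev w k = apply_bcontfun w (discrete k)"

definition to_bfun :: "('p \<Rightarrow> real) \<Rightarrow> 'p bfun" where
  "to_bfun f = Bcontfun (\<lambda>d. f (of_discrete d))"

lemma ev_to_bfun:
  assumes "\<And>k. \<bar>f k\<bar> \<le> b"
  shows "ev (to_bfun f) k = f k"
proof -
  have "continuous_on UNIV (\<lambda>d. f (of_discrete d))"
    by (simp add: continuous_on_open_vimage open_discrete)
  then have "(\<lambda>d. f (of_discrete d)) \<in> bcontfun"
    using assms by (intro bcontfun_normI[of _ b]) auto
  then show ?thesis
    by (simp add: ev_def to_bfun_def Bcontfun_inverse discrete_inverse)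
qed

lemma ev_simps [simp]:
  "ev (u + v) k = ev u k + ev v k" "ev (u - v) k = ev u k - ev v k"
  "ev (- v) k = - ev v k" "ev (c *\<^sub>R v) k = c * ev v k" "ev 0 k = 0"
  by (simp_all add: ev_def)

lemma abs_ev_le: "\<bar>ev w k\<bar> \<le> norm w"
  using norm_bounded[of w "discrete k"] by (simp add: ev_def)

lemma ev_le_norm: "ev w k \<le> norm w"
  using abs_ev_le[of w k] by simp

lemma norm_bfun_le:
  assumes "\<And>k. \<bar>ev w k\<bar> \<le> b"
  shows "norm w \<le> b"
proof (rule norm_bound)
  fix d show "norm (apply_bcontfun w d) \<le> b"
    using assms[of "of_discrete d"] by (simp add: ev_def of_discrete_inverse)
qed

lemma bfun_eqI:
  assumes "\<And>k. ev u k = ev v k"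
  shows "u = v"
  using norm_bfun_le[of "u - v" 0] assms by simp

lemma bounded_linear_ev: "bounded_linear (\<lambda>w. ev w k)"
  by (rule bounded_linear_intro[of _ 1]) (auto simp: abs_ev_le)

text \<open>
  Zorn's lemma is applied to triples \<open>(F, l, r)\<close>: a closed set \<open>F\<close> still to be treated, the mass \<open>l\<close>
  already replaced by point evaluations, and the remaining functional \<open>r\<close>, which is dominated by
  \<open>(1 - l) sup\<^sub>F\<close>. Along a chain the remainders converge in norm, since they change by at most the
  increase of \<open>l\<close>. If \<open>F\<close> is nonempty, extend \<open>r\<close> to all bounded functions and split off a piece
  of \<open>F\<close> of small oscillation by multiplying with an indicator function.
\<close>

lemma fragmented_functional_approx:
  fixes V :: "'p::topological_space bfun set" and p :: "'p bfun \<Rightarrow> real"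
  assumes V: "subspace V" and K: "compact K" "closed K"
    and cont: "\<And>v. v \<in> V \<Longrightarrow> continuous_on K (ev v)"
    and frag: "\<And>F. F \<subseteq> K \<Longrightarrow> F \<noteq> {} \<Longrightarrow> \<exists>U. open U \<and> F \<inter> U \<noteq> {} \<and>
        (\<forall>k\<in>F \<inter> U. \<forall>k'\<in>F \<inter> U. \<forall>v\<in>V. \<bar>ev v k - ev v k'\<bar> \<le> \<epsilon> * norm v)"
    and F0: "F0 \<subseteq> K" "closed F0" and p: "linear p"
    and pF: "\<And>v c. v \<in> V \<Longrightarrow> \<forall>k\<in>F0. ev v k \<le> c \<Longrightarrow> p v \<le> c"
    and \<epsilon>: "0 \<le> \<epsilon>" and \<eta>: "0 < \<eta>"
  shows "\<exists>(n::nat) l a. (\<forall>i<n. 0 \<le> l i \<and> a i \<in> F0) \<and> (\<Sum>i<n. l i) \<le> 1 \<and>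
      (\<forall>v\<in>V. \<bar>p v - (\<Sum>i<n. l i * ev v (a i))\<bar> \<le> (\<epsilon> + \<eta>) * norm v)"
proof -
  \<comment> \<open>Each unit of mass moved costs \<open>\<epsilon>\<close>, hence
    \<open>l * \<epsilon>\<close>. The arbitrary extra error \<open>\<eta>\<close> lets the property
    pass to the supremum of a chain, where an element of the chain close to the supremum supplies
    the finite combination.\<close>
  define approx where "approx l r \<longleftrightarrow> (\<forall>\<eta>>0. \<exists>(n::nat) m a. (\<forall>i<n. 0 \<le> m i \<and> a i \<in> F0) \<and> (\<Sum>i<n. m i) \<le> l \<and>
      (\<forall>v\<in>V. \<bar>p v - r v - (\<Sum>i<n. m i * ev v (a i))\<bar> \<le> (l * \<epsilon> + \<eta>) * norm v))" for l r
  \<comment> \<open>Remainders are set to 0 off \<open>V\<close>, so their values on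
    \<open>V\<close> determine them; the order is antisymmetric only because of this.\<close>
  define linV where "linV r \<longleftrightarrow> (\<forall>u\<in>V. \<forall>v\<in>V. r (u + v) = r u + r v) \<and> (\<forall>c. \<forall>v\<in>V. r (c *\<^sub>R v) = c * r v) \<and> (\<forall>v. v \<notin> V \<longrightarrow> r v = 0)"
    for r :: "'p bfun \<Rightarrow> real"
  \<comment> \<open>Quantifying over upper bounds \<open>c\<close> instead of taking a supremum
    covers \<open>F = {}\<close>: then \<open>c = 0\<close> is admissible, and linearity forces
    \<open>r\<close> to vanish on \<open>V\<close>.\<close>
  define dom where "dom F l r \<longleftrightarrow> (\<forall>v\<in>V. \<forall>c. (\<forall>k\<in>F. ev v k \<le> c) \<longrightarrow> r v \<le> (1 - l) * c)" for F l r
  define A where "A = {(F, l, r). F \<subseteq> F0 \<and> closed F \<and> 0 \<le> l \<and> l \<le> 1 \<and> linV r \<and> dom F l r \<and> approx l r}"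
  define P where "P s s' = (case (s, s') of ((F, l, r), (F', l', r')) \<Rightarrow>
      F' \<subseteq> F \<and> l \<le> l' \<and> (\<forall>v\<in>V. \<bar>r v - r' v\<bar> \<le> (l' - l) * norm v))"
    for s s' :: "'p set \<times> real \<times> ('p bfun \<Rightarrow> real)"
  have linV_ext: "r = r'" if "linV r" "linV r'" "\<And>v. v \<in> V \<Longrightarrow> r v = r' v" for r r'
    using that unfolding linV_def by (intro ext) metis
  have Vadd: "u + v \<in> V" if "u \<in> V" "v \<in> V" for u v using V that by (simp add: subspace_add)
  have Vscale: "c *\<^sub>R v \<in> V" if "v \<in> V" for c v using V that by (simp add: subspace_scale)
  have po: "partial_order_on A (relation_of P A)"
    unfolding partial_order_on_def preorder_on_def
  proof (intro conjI)
    show "refl_on A (relation_of P A)" by (auto simp: refl_on_def relation_of_def P_def)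
    show "relation_of P A \<subseteq> A \<times> A" by (auto simp: relation_of_def)
    show "trans (relation_of P A)"
    proof (rule transI)
      fix s s' s'' assume "(s, s') \<in> relation_of P A" "(s', s'') \<in> relation_of P A"
      moreover obtain F l r F' l' r' F'' l'' r'' where "s = (F, l, r)" "s' = (F', l', r')" "s'' = (F'', l'', r'')"
        by (metis prod_cases3)
      moreover have "\<bar>r v - r'' v\<bar> \<le> (l'' - l) * norm v"
        if "\<bar>r v - r' v\<bar> \<le> (l' - l) * norm v" "\<bar>r' v - r'' v\<bar> \<le> (l'' - l') * norm v" for v
        using that by (simp add: algebra_simps)
      ultimately show "(s, s'') \<in> relation_of P A"
        by (auto simp: relation_of_def P_def)
    qed
    show "antisym (relation_of P A)"
    proof (rule antisymI)
      fix s s' assume *: "(s, s') \<in> relation_of P A" "(s', s) \<in> relation_of P A"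
      obtain F l r F' l' r' where s: "s = (F, l, r)" "s' = (F', l', r')"
        by (metis prod_cases3)
      have ll: "F = F'" "l = l'" using * by (auto simp: s relation_of_def P_def)
      moreover have "r = r'"
        using * ll by (intro linV_ext) (auto simp: s relation_of_def P_def A_def)
      ultimately show "s = s'" by (simp add: s)
    qed
  qed
  have "\<exists>m\<in>A. \<forall>a\<in>A. P m a \<longrightarrow> a = m"
  proof (rule predicate_Zorn[OF po])
    fix C assume C: "C \<in> Chains (relation_of P A)"
    show "\<exists>u\<in>A. \<forall>a\<in>C. P a u"
    proof (cases "C = {}")
      case True
      define r0 where "r0 v = (if v \<in> V then p v else 0)" for v
      have "linV r0" unfolding linV_def r0_def
        using linear_add[OF p] linear_scale[OF p] Vadd Vscale by auto
      moreover have "approx 0 r0" unfolding approx_def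
        by (intro allI impI exI[of _ 0]) (auto simp: r0_def)
      ultimately have "(F0, 0, r0) \<in> A" using F0 pF by (auto simp: A_def dom_def r0_def)
      then show ?thesis using True by blast
    next
      case False
      define FF where "FF s = fst s" for s :: "'p set \<times> real \<times> ('p bfun \<Rightarrow> real)"
      define LL where "LL s = fst (snd s)" for s :: "'p set \<times> real \<times> ('p bfun \<Rightarrow> real)"
      define RR where "RR s = snd (snd s)" for s :: "'p set \<times> real \<times> ('p bfun \<Rightarrow> real)"
      have CA: "FF s \<subseteq> F0" "closed (FF s)" "0 \<le> LL s" "LL s \<le> 1" "linV (RR s)" "dom (FF s) (LL s) (RR s)" "approx (LL s) (RR s)"
        if "s \<in> C" for s
      proof -
        have "s \<in> A" using C that by (auto simp: Chains_def relation_of_def)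
        then show "FF s \<subseteq> F0" "closed (FF s)" "0 \<le> LL s" "LL s \<le> 1" "linV (RR s)" "dom (FF s) (LL s) (RR s)" "approx (LL s) (RR s)"
          by (auto simp: A_def FF_def LL_def RR_def split: prod.splits)
      qed
      have Pc: "P s s' \<longleftrightarrow> FF s' \<subseteq> FF s \<and> LL s \<le> LL s' \<and> (\<forall>v\<in>V. \<bar>RR s v - RR s' v\<bar> \<le> (LL s' - LL s) * norm v)" for s s'
        by (auto simp: P_def FF_def LL_def RR_def split: prod.splits)
      have tot: "P s s' \<or> P s' s" if "s \<in> C" "s' \<in> C" for s s'
        using C that by (auto simp: Chains_def relation_of_def)
      have near: "\<bar>RR s v - RR s' v\<bar> \<le> \<bar>LL s - LL s'\<bar> * norm v" if "s \<in> C" "s' \<in> C" "v \<in> V" for s s' v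
        using tot[OF that(1,2)] that(3) by (auto simp: Pc abs_minus_commute)
      define L where "L = Sup (LL ` C)"
      have ba: "bdd_above (LL ` C)" using CA(4) by (intro bdd_aboveI2[of _ _ 1])
      have LL_le: "LL s \<le> L" if "s \<in> C" for s unfolding L_def using that ba by (auto intro: cSup_upper)
      have L1: "L \<le> 1" unfolding L_def using False CA(4) by (intro cSup_least) auto
      have L0: "0 \<le> L" using False LL_le CA(3) by (meson equals0I order_trans)
      have ex: "\<exists>s\<in>C. L - e < LL s" if "0 < e" for e
      proof -
        have "L - e < Sup (LL ` C)" using that by (simp add: L_def)
        then show ?thesis using less_cSup_iff[OF _ ba] False by auto
      qed
      have "\<forall>n. \<exists>s\<in>C. L - 1 / Suc n < LL s" using ex by simp
      \<comment> \<open>The chain may be uncountable, but a sequence along which the masses tend to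
        their supremum determines the limit, since remainders differ by at most the difference of
        their masses.\<close>
      then obtain S where S: "\<And>n. S n \<in> C" "\<And>n. L - 1 / Suc n < LL (S n)" by metis
      have Slim: "(\<lambda>n. LL (S n)) \<longlonglongrightarrow> L"
      proof (rule tendsto_sandwich)
        have "(\<lambda>n. L - 1 / Suc n) \<longlonglongrightarrow> L - 0" by (intro tendsto_diff tendsto_const LIMSEQ_Suc[OF lim_const_over_n])
        then show "(\<lambda>n. L - 1 / Suc n) \<longlonglongrightarrow> L" by simp
        show "\<forall>\<^sub>F n in sequentially. L - 1 / real (Suc n) \<le> LL (S n)" using S(2) by (intro always_eventually) (auto intro: less_imp_le)
        show "\<forall>\<^sub>F n in sequentially. LL (S n) \<le> L" using LL_le S(1) by (intro always_eventually) auto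
      qed simp
      have conv: "convergent (\<lambda>n. RR (S n) v)" if v: "v \<in> V" for v
      proof -
        have "Cauchy (\<lambda>n. RR (S n) v)"
        proof (rule CauchyI)
          fix e :: real assume e: "0 < e"
          have "Cauchy (\<lambda>n. LL (S n))" using Slim by (rule LIMSEQ_imp_Cauchy)
          then obtain M where M: "\<And>m n. m \<ge> M \<Longrightarrow> n \<ge> M \<Longrightarrow> norm (LL (S m) - LL (S n)) < e / (norm v + 1)"
            using CauchyD[of "\<lambda>n. LL (S n)" "e / (norm v + 1)"] e by (auto simp: add_nonneg_pos)
          have "norm (RR (S m) v - RR (S n) v) < e" if "m \<ge> M" "n \<ge> M" for m n
          proof -
            have "norm (RR (S m) v - RR (S n) v) \<le> \<bar>LL (S m) - LL (S n)\<bar> * norm v"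
              using near[OF S(1) S(1) v] by simp
            also have "\<dots> \<le> \<bar>LL (S m) - LL (S n)\<bar> * (norm v + 1)" by (intro mult_left_mono) auto
            also have "\<dots> < e" using M[OF that] by (simp add: pos_less_divide_eq add_nonneg_pos)
            finally show ?thesis .
          qed
          then show "\<exists>M. \<forall>m\<ge>M. \<forall>n\<ge>M. norm (RR (S m) v - RR (S n) v) < e" by blast
        qed
        then show ?thesis by (rule Cauchy_convergent)
      qed
      define r where "r v = (if v \<in> V then lim (\<lambda>n. RR (S n) v) else 0)" for v
      have rlim: "(\<lambda>n. RR (S n) v) \<longlonglongrightarrow> r v" if "v \<in> V" for v
        using conv[OF that] that by (simp add: r_def convergent_LIMSEQ_iff)
      have linr: "linV r" unfolding linV_def
      proof (intro conjI ballI allI impI)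
        fix u v assume uv: "u \<in> V" "v \<in> V"
        have "(\<lambda>n. RR (S n) (u + v)) = (\<lambda>n. RR (S n) u + RR (S n) v)"
          using CA(5)[OF S(1)] uv by (auto simp: linV_def)
        then show "r (u + v) = r u + r v"
          using rlim[OF Vadd[OF uv]] tendsto_add[OF rlim[OF uv(1)] rlim[OF uv(2)]] LIMSEQ_unique by metis
      next
        fix c v assume v: "v \<in> V"
        have "(\<lambda>n. RR (S n) (c *\<^sub>R v)) = (\<lambda>n. c * RR (S n) v)"
          using CA(5)[OF S(1)] v by (auto simp: linV_def)
        then show "r (c *\<^sub>R v) = c * r v"
          using rlim[OF Vscale[OF v, of c]] tendsto_mult_left[OF rlim[OF v], of c] LIMSEQ_unique by metis
      qed (simp add: r_def)
      have rnear: "\<bar>RR s v - r v\<bar> \<le> (L - LL s) * norm v" if s: "s \<in> C" and v: "v \<in> V" for s v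
      proof (rule LIMSEQ_le)
        show "(\<lambda>n. \<bar>RR s v - RR (S n) v\<bar>) \<longlonglongrightarrow> \<bar>RR s v - r v\<bar>" by (intro tendsto_intros rlim v)
        have "(\<lambda>n. \<bar>LL s - LL (S n)\<bar> * norm v) \<longlonglongrightarrow> \<bar>LL s - L\<bar> * norm v" by (intro tendsto_intros Slim)
        then show "(\<lambda>n. \<bar>LL s - LL (S n)\<bar> * norm v) \<longlonglongrightarrow> (L - LL s) * norm v" using LL_le[OF s] by simp
        show "\<exists>N. \<forall>n\<ge>N. \<bar>RR s v - RR (S n) v\<bar> \<le> \<bar>LL s - LL (S n)\<bar> * norm v"
          using near[OF s S(1) v] by blast
      qed
      define G where "G = \<Inter>(FF ` C)"
      have "dom G L r" unfolding dom_def
      proof (intro ballI allI impI)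
        fix v c assume v: "v \<in> V" and c: "\<forall>k\<in>G. ev v k \<le> c"
        show "r v \<le> (1 - L) * c"
        proof (rule field_le_epsilon)
          fix e :: real assume e: "0 < e"
          define d where "d = e / (norm v + \<bar>c\<bar> + 2 + e)"
          have den: "0 < norm v + \<bar>c\<bar> + 2 + e" using e by (simp add: add_nonneg_pos)
          have d: "0 < d" "d < 1" "d * (norm v + \<bar>c\<bar> + 2) \<le> e"
            using e den by (auto simp: d_def field_simps add_nonneg_pos)
          \<comment> \<open>Compactness: if every set of the chain met the closed set where
            \<open>ev v\<close> is at least \<open>c + d\<close>, so would their intersection
            \<open>G\<close>, on which \<open>ev v\<close> is at most \<open>c\<close>.\<close>
          have "\<exists>s\<in>C. \<forall>k\<in>FF s. ev v k < c + d"
          proof (rule ccontr)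
            assume no: "\<not> (\<exists>s\<in>C. \<forall>k\<in>FF s. ev v k < c + d)"
            define H where "H s = FF s \<inter> {k \<in> K. c + d \<le> ev v k}" for s
            have clK: "closed {k \<in> K. c + d \<le> ev v k}"
              using continuous_on_closed_Collect_le[OF continuous_on_const cont[OF v] K(2), of "c + d"] by simp
            have "K \<inter> \<Inter>(H ` C) \<noteq> {}"
            proof (rule compact_imp_fip_image[OF K(1)])
              fix s assume "s \<in> C" then show "closed (H s)" using CA(2)[of s] clK by (simp add: H_def closed_Int)
            next
              fix I' assume I': "finite I'" "I' \<subseteq> C"
              have "\<exists>s\<in>C. \<forall>s'\<in>I'. FF s \<subseteq> FF s'"
                using I'
              proof (induct rule: finite_induct)
                case empty then show ?case using False by auto
              next
                case (insert x I)
                then obtain s where "s \<in> C" "\<forall>s'\<in>I. FF s \<subseteq> FF s'" by auto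
                then show ?case using tot[of x s] insert.prems unfolding Pc by blast
              qed
              then obtain s where s: "s \<in> C" "\<forall>s'\<in>I'. FF s \<subseteq> FF s'" by blast
              obtain k where k: "k \<in> FF s" "c + d \<le> ev v k" using no s(1) by (meson not_le)
              have kK: "k \<in> K" using k(1) CA(1)[OF s(1)] F0(1) by blast
              have "k \<in> H s'" if "s' \<in> I'" for s'
                using k kK s(2)[rule_format, OF that] by (auto simp: H_def)
              then have "k \<in> K \<inter> \<Inter>(H ` I')" using kK by auto
              then show "K \<inter> \<Inter>(H ` I') \<noteq> {}" by blast
            qed
            then obtain k where "k \<in> K" "\<And>s. s \<in> C \<Longrightarrow> k \<in> H s" by blast
            then have "k \<in> G" "c + d \<le> ev v k" using False by (auto simp: G_def H_def)
            then show False using c d(1) by force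
          qed
          then obtain s1 where s1: "s1 \<in> C" "\<forall>k\<in>FF s1. ev v k < c + d" by blast
          obtain s2 where s2: "s2 \<in> C" "L - d < LL s2" using ex d by blast
          have "\<exists>s\<in>C. (\<forall>k\<in>FF s. ev v k < c + d) \<and> L - d < LL s"
            using tot[OF s1(1) s2(1)] s1 s2 unfolding Pc by force
          then obtain s where s: "s \<in> C" "\<forall>k\<in>FF s. ev v k < c + d" "L - d < LL s" by blast
          have "\<forall>k\<in>FF s. ev v k \<le> c + d" using s(2) by force
          then have "RR s v \<le> (1 - LL s) * (c + d)" using CA(6)[OF s(1)] v by (simp add: dom_def)
          moreover have "\<bar>RR s v - r v\<bar> \<le> (L - LL s) * norm v" by (rule rnear[OF s(1) v])
          moreover have "(L - LL s) * norm v \<le> d * norm v" using s(3) by (intro mult_right_mono) auto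
          moreover have "(1 - LL s) * (c + d) \<le> (1 - L) * c + d * \<bar>c\<bar> + d"
          proof -
            have "(1 - LL s) * (c + d) = (1 - L) * c + (L - LL s) * c + (1 - LL s) * d" by (simp add: algebra_simps)
            also have "(L - LL s) * c \<le> (L - LL s) * \<bar>c\<bar>" using LL_le[OF s(1)] by (intro mult_left_mono) auto
            also have "(L - LL s) * \<bar>c\<bar> \<le> d * \<bar>c\<bar>" using s(3) by (intro mult_right_mono) auto
            also have "(1 - LL s) * d \<le> 1 * d" using CA(3)[OF s(1)] d(1) by (intro mult_right_mono) auto
            finally show ?thesis by simp
          qed
          ultimately have "r v \<le> (1 - L) * c + d * (norm v + \<bar>c\<bar> + 1)" by (simp add: algebra_simps abs_le_iff)
          also have "\<dots> \<le> (1 - L) * c + e" using d by (simp add: algebra_simps)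
          finally show "r v \<le> (1 - L) * c + e" .
        qed
      qed
      moreover have "approx L r" unfolding approx_def
      proof (intro allI impI)
        fix e :: real assume e: "0 < e"
        obtain s where s: "s \<in> C" "L - e / 2 < LL s" using ex[of "e / 2"] e by auto
        obtain n :: nat and m a where a: "\<forall>i<n. 0 \<le> m i \<and> a i \<in> F0" "(\<Sum>i<n. m i) \<le> LL s"
          "\<And>v. v \<in> V \<Longrightarrow> \<bar>p v - RR s v - (\<Sum>i<n. m i * ev v (a i))\<bar> \<le> (LL s * \<epsilon> + e / 2) * norm v"
          using CA(7)[OF s(1), unfolded approx_def, rule_format, OF half_gt_zero[OF e]] by blast
        have "\<bar>p v - r v - (\<Sum>i<n. m i * ev v (a i))\<bar> \<le> (L * \<epsilon> + e) * norm v" if v: "v \<in> V" for v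
        proof -
          have "(L - LL s) * norm v \<le> e / 2 * norm v" using s(2) by (intro mult_right_mono) auto
          moreover have "LL s * \<epsilon> * norm v \<le> L * \<epsilon> * norm v" using LL_le[OF s(1)] \<epsilon> by (intro mult_right_mono) auto
          ultimately show ?thesis using a(3)[OF v] rnear[OF s(1) v] by (simp add: algebra_simps)
        qed
        moreover have "(\<Sum>i<n. m i) \<le> L" using a(2) LL_le[OF s(1)] by simp
        ultimately show "\<exists>(n::nat) m a. (\<forall>i<n. 0 \<le> m i \<and> a i \<in> F0) \<and> sum m {..<n} \<le> L \<and>
            (\<forall>v\<in>V. \<bar>p v - r v - (\<Sum>i<n. m i * ev v (a i))\<bar> \<le> (L * \<epsilon> + e) * norm v)"
          using a(1) by (intro exI[of _ n] exI[of _ m] exI[of _ a] conjI ballI) auto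
      qed
      moreover have "G \<subseteq> F0" using False CA(1) unfolding G_def by blast
      moreover have "closed G" using CA(2) unfolding G_def by (intro closed_INT) auto
      ultimately have "(G, L, r) \<in> A" using L0 L1 linr by (simp add: A_def)
      moreover have "P s (G, L, r)" if "s \<in> C" for s
        using that rnear LL_le unfolding Pc by (auto simp: FF_def LL_def RR_def G_def)
      ultimately show ?thesis by blast
    qed
  qed
  then obtain F l r where m: "(F, l, r) \<in> A" and max: "\<And>a. a \<in> A \<Longrightarrow> P (F, l, r) a \<Longrightarrow> a = (F, l, r)"
    by (metis prod_cases3)
  have F: "F \<subseteq> F0" "closed F" and l: "0 \<le> l" "l \<le> 1" and r: "linV r" "dom F l r" "approx l r"
    using m by (auto simp: A_def)
  have "F = {}"
  proof (rule ccontr)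
    assume ne: "F \<noteq> {}"
    obtain U where U: "open U" "F \<inter> U \<noteq> {}"
      "\<And>k k' v. k \<in> F \<inter> U \<Longrightarrow> k' \<in> F \<inter> U \<Longrightarrow> v \<in> V \<Longrightarrow> \<bar>ev v k - ev v k'\<bar> \<le> \<epsilon> * norm v"
      using frag[OF order_trans[OF F(1) F0(1)] ne] by blast
    obtain k0 where k0: "k0 \<in> F \<inter> U" using U(2) by blast
    define S where "S w = (1 - l) * (SUP k\<in>F. ev w k)" for w
    have ba: "bdd_above ((\<lambda>k. ev w k) ` F)" for w
      by (rule bdd_aboveI2[OF ev_le_norm])
    have S_le: "S w \<le> (1 - l) * c" if "\<And>k. k \<in> F \<Longrightarrow> ev w k \<le> c" for w c
      unfolding S_def using that ne l by (intro mult_left_mono cSUP_least) auto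
    have subS: "sublinear S"
    proof (rule sublinearI)
      fix x y
      have "(SUP k\<in>F. ev (x + y) k) \<le> (SUP k\<in>F. ev x k) + (SUP k\<in>F. ev y k)"
        using ne by (intro cSUP_least) (auto intro!: add_mono cSUP_upper ba)
      then have "(1 - l) * (SUP k\<in>F. ev (x + y) k) \<le> (1 - l) * ((SUP k\<in>F. ev x k) + (SUP k\<in>F. ev y k))"
        using l by (intro mult_left_mono) auto
      then show "S (x + y) \<le> S x + S y" by (simp add: S_def algebra_simps)
    next
      fix c x assume "0 < (c::real)"
      then have "S (c *\<^sub>R x) \<le> (1 - l) * (c * (SUP k\<in>F. ev x k))"
        by (intro S_le) (auto intro!: mult_left_mono cSUP_upper ba)
      then show "S (c *\<^sub>R x) \<le> c * S x" by (simp add: S_def algebra_simps)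
    qed (use ne in \<open>simp add: S_def\<close>)
    \<comment> \<open>Cutting with \<open>U\<close> leads out of \<open>V\<close>, so
      \<open>r\<close> is first extended to all bounded functions. Domination by the supremum over
      \<open>F\<close> makes the extension monotone with \<open>Q one = 1 - l\<close>, in effect a
      finitely additive measure on \<open>F\<close>.\<close>
    have "\<exists>Q. linear Q \<and> (\<forall>x. Q x \<le> S x) \<and> (\<forall>x\<in>V. r x \<le> Q x)"
    proof (rule mazur_orlicz[OF subS])
      show "0 \<in> V" using V by (simp add: subspace_0)
      show "x + y \<in> V \<and> r x + r y \<le> r (x + y)" if "x \<in> V" "y \<in> V" for x y
        using that r(1) Vadd by (auto simp: linV_def)
      show "c *\<^sub>R x \<in> V \<and> c * r x \<le> r (c *\<^sub>R x)" if "x \<in> V" for c x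
        using that r(1) Vscale by (auto simp: linV_def)
      show "r x \<le> S x" if "x \<in> V" for x
        using that r(2) unfolding dom_def S_def by (auto intro!: cSUP_upper ba)
    qed
    then obtain Q where Q: "linear Q" "\<And>x. Q x \<le> S x" "\<And>x. x \<in> V \<Longrightarrow> r x \<le> Q x" by blast
    have Qr: "Q v = r v" if v: "v \<in> V" for v
    proof -
      have "r (- v) = - r v" using r(1) v unfolding linV_def by (metis mult_minus1 scaleR_minus1_left)
      moreover have "- v \<in> V" using Vscale[OF v, of "-1"] by simp
      ultimately show ?thesis using Q(3)[OF v] Q(3)[of "- v"] linear_neg[OF Q(1), of v] by simp
    qed
    have Qmono: "Q x \<le> Q y" if "\<And>k. k \<in> F \<Longrightarrow> ev x k \<le> ev y k" for x y
    proof -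
      have "Q (x - y) \<le> (1 - l) * 0" by (rule order_trans[OF Q(2) S_le]) (use that in auto)
      then show ?thesis using linear_diff[OF Q(1)] by simp
    qed
    define ind where "ind B w = to_bfun (\<lambda>k. if k \<in> B then ev w k else 0)" for B :: "'p set" and w
    have ev_ind: "ev (ind B w) k = (if k \<in> B then ev w k else 0)" for B w k
      unfolding ind_def by (rule ev_to_bfun[of _ "norm w"]) (simp add: abs_ev_le)
    define one :: "'p bfun" where "one = to_bfun (\<lambda>k. 1)"
    have ev_one: "ev one k = 1" for k unfolding one_def by (rule ev_to_bfun[of _ 1]) simp
    define c where "c w = Q (ind U w)" for w
    define r' where "r' v = (if v \<in> V then Q (ind (- U) v) else 0)" for v
    define \<mu> where "\<mu> = Q (ind U one)"
    have split: "Q w = Q (ind U w) + Q (ind (- U) w)" for w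
    proof -
      have "w = ind U w + ind (- U) w" by (rule bfun_eqI) (simp add: ev_ind)
      then show ?thesis using linear_add[OF Q(1)] by metis
    qed
    have ind_lin: "ind B (u + v) = ind B u + ind B v" "ind B (x *\<^sub>R v) = x *\<^sub>R ind B v" for B u v x
      by (rule bfun_eqI, simp add: ev_ind)+
    have Qone: "Q one = 1 - l"
    proof -
      have "Q one \<le> (1 - l) * 1" by (rule order_trans[OF Q(2) S_le]) (simp add: ev_one)
      moreover have "Q (- one) \<le> (1 - l) * (- 1)" by (rule order_trans[OF Q(2) S_le]) (simp add: ev_one)
      ultimately show ?thesis using linear_neg[OF Q(1), of one] by simp
    qed
    have \<mu>0: "0 \<le> \<mu>" unfolding \<mu>_def using Qmono[of 0 "ind U one"] linear_0[OF Q(1)] by (simp add: ev_ind ev_one)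
    have \<mu>1: "\<mu> \<le> 1 - l"
    proof -
      have "\<mu> \<le> Q one" unfolding \<mu>_def by (rule Qmono) (simp add: ev_ind ev_one)
      then show ?thesis by (simp add: Qone)
    qed
    \<comment> \<open>On \<open>F \<inter> U\<close> each \<open>v\<close> in \<open>V\<close> stays
      within \<open>\<epsilon> * norm v\<close> of its value at \<open>k0\<close>; monotonicity
      turns this into closeness of the cut-off piece to the mass \<open>\<mu>\<close> placed at
      \<open>k0\<close>.\<close>
    have cnear: "\<bar>c v - \<mu> * ev v k0\<bar> \<le> \<mu> * \<epsilon> * norm v" if v: "v \<in> V" for v
    proof -
      have b: "\<bar>ev v k - ev v k0\<bar> \<le> \<epsilon> * norm v" if "k \<in> F" "k \<in> U" for k
        using U(3)[of k k0 v] that k0 v by auto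
      have "Q (ind U v) \<le> Q ((ev v k0 + \<epsilon> * norm v) *\<^sub>R ind U one)"
        by (rule Qmono) (use b in \<open>auto simp: ev_ind ev_one abs_le_iff algebra_simps\<close>)
      moreover have "Q ((ev v k0 - \<epsilon> * norm v) *\<^sub>R ind U one) \<le> Q (ind U v)"
        by (rule Qmono) (use b in \<open>auto simp: ev_ind ev_one abs_le_iff algebra_simps\<close>)
      ultimately show ?thesis unfolding c_def \<mu>_def
        by (simp add: linear_scale[OF Q(1)] linear_neg[OF Q(1)] linear_add[OF Q(1)] linear_diff[OF Q(1)] algebra_simps abs_le_iff)
    qed
    \<comment> \<open>This is the order condition: the remainder changes by no more than the
      increase \<open>\<mu>\<close> of the moved mass.\<close>
    have cnorm: "\<bar>c v\<bar> \<le> \<mu> * norm v" for v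
    proof -
      have "Q (ind U v) \<le> Q (norm v *\<^sub>R ind U one)"
        by (rule Qmono) (simp add: ev_ind ev_one ev_le_norm)
      moreover have "Q ((- norm v) *\<^sub>R ind U one) \<le> Q (ind U v)"
        by (rule Qmono) (use abs_ev_le[of v] in \<open>auto simp: ev_ind ev_one abs_le_iff minus_le_iff\<close>)
      ultimately show ?thesis unfolding c_def \<mu>_def
        by (simp add: linear_scale[OF Q(1)] linear_neg[OF Q(1)] linear_add[OF Q(1)] linear_diff[OF Q(1)] algebra_simps abs_le_iff)
    qed
    have rc: "r v = c v + r' v" if "v \<in> V" for v
      using split[of v] Qr[OF that] that by (simp add: c_def r'_def)
    have "linV r'" unfolding linV_def r'_def
      using linear_add[OF Q(1)] linear_scale[OF Q(1)] Vadd Vscale by (auto simp: ind_lin)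
    moreover have "dom (F - U) (l + \<mu>) r'" unfolding dom_def
    proof (intro ballI allI impI)
      fix v x assume v: "v \<in> V" and x: "\<forall>k\<in>F - U. ev v k \<le> x"
      have "r' v \<le> Q (x *\<^sub>R ind (- U) one)" using v
        by (auto simp: r'_def intro!: Qmono) (use x in \<open>auto simp: ev_ind ev_one\<close>)
      also have "\<dots> = (1 - (l + \<mu>)) * x"
      proof -
        have "Q (ind (- U) one) = 1 - (l + \<mu>)" using split[of one] Qone by (simp add: \<mu>_def)
        then show ?thesis using linear_scale[OF Q(1)] by simp
      qed
      finally show "r' v \<le> (1 - (l + \<mu>)) * x" .
    qed
    moreover have "approx (l + \<mu>) r'" unfolding approx_def
    proof (intro allI impI)
      fix e :: real assume e: "0 < e"
      obtain n :: nat and m a where a: "\<forall>i<n. 0 \<le> m i \<and> a i \<in> F0" "(\<Sum>i<n. m i) \<le> l"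
        "\<And>v. v \<in> V \<Longrightarrow> \<bar>p v - r v - (\<Sum>i<n. m i * ev v (a i))\<bar> \<le> (l * \<epsilon> + e) * norm v"
        using r(3)[unfolded approx_def, rule_format, OF e] by blast
      define m' a' where "m' i = (if i < n then m i else \<mu>)" and "a' i = (if i < n then a i else k0)" for i
      have sum: "(\<Sum>i<Suc n. m' i * f (a' i)) = (\<Sum>i<n. m i * f (a i)) + \<mu> * f k0" for f :: "'p \<Rightarrow> real"
        by (simp add: m'_def a'_def)
      have "\<bar>p v - r' v - (\<Sum>i<Suc n. m' i * ev v (a' i))\<bar> \<le> ((l + \<mu>) * \<epsilon> + e) * norm v" if v: "v \<in> V" for v
        using a(3)[OF v] cnear[OF v] rc[OF v] unfolding sum by (simp add: algebra_simps)
      moreover have "(\<Sum>i<Suc n. m' i) \<le> l + \<mu>" using sum[of "\<lambda>_. 1"] a(2) by simp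
      moreover have "\<forall>i<Suc n. 0 \<le> m' i \<and> a' i \<in> F0"
        using a(1) \<mu>0 k0 F(1) by (auto simp: m'_def a'_def)
      ultimately show "\<exists>(n::nat) m a. (\<forall>i<n. 0 \<le> m i \<and> a i \<in> F0) \<and> sum m {..<n} \<le> l + \<mu> \<and>
            (\<forall>v\<in>V. \<bar>p v - r' v - (\<Sum>i<n. m i * ev v (a i))\<bar> \<le> ((l + \<mu>) * \<epsilon> + e) * norm v)"
        by (intro exI[of _ "Suc n"] exI[of _ m'] exI[of _ a'] conjI ballI) auto
    qed
    moreover have "closed (F - U)" using F(2) U(1) by (rule closed_Diff)
    ultimately have "(F - U, l + \<mu>, r') \<in> A" using F(1) l \<mu>0 \<mu>1 by (auto simp: A_def)
    moreover have "P (F, l, r) (F - U, l + \<mu>, r')" using \<mu>0 rc cnorm by (auto simp: P_def)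
    \<comment> \<open>The mass \<open>\<mu>\<close> may be 0; the new triple still differs, because
      \<open>F\<close> has lost \<open>k0\<close>.\<close>
    ultimately have "F - U = F" using max by blast
    then show False using k0 by blast
  qed
  then have r0: "r v = 0" if v: "v \<in> V" for v
  proof -
    have le: "r v \<le> (1 - l) * 0" if "v \<in> V" for v
      using r(2) that \<open>F = {}\<close> unfolding dom_def by blast
    moreover have "r (- v) = - r v" using r(1) v unfolding linV_def by (metis mult_minus1 scaleR_minus1_left)
    moreover have "- v \<in> V" using Vscale[OF v, of "-1"] by simp
    ultimately show ?thesis using le[OF v] le[of "- v"] by simp
  qed
  obtain n :: nat and m a where a: "\<forall>i<n. 0 \<le> m i \<and> a i \<in> F0" "(\<Sum>i<n. m i) \<le> l"
    "\<And>v. v \<in> V \<Longrightarrow> \<bar>p v - r v - (\<Sum>i<n. m i * ev v (a i))\<bar> \<le> (l * \<epsilon> + \<eta>) * norm v"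
    using r(3)[unfolded approx_def, rule_format, OF \<eta>] by blast
  have "\<bar>p v - (\<Sum>i<n. m i * ev v (a i))\<bar> \<le> (\<epsilon> + \<eta>) * norm v" if "v \<in> V" for v
  proof -
    have "(l * \<epsilon> + \<eta>) * norm v \<le> (\<epsilon> + \<eta>) * norm v"
      using l \<epsilon> mult_right_mono[of l 1 \<epsilon>] by (intro mult_right_mono) auto
    then show ?thesis using a(3)[OF that] r0[OF that] by simp
  qed
  then show ?thesis using a(1,2) l(2) by (intro exI[of _ n] exI[of _ m] exI[of _ a]) auto
qed

text \<open>Differentiate the norm of \<open>V\<close> at \<open>v1\<close> in direction \<open>v\<close>.\<close>

lemma norm_attained_face:
  fixes V :: "'p::topological_space bfun set"
  assumes V: "subspace V" and K: "compact K" "closed K"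
    and cont: "\<And>v. v \<in> V \<Longrightarrow> continuous_on K (ev v)"
    and norming: "\<And>v b. v \<in> V \<Longrightarrow> 0 \<le> b \<Longrightarrow> \<forall>k\<in>K. ev v k \<le> b \<Longrightarrow> norm v \<le> b"
    and p: "linear p" and pM: "\<And>v. v \<in> V \<Longrightarrow> p v \<le> M * norm v"
    and v1: "v1 \<in> V" "norm v1 \<le> 1" "p v1 = M"
    and v: "v \<in> V" "\<forall>k\<in>{k \<in> K. ev v1 k = 1}. ev v k \<le> c"
    and M: "0 \<le> M"
  shows "p v \<le> M * c"
proof (rule field_le_epsilon)
  fix e :: real assume e: "0 < e"
  define d where "d = e / (M + 1)"
  have d: "0 < d" "M * d \<le> e" using e M by (auto simp: d_def field_simps)
  \<comment> \<open>Only on \<open>H\<close> can \<open>v\<close> exceed the desired bound.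
    \<open>H\<close> misses the face, and compactness keeps \<open>v1\<close> at most
    \<open>1 - t\<close> on it.\<close>
  define H where "H = {k \<in> K. c + d \<le> ev v k}"
  have "closed H" unfolding H_def
    using continuous_on_closed_Collect_le[OF continuous_on_const cont[OF v(1)] K(2), of "c + d"] by simp
  then have cH: "compact H" using K(1) unfolding H_def by (metis (no_types, lifting) closed_Int_compact inf.absorb1 mem_Collect_eq subsetI)
  have "\<exists>t>0. \<forall>k\<in>H. ev v1 k \<le> 1 - t"
  proof (cases "H = {}")
    case False
    obtain k1 where k1: "k1 \<in> H" "\<And>k. k \<in> H \<Longrightarrow> ev v1 k \<le> ev v1 k1"
      using continuous_attains_sup[OF cH False continuous_on_subset[OF cont[OF v1(1)]]] by (auto simp: H_def)
    have "ev v1 k1 \<noteq> 1" using k1(1) v(2) d(1) by (force simp: H_def)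
    moreover have "ev v1 k1 \<le> 1" using ev_le_norm[of v1 k1] v1(2) by simp
    ultimately show ?thesis using k1(2) by (intro exI[of _ "1 - ev v1 k1"]) auto
  qed (auto intro: exI[of _ 1])
  then obtain t where t: "0 < t" "\<And>k. k \<in> H \<Longrightarrow> ev v1 k \<le> 1 - t" by blast
  define D where "D = norm v + \<bar>c\<bar> + d + t"
  have D: "0 < D" using d(1) t(1) by (auto simp: D_def add_nonneg_pos)
  \<comment> \<open>The step is so short that on \<open>H\<close> the amount \<open>t\<close> pays
    for \<open>s * norm v\<close> and also for a negative \<open>s * c\<close>; the minimum with 1
    keeps \<open>1 + s * (c + d)\<close> nonnegative, as \<open>norming\<close> demands.\<close>
  define s where "s = min t 1 / D"
  have s: "0 < s" "s * D \<le> t" "s * D \<le> 1" using t D by (auto simp: s_def)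
  have sb: "s * norm v + s * \<bar>c\<bar> + s * d \<le> t" "s * \<bar>c\<bar> \<le> 1"
  proof -
    have "s * D = s * norm v + s * \<bar>c\<bar> + s * d + s * t" by (simp add: D_def algebra_simps)
    moreover have "0 \<le> s * norm v" "0 \<le> s * \<bar>c\<bar>" "0 \<le> s * d" "0 \<le> s * t" using s d t by auto
    ultimately show "s * norm v + s * \<bar>c\<bar> + s * d \<le> t" "s * \<bar>c\<bar> \<le> 1" using s(2,3) by linarith+
  qed
  have sc: "- s * \<bar>c\<bar> \<le> s * c" "s * c \<le> s * \<bar>c\<bar>"
    using s(1) mult_left_mono[of "-\<bar>c\<bar>" c s] mult_left_mono[of c "\<bar>c\<bar>" s] by auto
  have vin: "v1 + s *\<^sub>R v \<in> V" using V v1(1) v(1) by (simp add: subspace_add subspace_scale)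
  have nb: "0 \<le> 1 + s * (c + d)"
  proof -
    have "s * (c + d) = s * c + s * d" by (rule distrib_left)
    then show ?thesis using sb(2) sc(1) mult_pos_pos[OF s(1) d(1)] by linarith
  qed
  have "norm (v1 + s *\<^sub>R v) \<le> 1 + s * (c + d)"
  proof (rule norming[OF vin nb], rule ballI)
    fix k assume k: "k \<in> K"
    show "ev (v1 + s *\<^sub>R v) k \<le> 1 + s * (c + d)"
    proof (cases "k \<in> H")
      case True
      have "s * ev v k \<le> s * norm v" using s(1) by (intro mult_left_mono ev_le_norm) auto
      then show ?thesis using t(2)[OF True] sb sc mult_pos_pos[OF s(1) d(1)] by (simp add: algebra_simps)
    next
      case False
      then have "s * ev v k \<le> s * (c + d)" using k s(1) by (intro mult_left_mono) (auto simp: H_def)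
      moreover have "ev v1 k \<le> 1" using ev_le_norm[of v1 k] v1(2) by simp
      ultimately show ?thesis by simp
    qed
  qed
  \<comment> \<open>Since \<open>p v1 = M\<close>, the constant terms cancel, and dividing by
    \<open>s\<close> leaves the claim up to \<open>M * d\<close>.\<close>
  then have "p (v1 + s *\<^sub>R v) \<le> M * (1 + s * (c + d))"
    using pM[OF vin] M by (meson mult_left_mono order_trans)
  then have "s * p v \<le> s * (M * c + M * d)"
    using v1(3) linear_add[OF p] linear_scale[OF p] by (simp add: algebra_simps)
  then have "p v \<le> M * c + M * d" using s(1) by simp
  then show "p v \<le> M * c + e" using d(2) by simp
qed

subsection \<open>Oscillation of vector measures with a density\<close>

text \<open>Without separability a difference of Borel functions need not be Borel, so
  \<open>f - s\<close> is treated on each of the finitely many level sets of \<open>s\<close>, where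
  it is \<open>f\<close> minus a constant.\<close>

lemma borel_measurable_norm_diff_simple:
  fixes f s :: "'m \<Rightarrow> 'e::real_normed_vector"
  assumes f: "f \<in> borel_measurable M" and s: "simple_function M s"
  shows "(\<lambda>x. norm (f x - s x)) \<in> borel_measurable M"
proof -
  have fin: "finite (s ` space M)" and ms: "\<And>c. s -` {c} \<inter> space M \<in> sets M"
    using simple_functionD[OF s] by auto
  have [measurable]: "(\<lambda>x. norm (f x - c)) \<in> borel_measurable M" for c
    by (rule borel_measurable_continuous_on[OF _ f]) (intro continuous_intros)
  have "(\<lambda>x. \<Sum>c\<in>s ` space M. indicator (s -` {c} \<inter> space M) x * norm (f x - c)) \<in> borel_measurable M"
    using ms by measurable
  moreover have "(\<Sum>c\<in>s ` space M. indicator (s -` {c} \<inter> space M) x * norm (f x - c)) = norm (f x - s x)"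
    if x: "x \<in> space M" for x
  proof -
    have "(\<Sum>c\<in>s ` space M. indicator (s -` {c} \<inter> space M) x * norm (f x - c))
        = (\<Sum>c\<in>{s x}. indicator (s -` {c} \<inter> space M) x * norm (f x - c))"
      using x fin by (intro sum.mono_neutral_right) (auto simp: indicator_def)
    then show ?thesis using x by (simp add: indicator_def)
  qed
  ultimately show ?thesis by (simp cong: measurable_cong)
qed

abbreviation "sb_integrable \<equiv> Bochner_Integration.simple_bochner_integrable"
abbreviation "sb_integral \<equiv> Bochner_Integration.simple_bochner_integral"

lemma norm_simple_bochner_integral_diff_le:
  fixes f :: "'m \<Rightarrow> 'e::real_normed_vector"
  assumes f: "f \<in> borel_measurable M"
    and s: "sb_integrable M s" and t: "sb_integrable M t"
  shows "ennreal (norm (sb_integral M s - sb_integral M t)) \<le>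
    (\<integral>\<^sup>+ x. ennreal (norm (f x - s x)) \<partial>M) + (\<integral>\<^sup>+ x. ennreal (norm (f x - t x)) \<partial>M)"
proof -
  have ss: "simple_function M s" "simple_function M t"
    using s t by (auto elim: simple_bochner_integrable.cases)
  note [measurable] = borel_measurable_norm_diff_simple[OF f ss(1)] borel_measurable_norm_diff_simple[OF f ss(2)]
  have "ennreal (norm (sb_integral M s - sb_integral M t)) =
      norm (sb_integral M (\<lambda>x. s x - t x))"
    using s t by (subst simple_bochner_integral_diff) auto
  also have "\<dots> \<le> sb_integral M (\<lambda>x. norm (s x - t x))"
    using simple_bochner_integrable_compose2[of "(-)" M "s" "t"] s t
    by (auto intro!: simple_bochner_integral_norm_bound)
  also have "\<dots> = (\<integral>\<^sup>+x. norm (s x - t x) \<partial>M)"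
    using simple_bochner_integrable_compose2[of "\<lambda>x y. norm (x - y)" M "s" "t"] s t
    by (auto intro!: simple_bochner_integral_eq_nn_integral)
  also have "\<dots> \<le> (\<integral>\<^sup>+x. ennreal (norm (f x - s x)) + ennreal (norm (f x - t x)) \<partial>M)"
  proof (rule nn_integral_mono)
    fix x
    have "norm (s x - t x) \<le> norm (f x - s x) + norm (f x - t x)"
      by (metis dual_order.refl norm_diff_triangle_le norm_minus_commute)
    then show "ennreal (norm (s x - t x)) \<le> ennreal (norm (f x - s x)) + ennreal (norm (f x - t x))"
      by (metis ennreal_leI ennreal_plus norm_ge_zero)
  qed
  also have "\<dots> = (\<integral>\<^sup>+ x. ennreal (norm (f x - s x)) \<partial>M) + (\<integral>\<^sup>+ x. ennreal (norm (f x - t x)) \<partial>M)"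
    by (rule nn_integral_add) auto
  finally show ?thesis .
qed

text \<open>The preceding estimate passes to the limit, so the integral is controlled by every
  simple function, not only by the sequence that witnesses integrability.\<close>

lemma has_bochner_integral_gen_approx:
  assumes f: "has_bochner_integral_gen M f x" and t: "sb_integrable M t"
  shows "ennreal (norm (x - sb_integral M t)) \<le> (\<integral>\<^sup>+ x. ennreal (norm (f x - t x)) \<partial>M)"
proof -
  obtain s where fm: "f \<in> borel_measurable M" and s: "\<And>i. sb_integrable M (s i)"
    and lim: "(\<lambda>i. \<integral>\<^sup>+\<omega>. ennreal (norm (f \<omega> - s i \<omega>)) \<partial>M) \<longlonglongrightarrow> 0"
      "(\<lambda>i. sb_integral M (s i)) \<longlonglongrightarrow> x"
    using f unfolding has_bochner_integral_gen_def by blast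
  have "ennreal (norm (x - sb_integral M t)) \<le> 0 + (\<integral>\<^sup>+ x. ennreal (norm (f x - t x)) \<partial>M)"
  proof (rule tendsto_le[of sequentially])
    show "(\<lambda>i. ennreal (norm (sb_integral M (s i) - sb_integral M t)))
       \<longlonglongrightarrow> ennreal (norm (x - sb_integral M t))"
      by (intro tendsto_ennrealI tendsto_norm tendsto_diff lim tendsto_const)
    show "(\<lambda>i. (\<integral>\<^sup>+\<omega>. ennreal (norm (f \<omega> - s i \<omega>)) \<partial>M) + (\<integral>\<^sup>+ x. ennreal (norm (f x - t x)) \<partial>M))
        \<longlonglongrightarrow> 0 + (\<integral>\<^sup>+ x. ennreal (norm (f x - t x)) \<partial>M)"
      by (intro tendsto_add lim tendsto_const)
  qed (auto intro!: always_eventually norm_simple_bochner_integral_diff_le[OF fm s t])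
  then show ?thesis by simp
qed

text \<open>In the resulting formula the vectors do not depend on \<open>B\<close>; only scalar
  measures do. This is the form to which the Haar estimate for sets applies.\<close>

lemma simple_bochner_integrable_indicator:
  fixes t :: "'m \<Rightarrow> 'e::real_normed_vector"
  assumes M: "finite_measure M" and t: "sb_integrable M t" and B: "B \<in> sets M"
  shows "sb_integrable M (\<lambda>x. indicator B x *\<^sub>R t x)"
    and "sb_integral M (\<lambda>x. indicator B x *\<^sub>R t x)
      = (\<Sum>c\<in>t ` space M. measure M (B \<inter> {x \<in> space M. t x = c}) *\<^sub>R c)"
proof -
  interpret finite_measure M by fact
  have st: "simple_function M t" using t by (auto elim: simple_bochner_integrable.cases)
  have sB: "simple_function M (indicator B :: _ \<Rightarrow> real)" using B by (rule simple_function_indicator)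
  have "simple_function M (\<lambda>x. indicator B x *\<^sub>R t x)"
    by (rule simple_function_compose2[OF sB st])
  then show int: "sb_integrable M (\<lambda>x. indicator B x *\<^sub>R t x)"
    by (intro simple_bochner_integrable.intros) auto
  \<comment> \<open>Partition by the value of \<open>t\<close> together with membership in
    \<open>B\<close>; cells outside \<open>B\<close> contribute 0.\<close>
  define g where "g x = (t x, x \<in> B)" for x
  have sg: "simple_function M g"
    using simple_function_compose2[OF st sB, of "\<lambda>c b. (c, b = 1)"]
    by (simp add: g_def[abs_def] indicator_eq_1_iff)
  have "sb_integral M (\<lambda>x. indicator B x *\<^sub>R t x)
      = (\<Sum>y\<in>g ` space M. measure M {x \<in> space M. g x = y} *\<^sub>R (if snd y then fst y else 0))"
    by (rule simple_bochner_integral_partition[OF int sg]) (auto simp: g_def split: if_splits)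
  also have "\<dots> = (\<Sum>y\<in>t ` space M \<times> {True}. measure M {x \<in> space M. g x = y} *\<^sub>R (if snd y then fst y else 0))"
  proof (rule sum.mono_neutral_cong)
    show "finite (t ` space M \<times> {True})" "finite (g ` space M)"
      using simple_functionD(1)[OF st] simple_functionD(1)[OF sg] by auto
    fix i assume i: "i \<in> t ` space M \<times> {True} - g ` space M"
    then have "i \<notin> g ` space M" by blast
    then have "{x \<in> space M. g x = i} = {}" by blast
    then show "measure M {x \<in> space M. g x = i} *\<^sub>R (if snd i then fst i else 0) = 0" by (simp only: measure_empty scaleR_zero_left)
  qed (auto simp: g_def)
  also have "\<dots> = (\<Sum>c\<in>t ` space M. measure M {x \<in> space M. g x = (c, True)} *\<^sub>R c)"
    by (rule sum.reindex_cong[of "\<lambda>c. (c, True)"]) (auto simp: inj_on_def)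
  also have "\<dots> = (\<Sum>c\<in>t ` space M. measure M (B \<inter> {x \<in> space M. t x = c}) *\<^sub>R c)"
    by (intro sum.cong refl arg_cong2[where f=scaleR] arg_cong[where f="measure M"]) (auto simp: g_def)
  finally show "sb_integral M (\<lambda>x. indicator B x *\<^sub>R t x)
      = (\<Sum>c\<in>t ` space M. measure M (B \<inter> {x \<in> space M. t x = c}) *\<^sub>R c)" .
qed

text \<open>An abstract Haar filtration. The index \<open>k\<close> is unrestricted to avoid side
  conditions; for the unit interval the sets with \<open>k \<ge> 2 ^ n\<close> are empty.\<close>

locale dyadic_partition = finite_measure M for M :: "'m measure" +
  fixes I :: "nat \<Rightarrow> nat \<Rightarrow> 'm set"
  assumes I_sets: "I n k \<in> sets M"
    and I_split: "I n k = I (Suc n) (2 * k) \<union> I (Suc n) (2 * k + 1)"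
    and I_disjoint: "k \<noteq> l \<Longrightarrow> I n k \<inter> I n l = {}"
    and I_measure: "measure M (I n k) \<le> (1/2) ^ n"
begin

text \<open>
  Bessel's inequality for the Haar system: \<open>\<Sum> 2\<^sup>n m(A \<inter> I n k)\<^sup>2\<close> is increasing in \<open>n\<close> and bounded.
\<close>

lemma haar_coefficients_tendsto_0:
  assumes A: "A \<in> sets M"
  shows "(\<lambda>n. \<Sum>k<2^n. \<bar>measure M (A \<inter> I (Suc n) (2 * k)) - measure M (A \<inter> I (Suc n) (2 * k + 1))\<bar>) \<longlonglongrightarrow> 0"
proof -
  define a where "a n k = measure M (A \<inter> I n k)" for n k
  define d where "d n k = a (Suc n) (2 * k) - a (Suc n) (2 * k + 1)" for n k
  define Q where "Q n = (\<Sum>k<2^n. 2^n * (a n k)^2)" for n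
  have a_split: "a n k = a (Suc n) (2 * k) + a (Suc n) (2 * k + 1)" for n k
  proof -
    have "A \<inter> I n k = (A \<inter> I (Suc n) (2 * k)) \<union> (A \<inter> I (Suc n) (2 * k + 1))"
      using I_split[of n k] by blast
    then show ?thesis unfolding a_def
      using A I_sets I_disjoint[of "2 * k" "2 * k + 1" "Suc n"]
      by (simp only:) (intro finite_measure_Union, auto)
  qed
  have a0: "0 \<le> a n k" for n k by (simp add: a_def)
  have a1: "2^n * a n k \<le> 1" for n k
  proof -
    have "a n k \<le> (1/2)^n" unfolding a_def
      by (rule order_trans[OF finite_measure_mono I_measure]) (use I_sets in auto)
    then show ?thesis by (simp add: field_simps power_divide)
  qed
  have diff: "Q (Suc n) - Q n = (\<Sum>k<2^n. 2^n * (d n k)^2)" for n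
  proof -
    have "Q (Suc n) = (\<Sum>i<2 * 2^n. if even i then 2^Suc n * (a (Suc n) i)^2 else 2^Suc n * (a (Suc n) i)^2)"
      by (simp add: Q_def)
    also have "\<dots> = (\<Sum>k<2^n. 2^Suc n * (a (Suc n) (2 * k))^2) + (\<Sum>k<2^n. 2^Suc n * (a (Suc n) (2 * k + 1))^2)"
      by (rule sum_split_even_odd)
    finally have "Q (Suc n) - Q n = (\<Sum>k<2^n. 2^Suc n * (a (Suc n) (2 * k))^2 + 2^Suc n * (a (Suc n) (2 * k + 1))^2 - 2^n * (a n k)^2)"
      by (simp add: Q_def sum_subtractf sum.distrib)
    \<comment> \<open>Termwise this is 2 (x^2 + y^2) - (x + y)^2 = (x - y)^2.\<close>
    also have "\<dots> = (\<Sum>k<2^n. 2^n * (d n k)^2)"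
      by (intro sum.cong refl, subst a_split) (simp add: d_def algebra_simps power2_eq_square)
    finally show ?thesis .
  qed
  have bound: "Q n \<le> measure M (space M)" for n
  proof -
    have "Q n \<le> (\<Sum>k<2^n. a n k)" unfolding Q_def
    proof (rule sum_mono)
      fix k
      show "2^n * (a n k)^2 \<le> a n k" using mult_right_mono[OF a1 a0, of n k n k] by (simp add: power2_eq_square mult.assoc)
    qed
    also have "\<dots> = measure M (\<Union>k<2^n. A \<inter> I n k)" unfolding a_def
    proof (rule finite_measure_finite_Union[symmetric])
      show "disjoint_family_on (\<lambda>k. A \<inter> I n k) {..<2^n}"
        unfolding disjoint_family_on_def using I_disjoint by blast
    qed (use A I_sets in auto)
    also have "\<dots> \<le> measure M (space M)" by (rule bounded_measure)
    finally show ?thesis .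
  qed
  have "incseq Q"
  proof (rule incseq_SucI)
    fix n have "0 \<le> (\<Sum>k<2^n. 2^n * (d n k)^2)" by (intro sum_nonneg) auto
    then show "Q n \<le> Q (Suc n)" using diff[of n] by simp
  qed
  then obtain q where q: "Q \<longlonglongrightarrow> q" using incseq_convergent bound by meson
  have "(\<lambda>n. Q (Suc n) - Q n) \<longlonglongrightarrow> q - q" by (intro tendsto_diff LIMSEQ_Suc q)
  then have "(\<lambda>n. sqrt (Q (Suc n) - Q n)) \<longlonglongrightarrow> 0" using tendsto_real_sqrt by fastforce
  then show ?thesis
  proof (rule tendsto_sandwich[rotated 3, OF _])
    show "(\<lambda>n. 0::real) \<longlonglongrightarrow> 0" by simp
    show "\<forall>\<^sub>F n in sequentially. 0 \<le> (\<Sum>k<2^n. \<bar>measure M (A \<inter> I (Suc n) (2 * k)) - measure M (A \<inter> I (Suc n) (2 * k + 1))\<bar>)"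
      by (intro always_eventually allI sum_nonneg) auto
    show "\<forall>\<^sub>F n in sequentially. (\<Sum>k<2^n. \<bar>measure M (A \<inter> I (Suc n) (2 * k)) - measure M (A \<inter> I (Suc n) (2 * k + 1))\<bar>) \<le> sqrt (Q (Suc n) - Q n)"
    proof (intro always_eventually allI real_le_rsqrt)
      fix n
      \<comment> \<open>Cauchy-Schwarz against \<open>2^n\<close> ones produces exactly the weight
        \<open>2^n\<close> built into \<open>Q\<close>.\<close>
      have "(\<Sum>k<2^n. \<bar>d n k\<bar> * 1)^2 \<le> (\<Sum>k<2^n. \<bar>d n k\<bar>^2) * (\<Sum>k<(2^n::nat). 1^2)"
        by (rule Cauchy_Schwarz_ineq_sum)
      also have "\<dots> = Q (Suc n) - Q n" by (simp add: diff sum_distrib_left mult.commute)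
      finally show "(\<Sum>k<2^n. \<bar>measure M (A \<inter> I (Suc n) (2 * k)) - measure M (A \<inter> I (Suc n) (2 * k + 1))\<bar>)^2 \<le> Q (Suc n) - Q n"
        by (simp add: d_def a_def)
    qed
  qed
qed

text \<open>For a simple density the oscillation is bounded by a finite combination of Haar sums and
  tends to 0. Replacing \<open>g\<close> by a simple \<open>t\<close> costs, on each level, at most
  the L1 distance of \<open>g\<close> and \<open>t\<close>, because the sets of one level are
  disjoint; the error is thus small uniformly in \<open>n\<close>.\<close>

lemma density_oscillation_tendsto_0:
  fixes G :: "'m set \<Rightarrow> 'e::real_normed_vector"
  assumes g: "has_bochner_integral_gen M g x"
    and G: "\<And>A. A \<in> sets M \<Longrightarrow> has_bochner_integral_gen M (\<lambda>\<omega>. indicator A \<omega> *\<^sub>R g \<omega>) (G A)"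
  shows "(\<lambda>n. \<Sum>k<2^n. norm (G (I (Suc n) (2 * k)) - G (I (Suc n) (2 * k + 1)))) \<longlonglongrightarrow> 0"
proof (rule LIMSEQ_I)
  fix e :: real assume e: "0 < e"
  obtain s where gm: "g \<in> borel_measurable M" and s: "\<And>i. sb_integrable M (s i)"
    and lim: "(\<lambda>i. \<integral>\<^sup>+\<omega>. ennreal (norm (g \<omega> - s i \<omega>)) \<partial>M) \<longlonglongrightarrow> 0"
    using g unfolding has_bochner_integral_gen_def by blast
  have "\<forall>\<^sub>F i in sequentially. (\<integral>\<^sup>+\<omega>. ennreal (norm (g \<omega> - s i \<omega>)) \<partial>M) < ennreal (e / 2)"
    using e by (intro order_tendstoD(2)[OF lim]) auto
  then obtain i where i: "(\<integral>\<^sup>+\<omega>. ennreal (norm (g \<omega> - s i \<omega>)) \<partial>M) < ennreal (e / 2)"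
    using eventually_happens'[OF sequentially_bot] by blast
  define t where "t = s i"
  have t: "sb_integrable M t" by (simp add: t_def s)
  then have st: "simple_function M t" by (auto elim: simple_bochner_integrable.cases)
  have nm[measurable]: "(\<lambda>x. norm (g x - t x)) \<in> borel_measurable M" by (rule borel_measurable_norm_diff_simple[OF gm st])
  have int: "integrable M (\<lambda>x. norm (g x - t x))"
    using i nm by (intro integrableI_bounded) (auto simp: t_def intro: order_less_trans)
  define R where "R B = integral\<^sup>L M (\<lambda>x. indicator B x * norm (g x - t x))" for B
  have intB: "integrable M (\<lambda>x. indicator B x * norm (g x - t x))" if "B \<in> sets M" for B
    using integrable_mult_indicator[OF that int] by simp
  have Rsum: "(\<Sum>k<N. R (I n k)) < e / 2" for n N
  proof -
    have "(\<Sum>k<N. R (I n k)) = integral\<^sup>L M (\<lambda>x. \<Sum>k<N. indicator (I n k) x * norm (g x - t x))"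
      unfolding R_def by (rule Bochner_Integration.integral_sum[symmetric]) (rule intB[OF I_sets])
    also have "\<dots> \<le> integral\<^sup>L M (\<lambda>x. norm (g x - t x))"
    proof (rule integral_mono[OF Bochner_Integration.integrable_sum[OF intB[OF I_sets]] int])
      fix x
      have "(\<Sum>k<N. indicator (I n k) x :: real) = indicator (\<Union>k<N. I n k) x"
        using I_disjoint by (intro indicator_UN_disjoint[symmetric]) (auto simp: disjoint_family_on_def)
      then show "(\<Sum>k<N. indicator (I n k) x * norm (g x - t x)) \<le> norm (g x - t x)"
        by (simp add: sum_distrib_right[symmetric] indicator_def)
    qed
    also have "\<dots> < e / 2"
    proof -
      have "ennreal (integral\<^sup>L M (\<lambda>x. norm (g x - t x))) < ennreal (e / 2)"
        using i int by (subst nn_integral_eq_integral[symmetric]) (auto simp: t_def)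
      then show ?thesis using e by (simp add: ennreal_less_iff integral_nonneg)
    qed
    finally show ?thesis .
  qed
  define J where "J B = (\<Sum>c\<in>t ` space M. measure M (B \<inter> {x \<in> space M. t x = c}) *\<^sub>R c)" for B
  have near: "norm (G B - J B) \<le> R B" if B: "B \<in> sets M" for B
  proof -
    have "ennreal (norm (G B - J B)) \<le> (\<integral>\<^sup>+ x. ennreal (norm (indicator B x *\<^sub>R g x - indicator B x *\<^sub>R t x)) \<partial>M)"
      using has_bochner_integral_gen_approx[OF G[OF B] simple_bochner_integrable_indicator(1)[OF finite_measure_axioms t B]]
      by (simp add: simple_bochner_integrable_indicator(2)[OF finite_measure_axioms t B] J_def)
    also have "\<dots> = (\<integral>\<^sup>+ x. ennreal (indicator B x * norm (g x - t x)) \<partial>M)"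
      by (intro nn_integral_cong) (auto simp: indicator_def)
    also have "\<dots> = ennreal (R B)" unfolding R_def
      by (rule nn_integral_eq_integral[OF intB[OF B]]) auto
    finally show ?thesis by (simp add: R_def integral_nonneg)
  qed
  define A where "A c = {x \<in> space M. t x = c}" for c
  have A: "A c \<in> sets M" for c
    using simple_functionD(2)[OF st, of "{c}"] by (simp add: A_def vimage_def Int_def conj_commute)
  have "(\<lambda>n. \<Sum>c\<in>t ` space M. norm c * (\<Sum>k<2^n. \<bar>measure M (A c \<inter> I (Suc n) (2 * k)) - measure M (A c \<inter> I (Suc n) (2 * k + 1))\<bar>))
      \<longlonglongrightarrow> (\<Sum>c\<in>t ` space M. norm c * 0)"
    by (intro tendsto_sum tendsto_mult tendsto_const haar_coefficients_tendsto_0 A)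
  then have "\<forall>\<^sub>F n in sequentially. (\<Sum>c\<in>t ` space M. norm c * (\<Sum>k<2^n. \<bar>measure M (A c \<inter> I (Suc n) (2 * k)) - measure M (A c \<inter> I (Suc n) (2 * k + 1))\<bar>)) < e / 2"
    using e by (intro order_tendstoD) auto
  then obtain N where N: "\<And>n. n \<ge> N \<Longrightarrow> (\<Sum>c\<in>t ` space M. norm c * (\<Sum>k<2^n. \<bar>measure M (A c \<inter> I (Suc n) (2 * k)) - measure M (A c \<inter> I (Suc n) (2 * k + 1))\<bar>)) < e / 2"
    unfolding eventually_sequentially by blast
  have main: "(\<Sum>k<2^n. norm (G (I (Suc n) (2 * k)) - G (I (Suc n) (2 * k + 1)))) < e" if n: "n \<ge> N" for n
  proof -
    let ?L = "\<lambda>k. I (Suc n) (2 * k)" and ?R = "\<lambda>k. I (Suc n) (2 * k + 1)"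
    have J: "norm (J (?L k) - J (?R k)) \<le> (\<Sum>c\<in>t ` space M. norm c * \<bar>measure M (A c \<inter> ?L k) - measure M (A c \<inter> ?R k)\<bar>)" for k
    proof -
      have "J (?L k) - J (?R k) = (\<Sum>c\<in>t ` space M. (measure M (A c \<inter> ?L k) - measure M (A c \<inter> ?R k)) *\<^sub>R c)"
        by (simp add: J_def A_def sum_subtractf scaleR_diff_left Int_commute)
      then show ?thesis by (simp only:) (rule order_trans[OF norm_sum], simp add: mult.commute)
    qed
    have "norm (G (?L k) - G (?R k)) \<le> R (?L k) + R (?R k) + norm (J (?L k) - J (?R k))" for k
      using near[OF I_sets[of "Suc n" "2 * k"]] near[OF I_sets[of "Suc n" "2 * k + 1"]]
        norm_triangle_ineq[of "(G (?L k) - J (?L k)) - (G (?R k) - J (?R k))" "J (?L k) - J (?R k)"]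
        norm_triangle_ineq4[of "G (?L k) - J (?L k)" "G (?R k) - J (?R k)"]
      by (simp add: algebra_simps)
    then have "(\<Sum>k<2^n. norm (G (?L k) - G (?R k))) \<le> (\<Sum>k<2^n. R (?L k) + R (?R k) + norm (J (?L k) - J (?R k)))"
      by (rule sum_mono)
    also have "\<dots> = ((\<Sum>k<2^n. R (?L k)) + (\<Sum>k<2^n. R (?R k))) + (\<Sum>k<2^n. norm (J (?L k) - J (?R k)))"
      by (simp add: sum.distrib)
    \<comment> \<open>Left and right children are the even and odd indices of level
      \<open>n + 1\<close>, so the bound for a whole level covers both sums at once.\<close>
    also have "(\<Sum>k<2^n. R (?L k)) + (\<Sum>k<2^n. R (?R k)) = (\<Sum>i<2 * 2^n. if even i then R (I (Suc n) i) else R (I (Suc n) i))"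
      by (rule sum_split_even_odd[symmetric])
    also have "\<dots> < e / 2" using Rsum[of "Suc n" "2 * 2^n"] by simp
    also have "(\<Sum>k<2^n. norm (J (?L k) - J (?R k))) \<le> (\<Sum>k<2^n. \<Sum>c\<in>t ` space M. norm c * \<bar>measure M (A c \<inter> ?L k) - measure M (A c \<inter> ?R k)\<bar>)"
      by (rule sum_mono) (rule J)
    also have "\<dots> = (\<Sum>c\<in>t ` space M. norm c * (\<Sum>k<2^n. \<bar>measure M (A c \<inter> ?L k) - measure M (A c \<inter> ?R k)\<bar>))"
      by (subst sum.swap) (simp add: sum_distrib_left)
    also have "\<dots> < e / 2" by (rule N[OF n])
    finally show ?thesis by simp
  qed
  then show "\<exists>no. \<forall>n\<ge>no. norm ((\<Sum>k<2^n. norm (G (I (Suc n) (2 * k)) - G (I (Suc n) (2 * k + 1)))) - 0) < e"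
    by (intro exI[of _ N]) (auto simp: sum_nonneg)
qed

end

subsection \<open>Fragmentability of dual balls\<close>

lemma inner_one_le_norm: "(z::'k::{real_normed_field,euclidean_space}) \<bullet> 1 \<le> norm z"
  using norm_cauchy_schwarz[of z 1] by simp

lemma abs_inner_one_le_norm: "\<bar>(z::'k::{real_normed_field,euclidean_space}) \<bullet> 1\<bar> \<le> norm z"
  using Cauchy_Schwarz_ineq2[of z 1] by simp

lemma of_real_inner_one [simp]: "(of_real r :: 'k::{real_normed_field,euclidean_space}) \<bullet> 1 = r"
  by (simp add: of_real_def dot_square_norm)

lemma rotate_to_norm:
  fixes z :: "'k::{real_normed_field,euclidean_space}"
  obtains u :: 'k where "norm u = 1" "u * z = of_real (norm z)"
proof (cases "z = 0")
  case True
  then show ?thesis using that[of 1] by simp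
next
  case False
  then show ?thesis using that[of "of_real (norm z) * inverse z"]
    by (simp add: norm_mult norm_inverse)
qed

lemma compact_PiE_cball: "compact (PiE UNIV (\<lambda>i::'i. cball (0::'k::euclidean_space) (b i)))"
proof -
  have "compactin (product_topology (\<lambda>i. euclidean) UNIV) (PiE UNIV (\<lambda>i::'i. cball (0::'k) (b i)))"
    by (simp add: compactin_PiE)
  then show ?thesis by (simp add: euclidean_product_topology)
qed

lemma closed_PiE_cball: "closed (PiE UNIV (\<lambda>i::'i. cball (0::'k::euclidean_space) (b i)))"
proof -
  have "PiE UNIV (\<lambda>i::'i. cball (0::'k) (b i)) = (\<Inter>i. {u. norm (u i) \<le> b i})"
    by (auto simp: PiE_def Pi_def)
  moreover have "closed \<dots>"
    by (intro closed_INT ballI closed_Collect_le continuous_on_norm continuous_on_product_coordinates continuous_on_const)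
  ultimately show ?thesis by simp
qed

text \<open>Tychonoff's theorem in place of a diagonal argument: the index set may be uncountable,
  so a pointwise convergent subsequence need not exist, but a finer filter does.\<close>

lemma pointwise_bounded_subfilter:
  fixes \<Psi> :: "nat \<Rightarrow> 'i \<Rightarrow> 'k::euclidean_space"
  assumes "\<And>m i. norm (\<Psi> m i) \<le> b i"
  obtains F \<Phi> where "F \<le> sequentially" "F \<noteq> bot" "\<And>i. ((\<lambda>m. \<Psi> m i) \<longlongrightarrow> \<Phi> i) F"
proof -
  have "compact (PiE UNIV (\<lambda>i. cball (0::'k) (b i)))" by (rule compact_PiE_cball)
  moreover have "\<forall>\<^sub>F x in filtermap \<Psi> sequentially. x \<in> PiE UNIV (\<lambda>i. cball (0::'k) (b i))"
    using assms by (simp add: eventually_filtermap PiE_def Pi_def)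
  ultimately obtain \<Phi> where \<Phi>: "inf (nhds \<Phi>) (filtermap \<Psi> sequentially) \<noteq> bot"
    unfolding compact_filter by (metis filtermap_bot_iff sequentially_bot)
  \<comment> \<open>The pullback of the neighbourhoods of \<open>\<Phi>\<close> meets every tail
    because \<open>\<Phi>\<close> is a cluster point.\<close>
  define F where "F = inf sequentially (filtercomap \<Psi> (nhds \<Phi>))"
  have "F \<noteq> bot"
  proof
    assume "F = bot"
    then have "eventually (\<lambda>_. False) F" by simp
    then obtain P R where P: "eventually P sequentially" and R: "eventually R (filtercomap \<Psi> (nhds \<Phi>))"
      and PR: "\<And>m. P m \<Longrightarrow> R m \<Longrightarrow> False"
      unfolding F_def eventually_inf by blast
    obtain Q where Q: "eventually Q (nhds \<Phi>)" "\<And>m. Q (\<Psi> m) \<Longrightarrow> R m"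
      using R unfolding eventually_filtercomap by blast
    have "eventually (\<lambda>m. \<not> Q (\<Psi> m)) sequentially"
      using P by (rule eventually_mono) (use Q(2) PR in blast)
    then have "eventually (\<lambda>x. \<not> Q x) (filtermap \<Psi> sequentially)"
      by (simp add: eventually_filtermap)
    with Q(1) have "eventually (\<lambda>_. False) (inf (nhds \<Phi>) (filtermap \<Psi> sequentially))"
      unfolding eventually_inf by blast
    with \<Phi> show False by (simp add: trivial_limit_def)
  qed
  moreover have "F \<le> sequentially" by (simp add: F_def)
  moreover have "((\<lambda>m. \<Psi> m i) \<longlongrightarrow> \<Phi> i) F" for i
  proof -
    have "filterlim \<Psi> (nhds \<Phi>) (filtercomap \<Psi> (nhds \<Phi>))" by (rule filterlim_filtercomap)
    then have "(\<Psi> \<longlongrightarrow> \<Phi>) F" unfolding F_def by (rule filterlim_mono) auto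
    then show ?thesis
      using continuous_on_tendsto_compose[OF continuous_on_product_coordinates[of i], of \<Psi> \<Phi> F] by simp
  qed
  ultimately show ?thesis using that by blast
qed

section \<open>Dyadic intervals in [0,1) and vector measures dominated by Lebesgue measure\<close>

definition dyadic_index :: "nat \<Rightarrow> real \<Rightarrow> nat" where
  "dyadic_index n t = nat \<lfloor>2 ^ n * t\<rfloor>"

definition dyadic_interval :: "nat \<Rightarrow> nat \<Rightarrow> real set" where
  "dyadic_interval n k = {t. 0 \<le> t \<and> t < 1 \<and> dyadic_index n t = k}"

text \<open>The last binary digit is dropped: halving the index leads from an interval to its
  parent. The tree of weak-star open sets is indexed in the same way.\<close>

lemma dyadic_index_Suc_div: "dyadic_index (Suc n) t div 2 = dyadic_index n t"
proof -
  have "\<lfloor>2 ^ Suc n * t\<rfloor> div 2 = \<lfloor>2 ^ Suc n * t / 2\<rfloor>"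
    using floor_divide_real_eq_div[of 2 "2 ^ Suc n * t"] by simp
  then have "\<lfloor>2 ^ Suc n * t\<rfloor> div 2 = \<lfloor>2 ^ n * t\<rfloor>" by simp
  then show ?thesis unfolding dyadic_index_def using nat_div_distrib'[of 2 "\<lfloor>2 ^ Suc n * t\<rfloor>"] by simp
qed

lemma dyadic_interval_eq:
  assumes "k < 2 ^ n"
  shows "dyadic_interval n k = {real k / 2 ^ n..<(real k + 1) / 2 ^ n}"
proof -
  have k1: "real k + 1 \<le> 2 ^ n" using assms by (metis Suc_leI of_nat_1 of_nat_Suc of_nat_le_iff of_nat_numeral of_nat_power add.commute)
  show ?thesis
  proof (intro set_eqI iffI)
    fix t assume "t \<in> dyadic_interval n k"
    then have t: "0 \<le> t" "nat \<lfloor>2 ^ n * t\<rfloor> = k" by (auto simp: dyadic_interval_def dyadic_index_def)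
    then have "\<lfloor>2 ^ n * t\<rfloor> = int k" by (auto simp: nat_eq_iff)
    then show "t \<in> {real k / 2 ^ n..<(real k + 1) / 2 ^ n}"
      by (simp add: floor_eq_iff field_simps)
  next
    fix t assume t: "t \<in> {real k / 2 ^ n..<(real k + 1) / 2 ^ n}"
    then have "\<lfloor>2 ^ n * t\<rfloor> = int k" by (simp add: floor_eq_iff field_simps)
    moreover have "0 \<le> t" using t by (auto intro: order_trans[of 0 "real k / 2 ^ n"])
    moreover have "t < 1"
    proof -
      have "t < (real k + 1) / 2 ^ n" using t by simp
      also have "\<dots> \<le> 1" using k1 by simp
      finally show ?thesis .
    qed
    ultimately show "t \<in> dyadic_interval n k" by (simp add: dyadic_interval_def dyadic_index_def)
  qed
qed

lemma dyadic_interval_empty: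
  assumes "\<not> k < 2 ^ n"
  shows "dyadic_interval n k = {}"
proof -
  have False if "0 \<le> t" "t < 1" "nat \<lfloor>2 ^ n * t\<rfloor> = k" for t :: real
  proof -
    have "2 ^ n * t < 2 ^ n" using that by simp
    then have "\<lfloor>2 ^ n * t\<rfloor> < 2 ^ n" by (simp add: floor_less_iff)
    moreover have "0 \<le> \<lfloor>2 ^ n * t\<rfloor>" using that(1) by simp
    ultimately have "nat \<lfloor>2 ^ n * t\<rfloor> < 2 ^ n" by (subst nat_less_iff) auto
    then show False using assms that(3) by simp
  qed
  then show ?thesis by (auto simp: dyadic_interval_def dyadic_index_def)
qed

definition unit_interval_measure :: "real measure" where
  "unit_interval_measure = restrict_space lborel {0..<1}"

lemma space_unit_interval_measure: "space unit_interval_measure = {0..<1}"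
  by (simp add: unit_interval_measure_def space_restrict_space)

lemma measure_unit_interval_measure:
  assumes "A \<subseteq> {0..<1}"
  shows "measure unit_interval_measure A = measure lborel A"
  unfolding unit_interval_measure_def using assms by (intro measure_restrict_space) auto

lemma dyadic_interval_sets: "dyadic_interval n k \<in> sets unit_interval_measure"
proof (cases "k < 2 ^ n")
  case True
  have "dyadic_interval n k \<in> sets borel" using dyadic_interval_eq[OF True] by simp
  moreover have "dyadic_interval n k \<subseteq> {0..<1}" by (auto simp: dyadic_interval_def)
  ultimately show ?thesis by (simp add: unit_interval_measure_def sets_restrict_space_iff)
qed (simp add: dyadic_interval_empty)

lemma measure_dyadic_interval:
  assumes "k < 2 ^ n"
  shows "measure unit_interval_measure (dyadic_interval n k) = (1/2) ^ n"
proof -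
  have "dyadic_interval n k \<subseteq> {0..<1}" by (auto simp: dyadic_interval_def)
  then have "measure unit_interval_measure (dyadic_interval n k) = measure lborel {real k / 2 ^ n..<(real k + 1) / 2 ^ n}"
    by (simp add: measure_unit_interval_measure dyadic_interval_eq[OF assms])
  also have "\<dots> = (real k + 1) / 2 ^ n - real k / 2 ^ n"
    by (intro measure_lborel_Ico divide_right_mono) auto
  finally show ?thesis by (simp add: add_divide_distrib power_divide)
qed

interpretation unit_interval: dyadic_partition unit_interval_measure dyadic_interval
proof (intro dyadic_partition.intro dyadic_partition_axioms.intro finite_measureI)
  have "emeasure unit_interval_measure (space unit_interval_measure) = emeasure lborel {0..<1::real}"
    unfolding unit_interval_measure_def by (subst emeasure_restrict_space) (auto simp: space_restrict_space)
  then show "emeasure unit_interval_measure (space unit_interval_measure) \<noteq> \<infinity>" by simp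
  fix n k
  show "dyadic_interval n k \<in> sets unit_interval_measure" by (rule dyadic_interval_sets)
  show "dyadic_interval n k = dyadic_interval (Suc n) (2 * k) \<union> dyadic_interval (Suc n) (2 * k + 1)"
  proof -
    have "dyadic_index n t = k \<longleftrightarrow> dyadic_index (Suc n) t = 2 * k \<or> dyadic_index (Suc n) t = 2 * k + 1" for t
      using dyadic_index_Suc_div[of n t] by presburger
    then show ?thesis by (auto simp: dyadic_interval_def)
  qed
  show "k \<noteq> l \<Longrightarrow> dyadic_interval n k \<inter> dyadic_interval n l = {}" for l
    by (auto simp: dyadic_interval_def)
  show "measure unit_interval_measure (dyadic_interval n k) \<le> (1/2) ^ n"
    by (cases "k < 2 ^ n") (simp_all add: measure_dyadic_interval dyadic_interval_empty)
qed

text \<open>Finite additivity becomes countable because the tails are dominated by measures tending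
  to 0; the variation is at most the total mass, and \<open>\<epsilon>\<close> itself serves as
  \<open>\<delta>\<close>.\<close>

lemma vector_measure_of_dominated:
  fixes G :: "'m set \<Rightarrow> 'e::real_normed_vector"
  assumes M: "finite_measure M" and E: "\<And>A. A \<in> sets M \<Longrightarrow> G A \<in> E"
    and add: "\<And>A B. A \<in> sets M \<Longrightarrow> B \<in> sets M \<Longrightarrow> A \<inter> B = {} \<Longrightarrow> G (A \<union> B) = G A + G B"
    and le: "\<And>A. A \<in> sets M \<Longrightarrow> norm (G A) \<le> measure M A"
  shows "vector_measure M E G" "of_bounded_variation M G" "measure_continuous M G"
proof -
  interpret finite_measure M by fact
  have G0: "G {} = 0" using le[of "{}"] by simp
  have "(\<lambda>n. G (A n)) sums G (\<Union>n. A n)" if A: "range A \<subseteq> sets M" "disjoint_family A" for A :: "nat \<Rightarrow> 'm set"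
  proof -
    have An: "A n \<in> sets M" for n using A(1) by auto
    have fin: "G (\<Union>i<n. A i) = (\<Sum>i<n. G (A i))" for n
    proof (induct n)
      case (Suc n)
      have "A i \<inter> A n = {}" if "i < n" for i
        using disjoint_family_onD[OF A(2), of i n] that by simp
      then have "(\<Union>i<n. A i) \<inter> A n = {}" by blast
      moreover have "(\<Union>i<Suc n. A i) = (\<Union>i<n. A i) \<union> A n" by (auto simp: less_Suc_eq)
      ultimately show ?case using Suc add[of "\<Union>i<n. A i" "A n"] An by auto
    qed (simp add: G0)
    have m: "(\<lambda>n. measure M (A n)) sums measure M (\<Union>n. A n)" by (rule finite_measure_UNION[OF A])
    have le_tail: "norm (G (\<Union>n. A n) - (\<Sum>i<n. G (A i))) \<le> measure M (\<Union>n. A n) - (\<Sum>i<n. measure M (A i))" for n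
    proof -
      let ?T = "(\<Union>n. A n) - (\<Union>i<n. A i)"
      have T: "?T \<in> sets M" using An by auto
      have eq: "(\<Union>n. A n) = (\<Union>i<n. A i) \<union> ?T" by auto
      have "G (\<Union>n. A n) = G (\<Union>i<n. A i) + G ?T"
        by (subst eq, rule add) (use T An in auto)
      then have "norm (G (\<Union>n. A n) - (\<Sum>i<n. G (A i))) \<le> measure M ?T" using le[OF T] fin by simp
      also have "\<dots> = measure M (\<Union>n. A n) - measure M (\<Union>i<n. A i)"
        using An by (intro finite_measure_Diff) auto
      also have "measure M (\<Union>i<n. A i) = (\<Sum>i<n. measure M (A i))"
        using A An by (intro finite_measure_finite_Union) (auto simp: disjoint_family_on_def)
      finally show ?thesis .
    qed
    have "(\<lambda>n. measure M (\<Union>n. A n) - (\<Sum>i<n. measure M (A i))) \<longlonglongrightarrow> measure M (\<Union>n. A n) - measure M (\<Union>n. A n)"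
      by (intro tendsto_diff tendsto_const m[unfolded sums_def])
    then have tail: "(\<lambda>n. measure M (\<Union>n. A n) - (\<Sum>i<n. measure M (A i))) \<longlonglongrightarrow> 0" by simp
    have "(\<lambda>n. G (\<Union>n. A n) - (\<Sum>i<n. G (A i))) \<longlonglongrightarrow> 0"
      by (rule Lim_null_comparison[OF always_eventually tail]) (rule allI, rule le_tail)
    then have "(\<lambda>n. G (\<Union>n. A n) - (G (\<Union>n. A n) - (\<Sum>i<n. G (A i)))) \<longlonglongrightarrow> G (\<Union>n. A n) - 0"
      by (intro tendsto_diff tendsto_const)
    then show ?thesis by (simp add: sums_def)
  qed
  then show "vector_measure M E G" using E by (auto simp: vector_measure_def)
  show "of_bounded_variation M G" unfolding of_bounded_variation_def
  proof (intro exI allI impI, elim conjE)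
    fix P assume P: "finite P" "P \<subseteq> sets M" "disjoint P"
    have "(\<Sum>A\<in>P. norm (G A)) \<le> (\<Sum>A\<in>P. measure M A)" using P le by (intro sum_mono) auto
    also have "\<dots> = measure M (\<Union>A\<in>P. A)"
      using P by (intro finite_measure_finite_Union[symmetric])
        (auto simp: disjoint_family_on_def pairwise_def disjnt_def)
    also have "\<dots> \<le> measure M (space M)" by (rule bounded_measure)
    finally show "(\<Sum>A\<in>P. norm (G A)) \<le> measure M (space M)" .
  qed
  show "measure_continuous M G" unfolding measure_continuous_def
    using le order_le_less_trans by blast
qed

text \<open>A vector on which \<open>f - g\<close> exceeds \<open>\<epsilon>\<close>, rotated to
  make the value real, separates the two functionals by weak-star half-spaces with a gap between
  them. Unlike a norm distance, such a gap survives averaging and weak-star limits.\<close>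

lemma weak_star_split:
  fixes sX :: "'k::{real_normed_field,euclidean_space} \<Rightarrow> 'a::banach \<Rightarrow> 'a"
  assumes sX: "banach_over sX" and S: "S \<subseteq> dual_space sX" and \<epsilon>: "0 < \<epsilon>"
    and U: "open U" and f: "f \<in> S" "blinfun_apply f \<in> U" and g: "g \<in> S" "blinfun_apply g \<in> U" and fg: "\<epsilon> < norm (f - g)"
  shows "\<exists>x c U0 U1. norm x = 1 \<and> open U0 \<and> open U1 \<and> U0 \<subseteq> U \<and> U1 \<subseteq> U \<and>
    blinfun_apply f \<in> U0 \<and> blinfun_apply g \<in> U1 \<and>
    (\<forall>h. blinfun_apply h \<in> U0 \<longrightarrow> c + \<epsilon> / 3 \<le> blinfun_apply h x \<bullet> 1) \<and>
    (\<forall>h. blinfun_apply h \<in> U1 \<longrightarrow> blinfun_apply h x \<bullet> 1 \<le> c)"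
proof -
  interpret banach_over sX by fact
  have fgE: "blinfun_apply (f - g) (sX c y) = c * blinfun_apply (f - g) y" for c y
  proof -
    have "blinfun_apply f (sX c y) = c * blinfun_apply f y" "blinfun_apply g (sX c y) = c * blinfun_apply g y"
      using S f(1) g(1) unfolding dual_space_def by blast+
    then show ?thesis by (simp add: blinfun.diff_left algebra_simps)
  qed
  obtain y where y: "\<epsilon> * norm y < norm (blinfun_apply (f - g) y)"
    using norm_blinfun_bound[of \<epsilon> "f - g"] fg \<epsilon> by (meson less_imp_le not_le)
  then have y0: "y \<noteq> 0" by auto
  obtain u where u: "norm u = 1" "u * blinfun_apply (f - g) y = of_real (norm (blinfun_apply (f - g) y))"
    using rotate_to_norm by blast
  define x where "x = (1 / norm y) *\<^sub>R sX u y"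
  have x1: "norm x = 1" using y0 u(1) by (simp add: x_def norm_scale)
  have "blinfun_apply (f - g) x \<bullet> 1 = norm (blinfun_apply (f - g) y) / norm y"
    by (simp add: x_def blinfun.scaleR_right fgE u(2))
  then have big: "\<epsilon> < blinfun_apply f x \<bullet> 1 - blinfun_apply g x \<bullet> 1"
    using y y0 by (simp add: blinfun.diff_left inner_diff_left pos_less_divide_eq)
  \<comment> \<open>The distance is cut into thirds: \<open>g\<close> lies
    \<open>\<epsilon> / 3\<close> below \<open>c\<close>, and \<open>f\<close> still lies more than
    \<open>\<epsilon> / 3\<close> above \<open>c + \<epsilon> / 3\<close>, so strict inequalities
    give open neighbourhoods of both.\<close>
  define c where "c = blinfun_apply g x \<bullet> 1 + \<epsilon> / 3"
  define U0 where "U0 = U \<inter> {\<phi>. c + \<epsilon> / 3 < \<phi> x \<bullet> 1}"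
  define U1 where "U1 = U \<inter> {\<phi>. \<phi> x \<bullet> 1 < c}"
  have cont: "continuous_on UNIV (\<lambda>\<phi>::'a \<Rightarrow> 'k. \<phi> x \<bullet> 1)"
    by (intro continuous_intros continuous_on_product_coordinates)
  have "open U0" "open U1" unfolding U0_def U1_def
    using U by (auto intro!: open_Int open_Collect_less cont continuous_on_const)
  moreover have "blinfun_apply f \<in> U0" "blinfun_apply g \<in> U1"
    using f g big \<epsilon> by (auto simp: U0_def U1_def c_def)
  ultimately show ?thesis using x1
    by (intro exI[of _ x] exI[of _ c] exI[of _ U0] exI[of _ U1]) (auto simp: U0_def U1_def)
qed

text \<open>
  If \<open>S\<close> is not fragmented, there is a dyadic tree of relatively weak-star open subsets of \<open>S\<close> such
  that the two children of each node are separated by a unit vector of \<open>X\<close>. A weak-star cluster point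
  of the measures \<open>\<Sum>\<^sub>j m(B \<inter> I n j) h n j\<close>, with \<open>h n j\<close> chosen in node \<open>j\<close> of level \<open>n\<close>, is a
  vector measure whose oscillation over dyadic intervals does not tend to zero.
\<close>

lemma dual_rnp_fragmented:
  fixes sX :: "'k::{real_normed_field,euclidean_space} \<Rightarrow> 'a::banach \<Rightarrow> 'a"
  assumes sX: "banach_over sX" and rnp: "radon_nikodym_property (dual_space sX)"
    and S: "S \<subseteq> dual_space sX" "\<And>f. f \<in> S \<Longrightarrow> norm f \<le> 1" "S \<noteq> {}" and \<epsilon>: "0 < \<epsilon>"
  shows "\<exists>U. open U \<and> (\<exists>f\<in>S. blinfun_apply f \<in> U) \<and>
    (\<forall>f\<in>S. \<forall>g\<in>S. blinfun_apply f \<in> U \<longrightarrow> blinfun_apply g \<in> U \<longrightarrow> norm (f - g) \<le> \<epsilon>)"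
proof (rule ccontr)
  assume contr: "\<not> ?thesis"
  interpret sX: banach_over sX by fact
  interpret dual: banach_over "dual_scale :: 'k \<Rightarrow> ('a \<Rightarrow>\<^sub>L 'k) \<Rightarrow> ('a \<Rightarrow>\<^sub>L 'k)" by (rule banach_over_dual_scale)
  let ?M = unit_interval_measure and ?I = dyadic_interval
  let ?m = "measure unit_interval_measure"
  define rel where "rel U \<longleftrightarrow> open U \<and> (\<exists>f\<in>S. blinfun_apply f \<in> U)" for U
  \<comment> \<open>The premise \<open>rel U\<close> stands inside the existential so that the
    choice functions \<open>X\<close>, \<open>C\<close>, \<open>L\<close>, \<open>R\<close> become
    total.\<close>
  have "\<exists>x c U0 U1. rel U \<longrightarrow> (norm x = 1 \<and> rel U0 \<and> rel U1 \<and> U0 \<subseteq> U \<and> U1 \<subseteq> U \<and>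
    (\<forall>h. blinfun_apply h \<in> U0 \<longrightarrow> c + \<epsilon> / 3 \<le> blinfun_apply h x \<bullet> 1) \<and>
    (\<forall>h. blinfun_apply h \<in> U1 \<longrightarrow> blinfun_apply h x \<bullet> 1 \<le> c))" for U
  proof (cases "rel U")
    case True
    then obtain f g where fg: "f \<in> S" "blinfun_apply f \<in> U" "g \<in> S" "blinfun_apply g \<in> U" "\<epsilon> < norm (f - g)"
      using contr unfolding rel_def by (meson not_le)
    have "open U" using True by (simp add: rel_def)
    from weak_star_split[OF sX S(1) \<epsilon> this fg] fg(1,3) show ?thesis unfolding rel_def by blast
  qed auto
  then obtain X C L R where XCLR: "\<And>U. rel U \<Longrightarrow> (norm (X U) = 1 \<and> rel (L U) \<and> rel (R U) \<and> L U \<subseteq> U \<and> R U \<subseteq> U \<and>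
    (\<forall>h. blinfun_apply h \<in> L U \<longrightarrow> C U + \<epsilon> / 3 \<le> blinfun_apply h (X U) \<bullet> 1) \<and>
    (\<forall>h. blinfun_apply h \<in> R U \<longrightarrow> blinfun_apply h (X U) \<bullet> 1 \<le> C U))" by metis
  \<comment> \<open>Node \<open>k\<close> has children \<open>2 * k\<close> and
    \<open>2 * k + 1\<close>, as the dyadic intervals do; along the intervals containing a fixed
    point the nodes decrease.\<close>
  define T where "T = rec_nat (\<lambda>k::nat. UNIV) (\<lambda>n t k. if even k then L (t (k div 2)) else R (t (k div 2)))"
  have TS: "T (Suc n) k = (if even k then L (T n (k div 2)) else R (T n (k div 2)))" for n k
    by (simp add: T_def)
  have relT: "rel (T n k)" for n k
    by (induct n arbitrary: k) (use S(3) XCLR in \<open>auto simp: T_def rel_def[of UNIV] TS\<close>)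
  have T_sub: "T m (dyadic_index m t) \<subseteq> T n (dyadic_index n t)" if "n \<le> m" for m n t
    using that
  proof (induct rule: dec_induct)
    case (step m)
    have "T (Suc m) (dyadic_index (Suc m) t) \<subseteq> T m (dyadic_index m t)"
      using XCLR[OF relT] by (auto simp: TS dyadic_index_Suc_div)
    then show ?case using step by blast
  qed simp
  have "\<exists>f. f \<in> S \<and> blinfun_apply f \<in> T n k" for n k using relT[of n k] by (auto simp: rel_def)
  then obtain h where hS: "\<And>n k. h n k \<in> S" and hT: "\<And>n k. blinfun_apply (h n k) \<in> T n k" by metis
  define G' where "G' m B = (\<Sum>j<2^m. ?m (B \<inter> ?I m j) *\<^sub>R h m j)" for m B
  have Isets: "?I n k \<in> sets ?M" for n k by (rule dyadic_interval_sets)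
  have I_cover: "B = (\<Union>j<2^m. B \<inter> ?I m j)" if B: "B \<in> sets ?M" for m B
  proof -
    have "\<exists>j<2^m. t \<in> ?I m j" if "t \<in> B" for t
    proof -
      have t: "0 \<le> t" "t < 1" using sets.sets_into_space[OF B] that by (auto simp: space_unit_interval_measure)
      then have "t \<in> ?I m (dyadic_index m t)" by (simp add: dyadic_interval_def)
      moreover from this have "dyadic_index m t < 2^m" using dyadic_interval_empty by blast
      ultimately show ?thesis by blast
    qed
    then show ?thesis by blast
  qed
  have m_sum: "(\<Sum>j<2^m. ?m (B \<inter> ?I m j)) = ?m B" if B: "B \<in> sets ?M" for m B
  proof -
    have "(\<Sum>j<2^m. ?m (B \<inter> ?I m j)) = ?m (\<Union>j<2^m. B \<inter> ?I m j)"
      using B Isets by (intro unit_interval.finite_measure_finite_Union[symmetric])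
        (auto simp: disjoint_family_on_def dyadic_interval_def)
    then show ?thesis using I_cover[OF B] by metis
  qed
  have G'E: "G' m B \<in> dual_space sX" for m B
  proof -
    have "c *\<^sub>R f \<in> dual_space sX" if "f \<in> dual_space sX" for c f
      using dual.subspace_scale[OF subspace_dual_space that, of "of_real c"] dual.scale_of_real by simp
    then show ?thesis unfolding G'_def
      using hS S(1) by (intro dual.subspace_sum[OF subspace_dual_space]) blast
  qed
  have G'norm: "norm (G' m B) \<le> ?m B" if B: "B \<in> sets ?M" for m B
  proof -
    have "norm (G' m B) \<le> (\<Sum>j<2^m. ?m (B \<inter> ?I m j) * 1)" unfolding G'_def
      by (rule order_trans[OF norm_sum]) (auto intro!: sum_mono mult_left_le S(2)[OF hS])
    then show ?thesis using m_sum[OF B] by simp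
  qed
  have G'add: "G' m (A \<union> B) = G' m A + G' m B" if AB: "A \<in> sets ?M" "B \<in> sets ?M" "A \<inter> B = {}" for m A B
  proof -
    have "?m ((A \<union> B) \<inter> ?I m j) = ?m (A \<inter> ?I m j) + ?m (B \<inter> ?I m j)" for j
      unfolding Int_Un_distrib2 using AB Isets by (intro unit_interval.finite_measure_Union) auto
    then show ?thesis by (simp add: G'_def sum.distrib scaleR_add_left)
  qed
  \<comment> \<open>Sets and vectors are paired into one index so that a single filter makes all
    values converge; the default 0 keeps the bound valid at non-measurable sets.\<close>
  define \<Psi> where "\<Psi> m i = (if fst i \<in> sets ?M then blinfun_apply (G' m (fst i)) (snd i) else 0)" for m i
  have "norm (\<Psi> m i) \<le> ?m (fst i) * norm (snd i)" for m i
  proof (cases "fst i \<in> sets ?M")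
    case True
    then show ?thesis unfolding \<Psi>_def
      using order_trans[OF norm_blinfun mult_right_mono[OF G'norm[OF True]]] by simp
  qed (simp add: \<Psi>_def)
  then obtain F \<Phi> where F: "F \<le> sequentially" "F \<noteq> bot" and \<Phi>: "\<And>i. ((\<lambda>m. \<Psi> m i) \<longlongrightarrow> \<Phi> i) F"
    using pointwise_bounded_subfilter[of \<Psi> "\<lambda>i. ?m (fst i) * norm (snd i)"] by blast
  have lim: "((\<lambda>m. blinfun_apply (G' m B) x) \<longlongrightarrow> \<Phi> (B, x)) F" if "B \<in> sets ?M" for B x
    using \<Phi>[of "(B, x)"] that by (simp add: \<Psi>_def)
  define G where "G B = Blinfun (\<lambda>x. \<Phi> (B, x))" for B
  have \<Phi>le: "norm (\<Phi> (B, x)) \<le> norm x * ?m B" if B: "B \<in> sets ?M" for B x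
  proof (rule tendsto_upperbound[OF tendsto_norm[OF lim[OF B]] _ F(2)])
    show "\<forall>\<^sub>F m in F. norm (blinfun_apply (G' m B) x) \<le> norm x * ?m B"
      using order_trans[OF norm_blinfun mult_right_mono[OF G'norm[OF B]]] by (simp add: mult.commute)
  qed
  have bl: "bounded_linear (\<lambda>x. \<Phi> (B, x))" if B: "B \<in> sets ?M" for B
  proof (rule bounded_linear_intro[OF _ _ \<Phi>le[OF B]])
    fix x y r
    have "((\<lambda>m. blinfun_apply (G' m B) (x + y)) \<longlongrightarrow> \<Phi> (B, x) + \<Phi> (B, y)) F"
      unfolding blinfun.add_right by (intro tendsto_add lim B)
    then show "\<Phi> (B, x + y) = \<Phi> (B, x) + \<Phi> (B, y)"
      using tendsto_unique[OF F(2) lim[OF B]] by blast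
    have "((\<lambda>m. blinfun_apply (G' m B) (r *\<^sub>R x)) \<longlongrightarrow> r *\<^sub>R \<Phi> (B, x)) F"
      unfolding blinfun.scaleR_right by (intro tendsto_scaleR tendsto_const lim B)
    then show "\<Phi> (B, r *\<^sub>R x) = r *\<^sub>R \<Phi> (B, x)"
      using tendsto_unique[OF F(2) lim[OF B]] by blast
  qed
  have Gapp: "blinfun_apply (G B) x = \<Phi> (B, x)" if "B \<in> sets ?M" for B x
    using bl[OF that] by (simp add: G_def bounded_linear_Blinfun_apply)
  have GE: "G B \<in> dual_space sX" if B: "B \<in> sets ?M" for B
  proof -
    have "\<Phi> (B, sX c x) = c * \<Phi> (B, x)" for c x
    proof -
      have "blinfun_apply (G' m B) (sX c x) = c * blinfun_apply (G' m B) x" for m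
        using G'E[of m B] by (simp add: dual_space_def)
      then have "((\<lambda>m. blinfun_apply (G' m B) (sX c x)) \<longlongrightarrow> c * \<Phi> (B, x)) F"
        by (simp only:) (intro tendsto_mult tendsto_const lim B)
      then show ?thesis using tendsto_unique[OF F(2) lim[OF B]] by blast
    qed
    then show ?thesis using Gapp[OF B] by (simp add: dual_space_def)
  qed
  have Gle: "norm (G B) \<le> ?m B" if B: "B \<in> sets ?M" for B
    using \<Phi>le[OF B] by (intro norm_blinfun_bound) (auto simp: Gapp[OF B] mult.commute)
  have Gadd: "G (A \<union> B) = G A + G B" if AB: "A \<in> sets ?M" "B \<in> sets ?M" "A \<inter> B = {}" for A B
  proof (rule blinfun_eqI)
    fix x
    have "((\<lambda>m. blinfun_apply (G' m (A \<union> B)) x) \<longlongrightarrow> \<Phi> (A, x) + \<Phi> (B, x)) F"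
      unfolding G'add[OF AB] blinfun.add_left by (intro tendsto_add lim AB)
    then have "\<Phi> (A \<union> B, x) = \<Phi> (A, x) + \<Phi> (B, x)"
      using tendsto_unique[OF F(2) lim] AB by blast
    then show "blinfun_apply (G (A \<union> B)) x = blinfun_apply (G A + G B) x"
      using AB by (simp add: Gapp blinfun.add_left)
  qed
  have fm: "finite_measure ?M" by (rule unit_interval.finite_measure_axioms)
  obtain g x where g: "has_bochner_integral_gen ?M g x"
    and gG: "\<And>A. A \<in> sets ?M \<Longrightarrow> has_bochner_integral_gen ?M (\<lambda>\<omega>. indicator A \<omega> *\<^sub>R g \<omega>) (G A)"
    using rnp[unfolded radon_nikodym_property_def, rule_format, of ?M G]
      vector_measure_of_dominated[OF fm GE Gadd Gle] fm by blast
  have gap: "(1/2) ^ Suc n * (\<epsilon> / 3) \<le> norm (G (?I (Suc n) (2 * k)) - G (?I (Suc n) (2 * k + 1)))"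
    if k: "k < 2 ^ n" for n k
  proof -
    define x where "x = X (T n k)"
    define c where "c = C (T n k)"
    have x1: "norm x = 1" using XCLR[OF relT] by (simp add: x_def)
    let ?A = "?I (Suc n) (2 * k)" and ?B = "?I (Suc n) (2 * k + 1)"
    have mA: "?m ?A = (1/2) ^ Suc n" "?m ?B = (1/2) ^ Suc n"
      using measure_dyadic_interval[of "2 * k" "Suc n"] measure_dyadic_interval[of "2 * k + 1" "Suc n"] k
      by simp_all
    \<comment> \<open>Only intervals of level \<open>m\<close> that meet the given one contribute to
      \<open>G' m\<close>. Their nodes descend from its node, so all functionals involved lie on the
      same side of the gap.\<close>
    have inT: "blinfun_apply (h m j) \<in> T (Suc n) i" if m: "Suc n \<le> m" and ne: "?I (Suc n) i \<inter> ?I m j \<noteq> {}" for m i j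
    proof -
      obtain t where "dyadic_index (Suc n) t = i" "dyadic_index m t = j"
        using ne by (auto simp: dyadic_interval_def)
      then show ?thesis using T_sub[OF m, of t] hT[of m j] by auto
    qed
    have sumx: "blinfun_apply (G' m B) x \<bullet> 1 = (\<Sum>j<2^m. ?m (B \<inter> ?I m j) * (blinfun_apply (h m j) x \<bullet> 1))" for m B
      by (simp add: G'_def blinfun.sum_left blinfun.scaleR_left inner_sum_left)
    have A: "(1/2) ^ Suc n * (c + \<epsilon> / 3) \<le> blinfun_apply (G' m ?A) x \<bullet> 1" if m: "Suc n \<le> m" for m
    proof -
      have "?m (?A \<inter> ?I m j) * (c + \<epsilon> / 3) \<le> ?m (?A \<inter> ?I m j) * (blinfun_apply (h m j) x \<bullet> 1)" for j
      proof (cases "?A \<inter> ?I m j = {}")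
        case False
        then have "blinfun_apply (h m j) \<in> L (T n k)" using inT[OF m False] by (simp add: TS)
        then show ?thesis using XCLR[OF relT[of n k]] by (intro mult_left_mono) (auto simp: x_def c_def)
      qed simp
      then have "(\<Sum>j<2^m. ?m (?A \<inter> ?I m j) * (c + \<epsilon> / 3)) \<le> blinfun_apply (G' m ?A) x \<bullet> 1"
        unfolding sumx by (rule sum_mono)
      then show ?thesis by (simp only: sum_distrib_right[symmetric] m_sum[OF Isets] mA)
    qed
    have B: "blinfun_apply (G' m ?B) x \<bullet> 1 \<le> (1/2) ^ Suc n * c" if m: "Suc n \<le> m" for m
    proof -
      have "?m (?B \<inter> ?I m j) * (blinfun_apply (h m j) x \<bullet> 1) \<le> ?m (?B \<inter> ?I m j) * c" for j
      proof (cases "?B \<inter> ?I m j = {}")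
        case False
        then have "blinfun_apply (h m j) \<in> R (T n k)" using inT[OF m False] by (simp add: TS)
        then show ?thesis using XCLR[OF relT[of n k]] by (intro mult_left_mono) (auto simp: x_def c_def)
      qed simp
      then have "blinfun_apply (G' m ?B) x \<bullet> 1 \<le> (\<Sum>j<2^m. ?m (?B \<inter> ?I m j) * c)"
        unfolding sumx by (rule sum_mono)
      then show ?thesis by (simp only: sum_distrib_right[symmetric] m_sum[OF Isets] mA)
    qed
    have ev: "\<forall>\<^sub>F m in F. Suc n \<le> m" using F(1) eventually_ge_at_top filter_leD by blast
    have "(1/2) ^ Suc n * (c + \<epsilon> / 3) \<le> blinfun_apply (G ?A) x \<bullet> 1"
      unfolding Gapp[OF Isets]
      by (rule tendsto_lowerbound[OF tendsto_inner[OF lim[OF Isets] tendsto_const] eventually_mono[OF ev A] F(2)])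
    moreover have "blinfun_apply (G ?B) x \<bullet> 1 \<le> (1/2) ^ Suc n * c"
      unfolding Gapp[OF Isets]
      by (rule tendsto_upperbound[OF tendsto_inner[OF lim[OF Isets] tendsto_const] eventually_mono[OF ev B] F(2)])
    ultimately have "(1/2) ^ Suc n * (\<epsilon> / 3) \<le> blinfun_apply (G ?A - G ?B) x \<bullet> 1"
      by (simp add: blinfun.diff_left inner_diff_left algebra_simps)
    also have "\<dots> \<le> norm (blinfun_apply (G ?A - G ?B) x)" by (rule inner_one_le_norm)
    also have "\<dots> \<le> norm (G ?A - G ?B)" using norm_blinfun[of "G ?A - G ?B" x] x1 by simp
    finally show ?thesis .
  qed
  \<comment> \<open>The \<open>2 ^ n\<close> gaps of size
    \<open>(1/2) ^ Suc n * (\<epsilon> / 3)\<close> add up to \<open>\<epsilon> / 6\<close> on every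
    level.\<close>
  have "\<epsilon> / 6 \<le> (\<Sum>k<2^n. norm (G (?I (Suc n) (2 * k)) - G (?I (Suc n) (2 * k + 1))))" for n
  proof -
    have "\<epsilon> / 6 = (\<Sum>k<(2^n::nat). (1/2) ^ Suc n * (\<epsilon> / 3))" by (simp add: power_divide)
    also have "\<dots> \<le> (\<Sum>k<2^n. norm (G (?I (Suc n) (2 * k)) - G (?I (Suc n) (2 * k + 1))))"
      by (rule sum_mono) (use gap in auto)
    finally show ?thesis .
  qed
  then have "\<epsilon> / 6 \<le> 0"
    by (intro LIMSEQ_le_const[OF unit_interval.density_oscillation_tendsto_0[OF g gG]]) auto
  then show False using \<epsilon> by simp
qed

subsection \<open>The approximation property\<close>

lemma compact_insert_limit_range:
  fixes f :: "nat \<Rightarrow> 'e::topological_space"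
  assumes "f \<longlonglongrightarrow> l"
  shows "compact (insert l (range f))"
proof (rule compactI)
  fix C assume C: "\<forall>t\<in>C. open t" "insert l (range f) \<subseteq> \<Union>C"
  then obtain U where U: "U \<in> C" "l \<in> U" by blast
  then have "\<forall>\<^sub>F n in sequentially. f n \<in> U" using C(1) assms topological_tendstoD by blast
  then obtain N where N: "\<And>n. n \<ge> N \<Longrightarrow> f n \<in> U" unfolding eventually_sequentially by blast
  have "\<forall>n. \<exists>V\<in>C. f n \<in> V" using C(2) by blast
  then obtain V where V: "\<And>n. V n \<in> C" "\<And>n. f n \<in> V n" by metis
  have "insert l (range f) \<subseteq> \<Union>(insert U (V ` {..<N}))"
    using U N V(2) by (auto simp: not_less) (metis lessThan_iff not_le)
  then show "\<exists>C'\<subseteq>C. finite C' \<and> insert l (range f) \<subseteq> \<Union>C'"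
    using U V(1) by (intro exI[of _ "insert U (V ` {..<N})"]) auto
qed

text \<open>With \<open>c n\<close> the square root of the tail \<open>r n\<close>, the quotients
  are dominated by the telescoping differences
  \<open>2 * (sqrt (r n) - sqrt (r (Suc n)))\<close>.\<close>

lemma summable_slowly_vanishing_weights:
  fixes a :: "nat \<Rightarrow> real"
  assumes a: "summable a" "\<And>n. 0 \<le> a n"
  obtains c where "\<And>n. 0 < c n" "c \<longlonglongrightarrow> 0" "summable (\<lambda>n. a n / c n)"
proof -
  \<comment> \<open>The geometric term keeps every tail strictly positive even where
    \<open>a\<close> vanishes.\<close>
  define b where "b n = a n + (1/2)^n" for n
  have b: "summable b" "\<And>n. 0 < b n"
    unfolding b_def using a by (auto intro!: summable_add summable_geometric add_nonneg_pos)
  define r where "r n = (\<Sum>i. b (i + n))" for n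
  have sb: "summable (\<lambda>i. b (i + n))" for n using b(1) by (simp add: summable_iff_shift)
  have r0: "0 < r n" for n unfolding r_def using sb b(2) by (intro suminf_pos) auto
  have r_Suc: "r n = b n + r (Suc n)" for n
    using suminf_split_head[OF sb[of n]] by (simp add: r_def)
  have rlim: "r \<longlonglongrightarrow> 0" unfolding r_def by (rule suminf_exist_split2[OF b(1)])
  have le: "a n / sqrt (r n) \<le> 2 * (sqrt (r n) - sqrt (r (Suc n)))" for n
  proof -
    have "sqrt (r (Suc n)) \<le> sqrt (r n)" using r_Suc[of n] b(2)[of n] by simp
    then have "a n \<le> (sqrt (r n) - sqrt (r (Suc n))) * (sqrt (r n) + sqrt (r n))"
    proof -
      have "a n \<le> b n" by (simp add: b_def)
      also have "b n = (sqrt (r n))^2 - (sqrt (r (Suc n)))^2" using r_Suc[of n] r0[of n] r0[of "Suc n"] by simp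
      also have "\<dots> = (sqrt (r n) - sqrt (r (Suc n))) * (sqrt (r n) + sqrt (r (Suc n)))"
        by (simp add: algebra_simps power2_eq_square)
      also have "\<dots> \<le> (sqrt (r n) - sqrt (r (Suc n))) * (sqrt (r n) + sqrt (r n))"
        using \<open>sqrt (r (Suc n)) \<le> sqrt (r n)\<close> by (intro mult_left_mono) auto
      finally show ?thesis .
    qed
    then show ?thesis using r0[of n] by (subst pos_divide_le_eq) (simp_all add: algebra_simps)
  qed
  have slim: "(\<lambda>n. sqrt (r n)) \<longlonglongrightarrow> 0" using tendsto_real_sqrt[OF rlim] by simp
  have "summable (\<lambda>n. sqrt (r n) - sqrt (r (Suc n)))" by (rule telescope_summable'[OF slim])
  then have "summable (\<lambda>n. 2 * (sqrt (r n) - sqrt (r (Suc n))))" by (rule summable_mult)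
  then have "summable (\<lambda>n. a n / sqrt (r n))"
    by (rule summable_comparison_test_ev[rotated])
      (use le a(2) r0 in \<open>auto intro!: always_eventually simp: less_imp_le\<close>)
  then show ?thesis using that[of "\<lambda>n. sqrt (r n)"] slim r0 by simp
qed

text \<open>
  A finite-dimensional space of functionals has a basis whose coordinate functionals are evaluations,
  so no equivalence of norms is needed to see that the coordinates are bounded.
\<close>

lemma dual_span_evaluations:
  fixes sX :: "'k::{real_normed_field,euclidean_space} \<Rightarrow> 'a::banach \<Rightarrow> 'a"
  assumes sX: "banach_over sX" and S: "finite S" "S \<subseteq> dual_space sX"
  shows "\<exists>(m::nat) x h. (\<forall>i<m. h i \<in> dual_space sX) \<and>
    (\<forall>f\<in>module.span dual_scale S. f = (\<Sum>i<m. dual_scale (blinfun_apply f (x i)) (h i)))"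
  using S
proof (induct rule: finite_induct)
  case empty
  interpret dual: banach_over "dual_scale :: 'k \<Rightarrow> ('a \<Rightarrow>\<^sub>L 'k) \<Rightarrow> ('a \<Rightarrow>\<^sub>L 'k)" by (rule banach_over_dual_scale)
  show ?case by (intro exI[of _ 0]) simp
next
  case (insert h0 S)
  interpret sX: banach_over sX by fact
  interpret dual: banach_over "dual_scale :: 'k \<Rightarrow> ('a \<Rightarrow>\<^sub>L 'k) \<Rightarrow> ('a \<Rightarrow>\<^sub>L 'k)" by (rule banach_over_dual_scale)
  let ?E = "dual_space sX"
  have subE: "module.subspace dual_scale ?E" by (rule subspace_dual_space)
  have "S \<subseteq> ?E" using insert.prems by simp
  from insert.hyps(3)[OF this] obtain m :: nat and x h where "\<forall>i<m. h i \<in> ?E"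
    "\<forall>f\<in>module.span dual_scale S. f = (\<Sum>i<m. dual_scale (blinfun_apply f (x i)) (h i))"
    by blast
  then have h: "\<And>i. i < m \<Longrightarrow> h i \<in> ?E"
    and rep: "\<And>f. f \<in> module.span dual_scale S \<Longrightarrow> f = (\<Sum>i<m. dual_scale (blinfun_apply f (x i)) (h i))"
    by blast+
  define P where "P f = (\<Sum>i<m. dual_scale (blinfun_apply f (x i)) (h i))" for f
  have P_add: "P (f + g) = P f + P g" for f g
    by (simp add: P_def blinfun.add_left dual.scale_left_distrib sum.distrib)
  have P_scale: "P (dual_scale c f) = dual_scale c (P f)" for c f
    by (simp add: P_def dual_scale_apply dual.scale_sum_right)
  \<comment> \<open>\<open>P\<close> fixes the span of \<open>S\<close>, so on the larger span
    \<open>f - P f\<close> is a multiple of the single vector \<open>d\<close>.\<close>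
  define d where "d = h0 - P h0"
  have PE: "P f \<in> ?E" for f
    unfolding P_def using h by (intro dual.subspace_sum[OF subE] dual.subspace_scale[OF subE]) auto
  have dE: "d \<in> ?E" unfolding d_def using insert.prems PE by (intro dual.subspace_diff[OF subE]) auto
  have spanE: "f \<in> ?E" if "f \<in> module.span dual_scale (insert h0 S)" for f
    using dual.span_minimal[OF insert.prems subE] that by blast
  have decomp: "\<exists>c. f - P f = dual_scale c d" if f: "f \<in> module.span dual_scale (insert h0 S)" for f
  proof -
    obtain c where c: "f - dual_scale c h0 \<in> module.span dual_scale S"
      using f unfolding dual.span_breakdown_eq by blast
    define s where "s = f - dual_scale c h0"
    have "P s = s" using rep c by (simp add: P_def s_def)
    moreover have fs: "f = s + dual_scale c h0" by (simp add: s_def)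
    moreover have "P f = P s + dual_scale c (P h0)" unfolding fs by (simp add: P_add P_scale)
    ultimately have "f - P f = dual_scale c d" by (simp add: d_def dual.scale_right_diff_distrib)
    then show ?thesis by blast
  qed
  show ?case
  proof (cases "d = 0")
    case True
    then have "f = P f" if "f \<in> module.span dual_scale (insert h0 S)" for f
      using decomp[OF that] by simp
    then show ?thesis unfolding P_def using h by blast
  next
    case False
    then obtain x0 where x0: "blinfun_apply d x0 \<noteq> 0" by (metis blinfun_eqI zero_blinfun.rep_eq)
    \<comment> \<open>The correction of \<open>x0\<close> makes evaluation of \<open>f\<close> at
      the new point equal to that of \<open>f - P f\<close> at \<open>x0\<close>; dividing by the
      value of \<open>d\<close> at \<open>x0\<close> recovers the coefficient of
      \<open>d\<close>.\<close>
    define x' where "x' i = (if i < m then x i else x0 - (\<Sum>i<m. sX (blinfun_apply (h i) x0) (x i)))" for i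
    define h' where "h' i = (if i < m then h i else dual_scale (inverse (blinfun_apply d x0)) d)" for i
    have "f = (\<Sum>i<Suc m. dual_scale (blinfun_apply f (x' i)) (h' i))"
      if f: "f \<in> module.span dual_scale (insert h0 S)" for f
    proof -
      have fE: "blinfun_apply f (sX c y) = c * blinfun_apply f y" for c y
        using spanE[OF f] by (simp add: dual_space_def)
      obtain c where c: "f - P f = dual_scale c d" using decomp[OF f] by blast
      have "blinfun_apply f (x' m) = blinfun_apply f x0 - blinfun_apply (P f) x0"
        by (simp add: x'_def P_def blinfun.diff_right blinfun.sum_right blinfun.sum_left fE dual_scale_apply mult.commute)
      also have "\<dots> = blinfun_apply (dual_scale c d) x0" by (simp only: c[symmetric] blinfun.diff_left)
      finally have "dual_scale (blinfun_apply f (x' m)) (h' m) = dual_scale c d"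
        using x0 by (simp add: h'_def dual_scale_apply)
      moreover have "(\<Sum>i<m. dual_scale (blinfun_apply f (x' i)) (h' i)) = P f"
        by (simp add: P_def x'_def h'_def)
      ultimately show ?thesis using c by (simp add: algebra_simps)
    qed
    moreover have "h' i \<in> ?E" if "i < Suc m" for i
      using h dual.subspace_scale[OF subE dE] by (simp add: h'_def)
    ultimately show ?thesis by blast
  qed
qed

lemma linear_map_on_sum:
  assumes T: "linear_map_on s s' E T" and s: "vector_space s" and s': "vector_space s'"
    and E: "module.subspace s E" and f: "\<And>i. i \<in> I \<Longrightarrow> f i \<in> E"
  shows "T (\<Sum>i\<in>I. s (c i) (f i)) = (\<Sum>i\<in>I. s' (c i) (T (f i)))"
proof -
  interpret s: vector_space s by fact
  interpret s': vector_space s' by fact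
  have T0: "T 0 = 0"
    using T s.subspace_0[OF E] s.scale_zero_left[of 0] s'.scale_zero_left[of "T 0"]
    unfolding linear_map_on_def by metis
  show ?thesis
    using f
  proof (induct I rule: infinite_finite_induct)
    case (insert i I)
    have "(\<Sum>i\<in>I. s (c i) (f i)) \<in> E" "s (c i) (f i) \<in> E"
      using insert.prems by (auto intro!: s.subspace_sum[OF E] s.subspace_scale[OF E])
    then show ?case using insert T by (simp add: linear_map_on_def)
  qed (simp_all add: T0)
qed

text \<open>For \<open>T\<close> of finite rank the series of \<open>\<tau> (T (f n)) (g n)\<close>
  vanishes: expanding \<open>T (f n)\<close> in finitely many \<open>h i\<close> moves the sum over
  \<open>n\<close> into the second factor, where \<open>null\<close> makes it 0. As \<open>T\<close>
  is within \<open>e\<close> of the identity on the compact set of 0 and all \<open>f n\<close>,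
  \<open>norm z\<close> is at most \<open>e\<close> times the sum of all
  \<open>norm (g n)\<close>.\<close>

lemma approximation_property_null_aux:
  fixes sX :: "'k::{real_normed_field,euclidean_space} \<Rightarrow> 'a::banach \<Rightarrow> 'a"
    and sY :: "'k \<Rightarrow> 'b::banach \<Rightarrow> 'b" and sT :: "'k \<Rightarrow> 'c::banach \<Rightarrow> 'c"
    and \<tau> :: "('a \<Rightarrow>\<^sub>L 'k) \<Rightarrow> ('b \<Rightarrow>\<^sub>L 'k) \<Rightarrow> 'c"
  assumes sX: "banach_over sX" and sT: "banach_over sT"
    and bil: "bilinear_map_on dual_scale dual_scale sT (dual_space sX) (dual_space sY) \<tau>"
    and \<tau>le: "\<And>f g. f \<in> dual_space sX \<Longrightarrow> g \<in> dual_space sY \<Longrightarrow> norm (\<tau> f g) \<le> norm f * norm g"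
    and ap: "approximation_property dual_scale (dual_space sX)"
    and f: "\<And>n. f n \<in> dual_space sX" "f \<longlonglongrightarrow> 0" and g: "\<And>n. g n \<in> dual_space sY" "summable (\<lambda>n. norm (g n))"
    and z: "(\<lambda>n. \<tau> (f n) (g n)) sums z"
    and null: "\<And>x y. (\<lambda>n. blinfun_apply (f n) x * blinfun_apply (g n) y) sums 0"
  shows "z = 0"
proof -
  let ?E = "dual_space sX" and ?F = "dual_space sY"
  interpret sT: banach_over sT by fact
  interpret E: banach_over "dual_scale :: 'k \<Rightarrow> ('a \<Rightarrow>\<^sub>L 'k) \<Rightarrow> ('a \<Rightarrow>\<^sub>L 'k)" by (rule banach_over_dual_scale)
  interpret F: banach_over "dual_scale :: 'k \<Rightarrow> ('b \<Rightarrow>\<^sub>L 'k) \<Rightarrow> ('b \<Rightarrow>\<^sub>L 'k)" by (rule banach_over_dual_scale)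
  have subE: "module.subspace dual_scale ?E" and subF: "module.subspace dual_scale ?F"
    by (rule subspace_dual_space)+
  have bilE: "linear_map_on dual_scale sT ?E (\<lambda>x. \<tau> x y)" if "y \<in> ?F" for y
    using bil that by (simp add: bilinear_map_on_def)
  have bilF: "linear_map_on dual_scale sT ?F (\<lambda>y. \<tau> x y)" if "x \<in> ?E" for x
    using bil that by (simp add: bilinear_map_on_def)
  obtain Bf where Bf: "\<And>n. norm (f n) \<le> Bf" using convergent_imp_Bseq[OF convergentI[OF f(2)]] by (auto simp: Bseq_def)
  have finite_rank_zero: "(\<lambda>n. \<tau> (T (f n)) (g n)) sums 0"
    if T: "linear_map_on dual_scale dual_scale ?E T" "T ` ?E \<subseteq> ?E" "\<And>x. x \<in> ?E \<Longrightarrow> norm (T x) \<le> B * norm x"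
      "finite S" "T ` ?E \<subseteq> module.span dual_scale S" for T B S
  proof -
    \<comment> \<open>The spanning set \<open>S\<close> need not lie in the dual space; an
      independent set inside the range of \<open>T\<close> does, as
      \<open>dual_span_evaluations\<close> requires.\<close>
    obtain D where D: "D \<subseteq> T ` ?E" "\<not> module.dependent dual_scale D" "T ` ?E \<subseteq> module.span dual_scale D"
      using E.maximal_independent_subset by blast
    have "finite D" using E.independent_span_bound[OF T(4) D(2)] D(1) T(5) by blast
    moreover have "D \<subseteq> ?E" using D(1) T(2) by blast
    ultimately obtain m :: nat and x h where h: "\<And>i. i < m \<Longrightarrow> h i \<in> ?E"
      and rep: "\<And>f. f \<in> module.span dual_scale D \<Longrightarrow> f = (\<Sum>i<m. dual_scale (blinfun_apply f (x i)) (h i))"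
      using dual_span_evaluations[OF sX] by meson
    \<comment> \<open>\<open>T\<close> need not be weak-star continuous, so pointwise vanishing
      cannot be pushed through it. For fixed \<open>y\<close> the sum is therefore shown to be 0 in
      norm first; the bound on \<open>T\<close> then carries this over.\<close>
    have fg_sum: "(\<lambda>n. dual_scale (blinfun_apply (g n) y) (f n)) sums 0" for y
    proof -
      have "summable (\<lambda>n. Bf * norm y * norm (g n))" by (intro summable_mult g(2))
      then have "summable (\<lambda>n. norm (dual_scale (blinfun_apply (g n) y) (f n)))"
      proof (rule summable_comparison_test'[where N=0])
        fix n
        have "norm (blinfun_apply (g n) y) * norm (f n) \<le> (norm (g n) * norm y) * Bf"
          using Bf by (intro mult_mono norm_blinfun) auto
        then show "norm (norm (dual_scale (blinfun_apply (g n) y) (f n))) \<le> Bf * norm y * norm (g n)"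
          by (simp add: E.norm_scale mult.commute mult.left_commute)
      qed
      then have "summable (\<lambda>n. dual_scale (blinfun_apply (g n) y) (f n))" by (rule summable_norm_cancel)
      then obtain s where s: "(\<lambda>n. dual_scale (blinfun_apply (g n) y) (f n)) sums s" by blast
      have "s = 0"
      proof (rule blinfun_eqI)
        fix x
        have "(\<lambda>n. blinfun_apply (dual_scale (blinfun_apply (g n) y) (f n)) x) sums blinfun_apply s x"
          using bounded_linear.sums[OF blinfun.bounded_linear_left s] .
        then have "(\<lambda>n. blinfun_apply (f n) x * blinfun_apply (g n) y) sums blinfun_apply s x"
          by (simp add: dual_scale_apply mult.commute)
        then show "blinfun_apply s x = blinfun_apply 0 x" using sums_unique2[OF _ null] by simp
      qed
      then show ?thesis using s by simp
    qed
    have Tfg: "(\<lambda>N. \<Sum>n<N. dual_scale (blinfun_apply (g n) y) (T (f n))) \<longlonglongrightarrow> 0" for y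
    proof -
      have "(\<lambda>N. T (\<Sum>n<N. dual_scale (blinfun_apply (g n) y) (f n))) \<longlonglongrightarrow> 0"
      proof (rule Lim_null_comparison[OF always_eventually])
        show "\<forall>N. norm (T (\<Sum>n<N. dual_scale (blinfun_apply (g n) y) (f n))) \<le> B * norm (\<Sum>n<N. dual_scale (blinfun_apply (g n) y) (f n))"
          using f(1) by (intro allI T(3) E.subspace_sum[OF subE] E.subspace_scale[OF subE]) auto
        show "(\<lambda>N. B * norm (\<Sum>n<N. dual_scale (blinfun_apply (g n) y) (f n))) \<longlonglongrightarrow> 0"
          using tendsto_mult_right_zero[OF tendsto_norm_zero[OF fg_sum[unfolded sums_def]]] .
      qed
      moreover have "T (\<Sum>n<N. dual_scale (blinfun_apply (g n) y) (f n)) = (\<Sum>n<N. dual_scale (blinfun_apply (g n) y) (T (f n)))" for N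
        by (rule linear_map_on_sum[OF T(1) E.vector_space_axioms E.vector_space_axioms subE f(1)])
      ultimately show ?thesis by simp
    qed
    define G where "G i n = dual_scale (blinfun_apply (T (f n)) (x i)) (g n)" for i n
    have GF: "G i n \<in> ?F" for i n unfolding G_def by (intro F.subspace_scale[OF subF] g)
    have G_sum: "(\<lambda>n. G i n) sums 0" for i
    proof -
      have "summable (\<lambda>n. (\<bar>B\<bar> * Bf * norm (x i)) * norm (g n))" by (intro summable_mult g(2))
      then have "summable (\<lambda>n. norm (G i n))"
      proof (rule summable_comparison_test'[where N=0])
        fix n
        have "norm (blinfun_apply (T (f n)) (x i)) \<le> norm (T (f n)) * norm (x i)" by (rule norm_blinfun)
        also have "\<dots> \<le> (\<bar>B\<bar> * Bf) * norm (x i)"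
        proof (rule mult_right_mono)
          have "norm (T (f n)) \<le> B * norm (f n)" by (rule T(3)[OF f(1)])
          also have "\<dots> \<le> \<bar>B\<bar> * Bf" using Bf[of n] by (intro mult_mono) auto
          finally show "norm (T (f n)) \<le> \<bar>B\<bar> * Bf" .
        qed auto
        finally show "norm (norm (G i n)) \<le> (\<bar>B\<bar> * Bf * norm (x i)) * norm (g n)"
          by (simp add: G_def F.norm_scale mult_right_mono)
      qed
      then have "summable (\<lambda>n. G i n)" by (rule summable_norm_cancel)
      then obtain s where s: "(\<lambda>n. G i n) sums s" by blast
      have "s = 0"
      proof (rule blinfun_eqI)
        fix y
        have "(\<lambda>n. blinfun_apply (G i n) y) sums blinfun_apply s y"
          using bounded_linear.sums[OF blinfun.bounded_linear_left s] .
        moreover have "(\<lambda>n. blinfun_apply (G i n) y) sums 0"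
        proof -
          have "(\<lambda>N. blinfun_apply (\<Sum>n<N. dual_scale (blinfun_apply (g n) y) (T (f n))) (x i)) \<longlonglongrightarrow> blinfun_apply 0 (x i)"
            by (rule bounded_linear.tendsto[OF blinfun.bounded_linear_left Tfg])
          then show ?thesis
            by (simp add: sums_def G_def dual_scale_apply blinfun.sum_left mult.commute)
        qed
        ultimately show "blinfun_apply s y = blinfun_apply 0 y" using sums_unique2 by (metis zero_blinfun.rep_eq)
      qed
      then show ?thesis using s by simp
    qed
    have tau_sum: "\<tau> (T (f n)) (g n) = (\<Sum>i<m. \<tau> (h i) (G i n))" for n
    proof -
      have "T (f n) = (\<Sum>i<m. dual_scale (blinfun_apply (T (f n)) (x i)) (h i))"
        using rep D(3) f(1) by blast
      then have "\<tau> (T (f n)) (g n) = \<tau> (\<Sum>i<m. dual_scale (blinfun_apply (T (f n)) (x i)) (h i)) (g n)"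
        by simp
      also have "\<dots> = (\<Sum>i<m. sT (blinfun_apply (T (f n)) (x i)) (\<tau> (h i) (g n)))"
        using h by (intro linear_map_on_sum[OF bilE[OF g(1)] E.vector_space_axioms sT.vector_space_axioms subE]) auto
      also have "\<dots> = (\<Sum>i<m. \<tau> (h i) (G i n))"
        using h g(1) bilF by (intro sum.cong refl) (auto simp: G_def linear_map_on_def)
      finally show ?thesis .
    qed
    have "(\<lambda>n. \<tau> (h i) (G i n)) sums 0" if i: "i < m" for i
      unfolding sums_def
    proof (rule Lim_null_comparison[OF always_eventually])
      show "\<forall>N. norm (\<Sum>n<N. \<tau> (h i) (G i n)) \<le> norm (h i) * norm (\<Sum>n<N. G i n)"
      proof
        fix N
        have "\<tau> (h i) (\<Sum>n\<in>{..<N}. dual_scale 1 (G i n)) = (\<Sum>n\<in>{..<N}. sT 1 (\<tau> (h i) (G i n)))"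
          by (intro linear_map_on_sum[OF bilF[OF h[OF i]] F.vector_space_axioms sT.vector_space_axioms subF] GF)
        then have "(\<Sum>n<N. \<tau> (h i) (G i n)) = \<tau> (h i) (\<Sum>n<N. G i n)" by simp
        then show "norm (\<Sum>n<N. \<tau> (h i) (G i n)) \<le> norm (h i) * norm (\<Sum>n<N. G i n)"
          using \<tau>le[OF h[OF i] F.subspace_sum[OF subF GF]] by simp
      qed
      show "(\<lambda>N. norm (h i) * norm (\<Sum>n<N. G i n)) \<longlonglongrightarrow> 0"
        using tendsto_mult_right_zero[OF tendsto_norm_zero[OF G_sum[unfolded sums_def]]] .
    qed
    then have "(\<lambda>n. \<Sum>i<m. \<tau> (h i) (G i n)) sums (\<Sum>i<m. 0)" by (intro sums_sum) auto
    then show ?thesis by (simp add: tau_sum)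
  qed
  define s where "s = (\<Sum>n. norm (g n))"
  have s0: "0 \<le> s" unfolding s_def by (intro suminf_nonneg g(2)) auto
  have le_z: "norm z \<le> e * (s + 1)" if e: "0 < e" for e
  proof -
    have "compact (insert 0 (range f)) \<and> insert 0 (range f) \<subseteq> ?E \<and> e > 0"
      using compact_insert_limit_range[OF f(2)] f(1) E.subspace_0[OF subE] e by auto
    from ap[unfolded approximation_property_def, THEN spec, THEN spec, THEN mp, OF this]
    obtain T B S where T: "linear_map_on dual_scale dual_scale ?E T" "T ` ?E \<subseteq> ?E"
      and TB: "\<forall>x\<in>?E. norm (T x) \<le> B * norm x"
      and near: "\<forall>x\<in>insert 0 (range f). norm (T x - x) \<le> e"
      and TS: "finite S" "T ` ?E \<subseteq> module.span dual_scale S"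
      by (elim exE conjE) (rule that; assumption)
    have "(\<lambda>n. \<tau> (f n) (g n) - \<tau> (T (f n)) (g n)) sums (z - 0)"
      by (intro sums_diff z finite_rank_zero[OF T TB[rule_format] TS])
    then have zs: "(\<lambda>n. \<tau> (f n) (g n) - \<tau> (T (f n)) (g n)) sums z" by simp
    have le: "norm (\<tau> (f n) (g n) - \<tau> (T (f n)) (g n)) \<le> e * norm (g n)" for n
    proof -
      have TE: "T (f n) \<in> ?E" using T(2) f(1) by blast
      have "f n - T (f n) \<in> ?E" by (intro E.subspace_diff[OF subE] f(1) TE)
      then have "\<tau> ((f n - T (f n)) + T (f n)) (g n) = \<tau> (f n - T (f n)) (g n) + \<tau> (T (f n)) (g n)"
        using bilE[OF g(1)] TE unfolding linear_map_on_def by blast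
      then have "norm (\<tau> (f n) (g n) - \<tau> (T (f n)) (g n)) \<le> norm (f n - T (f n)) * norm (g n)"
        using \<tau>le[OF \<open>f n - T (f n) \<in> ?E\<close> g(1)] by simp
      also have "\<dots> \<le> e * norm (g n)"
        using near by (intro mult_right_mono) (auto simp: norm_minus_commute)
      finally show ?thesis .
    qed
    have sm: "summable (\<lambda>n. e * norm (g n))" by (intro summable_mult g(2))
    have "norm z \<le> (\<Sum>n. e * norm (g n))"
      unfolding sums_unique[OF zs] using le sm by (rule norm_suminf_le)
    also have "\<dots> = e * s" unfolding s_def by (rule suminf_mult[OF g(2)])
    finally show ?thesis using e by (simp add: algebra_simps)
  qed
  have "norm z \<le> 0 + e" if "0 < e" for e
    using le_z[of "e / (s + 1)"] s0 that by simp
  then have "norm z \<le> 0" by (rule field_le_epsilon)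
  then show ?thesis by simp
qed

text \<open>The factors are rescaled so that the first ones tend to 0 while the norms of the second
  ones stay summable. With 0 added, the first ones form a compact set, on which the approximation
  property can act.\<close>

lemma approximation_property_null:
  fixes sX :: "'k::{real_normed_field,euclidean_space} \<Rightarrow> 'a::banach \<Rightarrow> 'a"
    and sY :: "'k \<Rightarrow> 'b::banach \<Rightarrow> 'b" and sT :: "'k \<Rightarrow> 'c::banach \<Rightarrow> 'c"
    and \<tau> :: "('a \<Rightarrow>\<^sub>L 'k) \<Rightarrow> ('b \<Rightarrow>\<^sub>L 'k) \<Rightarrow> 'c"
  assumes sX: "banach_over sX" and sT: "banach_over sT"
    and bil: "bilinear_map_on dual_scale dual_scale sT (dual_space sX) (dual_space sY) \<tau>"
    and \<tau>le: "\<And>f g. f \<in> dual_space sX \<Longrightarrow> g \<in> dual_space sY \<Longrightarrow> norm (\<tau> f g) \<le> norm f * norm g"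
    and ap: "approximation_property dual_scale (dual_space sX)"
    and f: "\<And>n. f n \<in> dual_space sX" and g: "\<And>n. g n \<in> dual_space sY"
    and fg: "summable (\<lambda>n. norm (f n) * norm (g n))"
    and z: "(\<lambda>n. \<tau> (f n) (g n)) sums z"
    and null: "\<And>x y. (\<lambda>n. blinfun_apply (f n) x * blinfun_apply (g n) y) sums 0"
  shows "z = 0"
proof -
  interpret sT: banach_over sT by fact
  interpret E: banach_over "dual_scale :: 'k \<Rightarrow> ('a \<Rightarrow>\<^sub>L 'k) \<Rightarrow> ('a \<Rightarrow>\<^sub>L 'k)" by (rule banach_over_dual_scale)
  interpret F: banach_over "dual_scale :: 'k \<Rightarrow> ('b \<Rightarrow>\<^sub>L 'k) \<Rightarrow> ('b \<Rightarrow>\<^sub>L 'k)" by (rule banach_over_dual_scale)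
  obtain c where c: "\<And>n. 0 < c n" "c \<longlonglongrightarrow> 0" "summable (\<lambda>n. norm (f n) * norm (g n) / c n)"
    using summable_slowly_vanishing_weights[OF fg] by auto
  \<comment> \<open>If \<open>f n = 0\<close>, the convention for division by 0 makes both rescaled
    factors 0, and all identities persist.\<close>
  define f' where "f' n = dual_scale (of_real (c n / norm (f n))) (f n)" for n
  define g' where "g' n = dual_scale (of_real (norm (f n) / c n)) (g n)" for n
  have f'E: "f' n \<in> dual_space sX" for n
    unfolding f'_def by (intro E.subspace_scale[OF subspace_dual_space] f)
  have g'F: "g' n \<in> dual_space sY" for n
    unfolding g'_def by (intro F.subspace_scale[OF subspace_dual_space] g)
  have f_eq: "f n = dual_scale (of_real (norm (f n) / c n)) (f' n)" for n
  proof (cases "f n = 0")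
    case False
    then have "norm (f n) / c n * (c n / norm (f n)) = 1" using c(1)[of n] by simp
    then have "of_real (norm (f n) / c n) * of_real (c n / norm (f n)) = (1 :: 'k)"
      by (metis of_real_mult of_real_1)
    then show ?thesis unfolding f'_def E.scale_scale by simp
  qed (simp add: f'_def)
  show ?thesis
  proof (rule approximation_property_null_aux[OF sX sT bil \<tau>le ap f'E _ g'F])
    show "f' \<longlonglongrightarrow> 0"
    proof (rule Lim_null_comparison[OF always_eventually c(2)], intro allI)
      fix n show "norm (f' n) \<le> c n"
        using c(1)[of n] by (cases "f n = 0") (simp_all add: f'_def E.norm_scale norm_divide)
    qed
    show "summable (\<lambda>n. norm (g' n))"
      using c(3) by (simp add: g'_def F.norm_scale norm_divide abs_of_pos[OF c(1)])
    have "\<tau> (f n) (g n) = \<tau> (f' n) (g' n)" for n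
    proof -
      have "\<tau> (f n) (g n) = sT (of_real (norm (f n) / c n)) (\<tau> (f' n) (g n))"
        using bil f'E[of n] g[of n] f_eq[of n] unfolding bilinear_map_on_def linear_map_on_def by metis
      also have "\<dots> = \<tau> (f' n) (g' n)"
        using bil f'E[of n] g[of n] unfolding bilinear_map_on_def linear_map_on_def g'_def by metis
      finally show ?thesis .
    qed
    then show "(\<lambda>n. \<tau> (f' n) (g' n)) sums z" using z by simp
    fix x y
    have "blinfun_apply (f' n) x * blinfun_apply (g' n) y = blinfun_apply (f n) x * blinfun_apply (g n) y" for n
      by (subst f_eq[of n]) (simp add: g'_def dual_scale_apply)
    then show "(\<lambda>n. blinfun_apply (f' n) x * blinfun_apply (g' n) y) sums 0" using null by simp
  qed
qed

subsection \<open>The projective tensor product of two duals\<close>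

text \<open>Functionals are taken as plain functions because the product topology of the function
  type induces the weak-star topology, whereas the type of bounded maps carries the norm
  topology.\<close>

definition dual_ball :: "('k::{real_normed_field,euclidean_space} \<Rightarrow> 'a::banach \<Rightarrow> 'a) \<Rightarrow> ('a \<Rightarrow> 'k) set" where
  "dual_ball s = blinfun_apply ` {f \<in> dual_space s. norm f \<le> 1}"

text \<open>Banach-Alaoglu: the ball is cut out of a product of compact balls by pointwise linearity
  conditions, which are closed.\<close>

lemma compact_dual_ball:
  fixes s :: "'k::{real_normed_field,euclidean_space} \<Rightarrow> 'a::banach \<Rightarrow> 'a"
  assumes "banach_over s"
  shows "compact (dual_ball s)" "closed (dual_ball s)"
proof -
  interpret banach_over s by fact
  define A where "A = (\<Inter>x. \<Inter>y. {u :: 'a \<Rightarrow> 'k. u (x + y) = u x + u y})"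
  define H where "H = (\<Inter>c. \<Inter>x. {u :: 'a \<Rightarrow> 'k. u (s c x) = c * u x})"
  have AH: "closed A" "closed H" unfolding A_def H_def
    by (intro closed_INT ballI closed_Collect_eq continuous_intros continuous_on_product_coordinates)+
  have "compact (PiE UNIV (\<lambda>x. cball (0::'k) (norm x)) \<inter> (A \<inter> H))"
    by (intro compact_Int_closed compact_PiE_cball closed_Int AH)
  moreover have "closed (PiE UNIV (\<lambda>x. cball (0::'k) (norm x)) \<inter> (A \<inter> H))"
    by (intro closed_Int closed_PiE_cball AH)
  moreover have "dual_ball s = PiE UNIV (\<lambda>x. cball 0 (norm x)) \<inter> (A \<inter> H)"
  proof (intro set_eqI iffI)
    fix u assume "u \<in> dual_ball s"
    then obtain f where f: "f \<in> dual_space s" "norm f \<le> 1" "u = blinfun_apply f" by (auto simp: dual_ball_def)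
    have "norm (u x) \<le> norm x" for x
    proof -
      have "norm (u x) \<le> norm f * norm x" unfolding f(3) by (rule norm_blinfun)
      also have "\<dots> \<le> 1 * norm x" using f(2) by (intro mult_right_mono) auto
      finally show ?thesis by simp
    qed
    then show "u \<in> PiE UNIV (\<lambda>x. cball 0 (norm x)) \<inter> (A \<inter> H)"
      using f by (auto simp: A_def H_def PiE_def Pi_def dual_space_def blinfun.add_right)
  next
    fix u assume "u \<in> PiE UNIV (\<lambda>x. cball 0 (norm x)) \<inter> (A \<inter> H)"
    then have u: "norm (u x) \<le> norm x" "u (x + y) = u x + u y" "u (s c x) = c * u x" for x y c
      by (auto simp: A_def H_def PiE_def Pi_def)
    have "bounded_linear u"
    proof (rule bounded_linear_intro[of _ 1])
      show "u (r *\<^sub>R x) = r *\<^sub>R u x" for r x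
        using u(3)[of "of_real r" x] by (simp add: scale_of_real scaleR_conv_of_real)
    qed (use u in auto)
    then have app: "blinfun_apply (Blinfun u) = u" by (rule bounded_linear_Blinfun_apply)
    have "norm (Blinfun u) \<le> 1" by (rule norm_blinfun_bound) (use u in \<open>auto simp: app\<close>)
    moreover have "Blinfun u \<in> dual_space s" using u by (simp add: dual_space_def app)
    ultimately show "u \<in> dual_ball s" using app unfolding dual_ball_def by force
  qed
  ultimately show "compact (dual_ball s)" "closed (dual_ball s)" by simp_all
qed

lemma sums_interleave:
  fixes f g :: "nat \<Rightarrow> 'e::real_normed_vector"
  assumes "f sums x" "g sums y"
  shows "(\<lambda>n. if even n then f (n div 2) else g (n div 2)) sums (x + y)"
proof -
  have "(\<Sum>i<N. if even i then f (i div 2) else g (i div 2)) = (\<Sum>i<Suc N div 2. f i) + (\<Sum>i<N div 2. g i)" for N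
  proof (induct N)
    case (Suc N)
    then show ?case by (cases "even N") (auto elim!: evenE oddE)
  qed simp
  moreover have "(\<lambda>N. (\<Sum>i<Suc N div 2. f i) + (\<Sum>i<N div 2. g i)) \<longlonglongrightarrow> x + y"
  proof (intro tendsto_add)
    have d: "filterlim (\<lambda>N::nat. N div 2) sequentially sequentially" by (rule filterlim_at_top_div_const_nat) simp
    show "(\<lambda>N. \<Sum>i<N div 2. g i) \<longlonglongrightarrow> y"
      using assms(2) unfolding sums_def by (rule filterlim_compose[OF _ d])
    show "(\<lambda>N. \<Sum>i<Suc N div 2. f i) \<longlonglongrightarrow> x"
      using assms(1) unfolding sums_def by (rule filterlim_compose[OF _ filterlim_compose[OF d filterlim_Suc]])
  qed
  ultimately show ?thesis by (simp add: sums_def)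
qed

lemma sums_if_lessThan:
  fixes f :: "nat \<Rightarrow> 'e::real_normed_vector"
  shows "(\<lambda>i. if i < n then f i else 0) sums (\<Sum>i<n. f i)"
  using sums_If_finite_set[of "{..<n}" f] by simp

lemma scaleR_norm_sgn: "norm x *\<^sub>R sgn x = (x :: 'e::real_normed_vector)"
  by (cases "x = 0") (simp_all add: sgn_div_norm)

lemma sum_lessThan_add:
  fixes h :: "nat \<Rightarrow> 'e::comm_monoid_add"
  shows "(\<Sum>i<n + m. h i) = (\<Sum>i<n. h i) + (\<Sum>i<m. h (n + i))"
  by (induct m) (simp_all add: add.assoc)

lemma subspace_closure:
  fixes S :: "'e::real_normed_vector set"
  assumes "subspace S"
  shows "subspace (closure S)"
proof (rule subspaceI)
  show "0 \<in> closure S" using subspace_0[OF assms] closure_subset by blast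
next
  fix x y assume "x \<in> closure S" "y \<in> closure S"
  then obtain f g where f: "\<And>n. f n \<in> S" "f \<longlonglongrightarrow> x" and g: "\<And>n. g n \<in> S" "g \<longlonglongrightarrow> y"
    unfolding closure_sequential by blast
  show "x + y \<in> closure S" unfolding closure_sequential
    using tendsto_add[OF f(2) g(2)] subspace_add[OF assms f(1) g(1)] by (intro exI[of _ "\<lambda>n. f n + g n"]) auto
next
  fix c x assume "x \<in> closure S"
  then obtain f where f: "\<And>n. f n \<in> S" "f \<longlonglongrightarrow> x" unfolding closure_sequential by blast
  show "c *\<^sub>R x \<in> closure S" unfolding closure_sequential
    using tendsto_scaleR[OF tendsto_const f(2)] subspace_scale[OF assms f(1)] by (intro exI[of _ "\<lambda>n. c *\<^sub>R f n"]) auto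
qed

locale dual_tensor_product =
  fixes sX :: "'k::{real_normed_field,euclidean_space} \<Rightarrow> 'a::banach \<Rightarrow> 'a"
    and sY :: "'k \<Rightarrow> 'b::banach \<Rightarrow> 'b"
    and sT :: "'k \<Rightarrow> 'c::banach \<Rightarrow> 'c"
    and t :: "('a \<Rightarrow>\<^sub>L 'k) \<Rightarrow> ('b \<Rightarrow>\<^sub>L 'k) \<Rightarrow> 'c"
  assumes sX: "banach_over sX" and sY: "banach_over sY"
    and tensor: "is_projective_tensor_product dual_scale (dual_space sX) dual_scale (dual_space sY) sT t"
begin

sublocale sX: banach_over sX by (rule sX)
sublocale sY: banach_over sY by (rule sY)
sublocale sT: banach_over sT using tensor by (simp add: is_projective_tensor_product_def)
sublocale E: banach_over "dual_scale :: 'k \<Rightarrow> ('a \<Rightarrow>\<^sub>L 'k) \<Rightarrow> ('a \<Rightarrow>\<^sub>L 'k)" by (rule banach_over_dual_scale)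
sublocale F: banach_over "dual_scale :: 'k \<Rightarrow> ('b \<Rightarrow>\<^sub>L 'k) \<Rightarrow> ('b \<Rightarrow>\<^sub>L 'k)" by (rule banach_over_dual_scale)

abbreviation "E \<equiv> dual_space sX"
abbreviation "F \<equiv> dual_space sY"
abbreviation "alg \<equiv> algebraic_tensors sT E F t"
abbreviation "Z \<equiv> projective_tensors sT E F t"

lemmas subE = subspace_dual_space[of sX] and subF = subspace_dual_space[of sY]

lemma scaleR_E: "f \<in> E \<Longrightarrow> r *\<^sub>R f \<in> E"
  using E.subspace_scale[OF subE, of f "of_real r"] by (simp add: E.scale_of_real)

lemma scaleR_F: "g \<in> F \<Longrightarrow> r *\<^sub>R g \<in> F"
  using F.subspace_scale[OF subF, of g "of_real r"] by (simp add: F.scale_of_real)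

lemma bil: "bilinear_map_on dual_scale dual_scale sT E F t"
  using tensor by (simp add: is_projective_tensor_product_def)

lemma bilinear_scaleR:
  assumes b: "bilinear_map_on dual_scale dual_scale s E F b" and s: "\<And>r x. s (of_real r) x = r *\<^sub>R x"
    and fg: "f \<in> E" "g \<in> F"
  shows "b (r *\<^sub>R f) g = r *\<^sub>R b f g" "b f (r *\<^sub>R g) = r *\<^sub>R b f g"
proof -
  have "b (dual_scale (of_real r) f) g = s (of_real r) (b f g)" "b f (dual_scale (of_real r) g) = s (of_real r) (b f g)"
    using b fg by (auto simp: bilinear_map_on_def linear_map_on_def)
  then show "b (r *\<^sub>R f) g = r *\<^sub>R b f g" "b f (r *\<^sub>R g) = r *\<^sub>R b f g"
    by (simp_all add: s E.scale_of_real F.scale_of_real)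
qed

lemmas t_scaleR = bilinear_scaleR[OF bil sT.scale_of_real]

lemma t_alg: "f \<in> E \<Longrightarrow> g \<in> F \<Longrightarrow> t f g \<in> alg"
  unfolding algebraic_tensors_def by (intro sT.span_base) blast

lemma alg_subspace: "module.subspace sT alg"
  unfolding algebraic_tensors_def by (rule sT.subspace_span)

lemma scaleR_alg: "w \<in> alg \<Longrightarrow> r *\<^sub>R w \<in> alg"
  using sT.subspace_scale[OF alg_subspace, of w "of_real r"] by (simp add: sT.scale_of_real)

lemma norm_alg: "w \<in> alg \<Longrightarrow> norm w = projective_norm E F t w"
  using tensor by (simp add: is_projective_tensor_product_def)

text \<open>Scalars are absorbed into the first factor, so plain sums of elementary tensors already
  form a subspace.\<close>

lemma alg_sum:
  assumes "w \<in> alg"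
  shows "\<exists>(n::nat) x y. (\<forall>i<n. x i \<in> E \<and> y i \<in> F) \<and> w = (\<Sum>i<n. t (x i) (y i))"
proof -
  define W where "W = {w. \<exists>(n::nat) x y. (\<forall>i<n. x i \<in> E \<and> y i \<in> F) \<and> w = (\<Sum>i<n. t (x i) (y i))}"
  have "module.subspace sT W"
  proof (rule sT.subspaceI)
    show "0 \<in> W" unfolding W_def by (intro CollectI exI[of _ 0]) simp
  next
    fix v w assume "v \<in> W" "w \<in> W"
    then obtain n m :: nat and x y x' y' where v: "\<forall>i<n. x i \<in> E \<and> y i \<in> F" "v = (\<Sum>i<n. t (x i) (y i))"
      and w: "\<forall>i<m. x' i \<in> E \<and> y' i \<in> F" "w = (\<Sum>i<m. t (x' i) (y' i))" unfolding W_def by blast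
    define X where "X i = (if i < n then x i else x' (i - n))" for i
    define Y where "Y i = (if i < n then y i else y' (i - n))" for i
    have "(\<Sum>i<n + m. t (X i) (Y i)) = v + w"
      unfolding sum_lessThan_add v(2) w(2) by (simp add: X_def Y_def)
    moreover have "X i \<in> E \<and> Y i \<in> F" if "i < n + m" for i
      using v(1) w(1) that by (auto simp: X_def Y_def)
    ultimately show "v + w \<in> W" unfolding W_def
      by (intro CollectI exI[of _ "n + m"] exI[of _ X] exI[of _ Y]) auto
  next
    fix c w assume "w \<in> W"
    then obtain n :: nat and x y where w: "\<forall>i<n. x i \<in> E \<and> y i \<in> F" "w = (\<Sum>i<n. t (x i) (y i))"
      unfolding W_def by blast
    have "t (dual_scale c (x i)) (y i) = sT c (t (x i) (y i))" if "i < n" for i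
      using bil w(1) that by (auto simp: bilinear_map_on_def linear_map_on_def)
    then have "sT c w = (\<Sum>i<n. t (dual_scale c (x i)) (y i))" by (simp add: w(2) sT.scale_sum_right)
    moreover have "dual_scale c (x i) \<in> E \<and> y i \<in> F" if "i < n" for i
      using w(1) that E.subspace_scale[OF subE] by blast
    ultimately show "sT c w \<in> W" unfolding W_def
      by (intro CollectI exI[of _ n] exI[of _ "\<lambda>i. dual_scale c (x i)"] exI[of _ y]) auto
  qed
  moreover have "{t x y |x y. x \<in> E \<and> y \<in> F} \<subseteq> W"
  proof
    fix w assume "w \<in> {t x y |x y. x \<in> E \<and> y \<in> F}"
    then obtain x y where "x \<in> E" "y \<in> F" "w = t x y" by blast
    then show "w \<in> W" unfolding W_def
      by (intro CollectI exI[of _ 1] exI[of _ "\<lambda>_. x"] exI[of _ "\<lambda>_. y"]) auto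
  qed
  ultimately have "alg \<subseteq> W" unfolding algebraic_tensors_def by (rule sT.span_minimal[rotated])
  then show ?thesis using assms unfolding W_def by blast
qed

lemma alg_near:
  assumes w: "w \<in> alg" and \<eta>: "0 < \<eta>"
  obtains n :: nat and x y where "\<And>i. i < n \<Longrightarrow> x i \<in> E \<and> y i \<in> F" "w = (\<Sum>i<n. t (x i) (y i))"
    "(\<Sum>i<n. norm (x i) * norm (y i)) < norm w + \<eta>"
proof -
  define S where "S = {(\<Sum>i<n. norm (x i) * norm (y i)) | (n::nat) x y.
            (\<forall>i<n. x i \<in> E \<and> y i \<in> F) \<and> w = (\<Sum>i<n. t (x i) (y i))}"
  have "S \<noteq> {}" using alg_sum[OF w] unfolding S_def by blast
  moreover have "bdd_below S" unfolding S_def by (auto intro!: bdd_belowI[of _ 0] sum_nonneg)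
  moreover have "Inf S < norm w + \<eta>" using norm_alg[OF w] \<eta> by (simp add: projective_norm_def S_def)
  ultimately obtain s where "s \<in> S" "s < norm w + \<eta>" using cInf_less_iff by blast
  then show ?thesis using that unfolding S_def by blast
qed

lemma norm_t_le:
  assumes "f \<in> E" "g \<in> F"
  shows "norm (t f g) \<le> norm f * norm g"
proof -
  have "norm f * norm g \<in> {(\<Sum>i<n. norm (x i) * norm (y i)) | (n::nat) x y.
            (\<forall>i<n. x i \<in> E \<and> y i \<in> F) \<and> t f g = (\<Sum>i<n. t (x i) (y i))}"
    using assms by (intro CollectI exI[of _ 1] exI[of _ "\<lambda>_. f"] exI[of _ "\<lambda>_. g"]) auto
  then have "projective_norm E F t (t f g) \<le> norm f * norm g"
    unfolding projective_norm_def by (intro cInf_lower bdd_belowI[of _ 0]) (auto intro!: sum_nonneg)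
  then show ?thesis using norm_alg[OF t_alg[OF assms]] by simp
qed

section \<open>The compact set \<open>K\<close> of pairs of functionals and the function space
  \<open>V\<close> on it\<close>

definition pt :: "('a \<Rightarrow>\<^sub>L 'k) \<Rightarrow> ('b \<Rightarrow>\<^sub>L 'k) \<Rightarrow> ('a \<Rightarrow> 'k) \<times> ('b \<Rightarrow> 'k)" where
  "pt f g = (blinfun_apply f, blinfun_apply g)"

definition K :: "(('a \<Rightarrow> 'k) \<times> ('b \<Rightarrow> 'k)) set" where
  "K = dual_ball sX \<times> dual_ball sY"

definition tau :: "('a \<Rightarrow> 'k) \<times> ('b \<Rightarrow> 'k) \<Rightarrow> 'c" where
  "tau k = t (Blinfun (fst k)) (Blinfun (snd k))"

lemma tau_pt [simp]: "tau (pt f g) = t f g"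
  by (simp add: tau_def pt_def blinfun_apply_inverse)

lemma compact_K: "compact K"
  unfolding K_def by (intro compact_Times compact_dual_ball sX sY)

lemma closed_K: "closed K"
  unfolding K_def by (intro closed_Times compact_dual_ball sX sY)

lemma K_cases:
  assumes "k \<in> K"
  obtains f g where "f \<in> E" "norm f \<le> 1" "g \<in> F" "norm g \<le> 1" "k = pt f g"
  using assms unfolding K_def dual_ball_def pt_def by auto

lemma pt_in_K: "f \<in> E \<Longrightarrow> norm f \<le> 1 \<Longrightarrow> g \<in> F \<Longrightarrow> norm g \<le> 1 \<Longrightarrow> pt f g \<in> K"
  unfolding K_def dual_ball_def pt_def by auto

lemma zero_in_K: "pt 0 0 \<in> K"
  by (intro pt_in_K) (auto intro: E.subspace_0[OF subE] F.subspace_0[OF subF])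

lemma sgn_E: "f \<in> E \<Longrightarrow> sgn f \<in> E" and sgn_F: "g \<in> F \<Longrightarrow> sgn g \<in> F"
  by (simp_all add: sgn_div_norm scaleR_E scaleR_F)

lemma sgn_in_K: "f \<in> E \<Longrightarrow> g \<in> F \<Longrightarrow> pt (sgn f) (sgn g) \<in> K"
  by (intro pt_in_K sgn_E sgn_F) (auto simp: norm_sgn)

lemma tau_alg: "k \<in> K \<Longrightarrow> tau k \<in> alg"
  by (erule K_cases) (auto intro: t_alg)

lemma norm_tau_le: "k \<in> K \<Longrightarrow> norm (tau k) \<le> 1"
proof (erule K_cases)
  fix f g assume fg: "f \<in> E" "norm f \<le> 1" "g \<in> F" "norm g \<le> 1" "k = pt f g"
  have "norm (t f g) \<le> norm f * norm g" by (rule norm_t_le[OF fg(1,3)])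
  also have "\<dots> \<le> 1 * 1" by (intro mult_mono fg) auto
  finally show ?thesis by (simp add: fg)
qed

lemma norm_mult_tau_sgn:
  assumes "f \<in> E" "g \<in> F"
  shows "(norm f * norm g) *\<^sub>R tau (pt (sgn f) (sgn g)) = t f g"
proof -
  have "t (norm f *\<^sub>R sgn f) (norm g *\<^sub>R sgn g) = (norm f * norm g) *\<^sub>R t (sgn f) (sgn g)"
    using assms by (simp add: t_scaleR scaleR_E scaleR_F sgn_E sgn_F)
  then show ?thesis by (simp add: scaleR_norm_sgn)
qed

text \<open>The form \<open>b\<close> is only assumed bilinear; its real part is bounded because
  \<open>v\<close> is. Vanishing off \<open>K\<close> makes the norm of \<open>v\<close> depend on
  its values on \<open>K\<close> alone.\<close>

definition V0 :: "(('a \<Rightarrow> 'k) \<times> ('b \<Rightarrow> 'k)) bfun set" where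
  "V0 = {v. (\<exists>b. bilinear_map_on dual_scale dual_scale (*) E F b \<and>
        (\<forall>f\<in>E. \<forall>g\<in>F. norm f \<le> 1 \<longrightarrow> norm g \<le> 1 \<longrightarrow> ev v (pt f g) = b f g \<bullet> 1)) \<and>
      continuous_on K (ev v) \<and> (\<forall>k. k \<notin> K \<longrightarrow> ev v k = 0)}"

text \<open>The closure makes the unit ball of \<open>V\<close> closed, as Bishop-Phelps demands.
  Its members are not tied to bilinear forms of their own; they inherit what is needed as closed
  conditions through \<open>V_closure_induct\<close>.\<close>

definition V :: "(('a \<Rightarrow> 'k) \<times> ('b \<Rightarrow> 'k)) bfun set" where
  "V = closure V0"

lemma V0E:
  assumes "v \<in> V0"
  obtains b where "bilinear_map_on dual_scale dual_scale (*) E F b"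
    "\<And>f g. f \<in> E \<Longrightarrow> g \<in> F \<Longrightarrow> norm f \<le> 1 \<Longrightarrow> norm g \<le> 1 \<Longrightarrow> ev v (pt f g) = b f g \<bullet> 1"
  using assms unfolding V0_def by blast

lemma subspace_V0: "subspace V0"
proof (rule subspaceI)
  show "0 \<in> V0" unfolding V0_def
    by (auto simp: bilinear_map_on_def linear_map_on_def intro!: exI[of _ "\<lambda>_ _. 0"])
next
  fix u v assume uv: "u \<in> V0" "v \<in> V0"
  obtain b b' where b: "bilinear_map_on dual_scale dual_scale (*) E F b"
    "\<And>f g. f \<in> E \<Longrightarrow> g \<in> F \<Longrightarrow> norm f \<le> 1 \<Longrightarrow> norm g \<le> 1 \<Longrightarrow> ev u (pt f g) = b f g \<bullet> 1"
    and b': "bilinear_map_on dual_scale dual_scale (*) E F b'"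
    "\<And>f g. f \<in> E \<Longrightarrow> g \<in> F \<Longrightarrow> norm f \<le> 1 \<Longrightarrow> norm g \<le> 1 \<Longrightarrow> ev v (pt f g) = b' f g \<bullet> 1"
    using V0E[OF uv(1)] V0E[OF uv(2)] by metis
  have "bilinear_map_on dual_scale dual_scale (*) E F (\<lambda>f g. b f g + b' f g)"
    using b(1) b'(1) unfolding bilinear_map_on_def linear_map_on_def by (simp add: algebra_simps)
  moreover have "continuous_on K (ev (u + v))"
    using uv continuous_on_add[of K "ev u" "ev v"] by (simp add: V0_def cong: continuous_on_cong)
  ultimately show "u + v \<in> V0" using uv b(2) b'(2) unfolding V0_def
    by (auto intro!: exI[of _ "\<lambda>f g. b f g + b' f g"] simp: inner_add_left)
next
  fix c v assume v: "v \<in> V0"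
  obtain b where b: "bilinear_map_on dual_scale dual_scale (*) E F b"
    "\<And>f g. f \<in> E \<Longrightarrow> g \<in> F \<Longrightarrow> norm f \<le> 1 \<Longrightarrow> norm g \<le> 1 \<Longrightarrow> ev v (pt f g) = b f g \<bullet> 1"
    using V0E[OF v] by metis
  have "bilinear_map_on dual_scale dual_scale (*) E F (\<lambda>f g. c *\<^sub>R b f g)"
    using b(1) unfolding bilinear_map_on_def linear_map_on_def by (simp add: algebra_simps)
  moreover have "continuous_on K (ev (c *\<^sub>R v))"
    using v continuous_on_mult_left[of K "ev v" c] by (simp add: V0_def cong: continuous_on_cong)
  ultimately show "c *\<^sub>R v \<in> V0" using v b(2) unfolding V0_def
    by (auto intro!: exI[of _ "\<lambda>f g. c *\<^sub>R b f g"])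
qed

lemma subspace_V: "subspace V"
  unfolding V_def by (rule subspace_closure[OF subspace_V0])

lemma closed_V: "closed V"
  by (simp add: V_def)

lemma V_closure_induct:
  assumes "v \<in> V" "closed {v. P v}" "\<And>v. v \<in> V0 \<Longrightarrow> P v"
  shows "P v"
  using closure_minimal[of V0 "{v. P v}"] assms unfolding V_def by blast

lemma continuous_ev: "continuous_on A (\<lambda>w. ev w k)"
  by (rule linear_continuous_on[OF bounded_linear_ev])

lemma V_continuous:
  assumes "v \<in> V"
  shows "continuous_on K (ev v)"
proof (rule V_closure_induct[OF assms])
  show "closed {v. continuous_on K (ev v)}"
    unfolding closed_sequential_limits
  proof (intro allI impI, elim conjE)
    fix f :: "nat \<Rightarrow> (('a \<Rightarrow> 'k) \<times> ('b \<Rightarrow> 'k)) bfun" and l assume f: "\<forall>n. f n \<in> {v. continuous_on K (ev v)}" "f \<longlonglongrightarrow> l"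
    have ul: "uniform_limit K (\<lambda>n. ev (f n)) (ev l) sequentially"
    proof (rule uniform_limitI)
      fix e :: real assume "0 < e"
      then have "\<forall>\<^sub>F n in sequentially. dist (f n) l < e" using f(2) tendstoD by blast
      then show "\<forall>\<^sub>F n in sequentially. \<forall>k\<in>K. dist (ev (f n) k) (ev l k) < e"
      proof (rule eventually_mono)
        fix n assume "dist (f n) l < e"
        then show "\<forall>k\<in>K. dist (ev (f n) k) (ev l k) < e"
          using abs_ev_le[of "f n - l"] by (auto simp: dist_norm intro: order_le_less_trans)
      qed
    qed
    show "l \<in> {v. continuous_on K (ev v)}"
      using f(1) uniform_limit_theorem[OF _ ul] by simp
  qed
qed (simp add: V0_def)

lemma V_outside:
  assumes "v \<in> V" "k \<notin> K"
  shows "ev v k = 0"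
proof (rule V_closure_induct[OF assms(1)])
  show "closed {v. ev v k = 0}" by (intro closed_Collect_eq continuous_ev continuous_on_const)
  show "ev v k = 0" if "v \<in> V0" for v using that assms(2) unfolding V0_def by blast
qed

lemma V_neg:
  assumes "v \<in> V" and fg: "f \<in> E" "norm f \<le> 1" "g \<in> F" "norm g \<le> 1"
  shows "ev v (pt (- f) g) = - ev v (pt f g)"
proof (rule V_closure_induct[OF assms(1)])
  show "closed {v. ev v (pt (- f) g) = - ev v (pt f g)}"
    by (intro closed_Collect_eq continuous_on_minus continuous_ev)
  fix v assume "v \<in> V0"
  then obtain b where b: "bilinear_map_on dual_scale dual_scale (*) E F b"
    "\<And>f g. f \<in> E \<Longrightarrow> g \<in> F \<Longrightarrow> norm f \<le> 1 \<Longrightarrow> norm g \<le> 1 \<Longrightarrow> ev v (pt f g) = b f g \<bullet> 1"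
    by (rule V0E) (rule that, blast+)
  have "b ((- 1) *\<^sub>R f) g = (- 1) *\<^sub>R b f g"
    by (rule bilinear_scaleR(1)[OF b(1) _ fg(1,3)]) (simp add: scaleR_conv_of_real)
  then show "ev v (pt (- f) g) = - ev v (pt f g)"
    using fg scaleR_E[OF fg(1), of "-1"] by (simp add: b(2))
qed

text \<open>Replacing \<open>f\<close> by \<open>- f\<close> flips the sign of the value, so an
  upper bound on \<open>K\<close> also bounds the absolute value.\<close>

lemma V_norming:
  assumes v: "v \<in> V" and b: "0 \<le> b" "\<forall>k\<in>K. ev v k \<le> b"
  shows "norm v \<le> b"
proof (rule norm_bfun_le)
  fix k
  show "\<bar>ev v k\<bar> \<le> b"
  proof (cases "k \<in> K")
    case True
    then obtain f g where k: "f \<in> E" "norm f \<le> 1" "g \<in> F" "norm g \<le> 1" "k = pt f g" by (rule K_cases)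
    have "pt (- f) g \<in> K" using k scaleR_E[OF k(1), of "-1"] by (intro pt_in_K) auto
    then have "- ev v k \<le> b" using V_neg[OF v k(1-4)] b(2) k(5) by (metis)
    then show ?thesis using b(2) True by (simp add: abs_le_iff)
  qed (use V_outside[OF v] b in simp)
qed

lemma V0_bilinear_le:
  assumes b: "bilinear_map_on dual_scale dual_scale (*) E F b"
    "\<And>f g. f \<in> E \<Longrightarrow> g \<in> F \<Longrightarrow> norm f \<le> 1 \<Longrightarrow> norm g \<le> 1 \<Longrightarrow> ev v (pt f g) = b f g \<bullet> 1"
    and fg: "f \<in> E" "g \<in> F"
  shows "b f g \<bullet> 1 \<le> norm f * norm g * norm v"
proof -
  have s: "of_real r * x = r *\<^sub>R x" for r and x :: 'k by (simp add: scaleR_conv_of_real)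
  have "b (norm f *\<^sub>R sgn f) (norm g *\<^sub>R sgn g) = (norm f * norm g) *\<^sub>R b (sgn f) (sgn g)"
    using fg by (simp add: bilinear_scaleR[OF b(1) s] scaleR_E scaleR_F sgn_E sgn_F)
  then have "b f g \<bullet> 1 = (norm f * norm g) * (b (sgn f) (sgn g) \<bullet> 1)"
    by (simp add: scaleR_norm_sgn)
  also have "b (sgn f) (sgn g) \<bullet> 1 = ev v (pt (sgn f) (sgn g))"
    using fg by (intro b(2)[symmetric] sgn_E sgn_F) (auto simp: norm_sgn)
  finally show ?thesis using mult_left_mono[OF ev_le_norm, of "norm f * norm g" v "pt (sgn f) (sgn g)"] by simp
qed

text \<open>Bilinearity splits the difference into \<open>b (f - f') g\<close> and
  \<open>b f' (g - g')\<close>. This converts small norm diameter in both factors into small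
  oscillation, uniformly over the unit ball of \<open>V\<close>.\<close>

lemma V_lipschitz:
  assumes "v \<in> V" and f: "f \<in> E" "norm f \<le> 1" "f' \<in> E" "norm f' \<le> 1" and g: "g \<in> F" "norm g \<le> 1" "g' \<in> F" "norm g' \<le> 1"
  shows "ev v (pt f g) - ev v (pt f' g') \<le> (norm (f - f') + norm (g - g')) * norm v"
proof (rule V_closure_induct[OF assms(1)])
  show "closed {v. ev v (pt f g) - ev v (pt f' g') \<le> (norm (f - f') + norm (g - g')) * norm v}"
    by (intro closed_Collect_le continuous_intros continuous_ev)
  fix v assume "v \<in> V0"
  then obtain b where b: "bilinear_map_on dual_scale dual_scale (*) E F b"
    "\<And>f g. f \<in> E \<Longrightarrow> g \<in> F \<Longrightarrow> norm f \<le> 1 \<Longrightarrow> norm g \<le> 1 \<Longrightarrow> ev v (pt f g) = b f g \<bullet> 1"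
    by (rule V0E) (rule that, blast+)
  have d: "f - f' \<in> E" "g - g' \<in> F" using f g by (auto intro: E.subspace_diff[OF subE] F.subspace_diff[OF subF])
  have "b ((f - f') + f') g = b (f - f') g + b f' g" "b f' ((g - g') + g') = b f' (g - g') + b f' g'"
    using b(1) d f g unfolding bilinear_map_on_def linear_map_on_def by blast+
  then have "ev v (pt f g) - ev v (pt f' g') = b (f - f') g \<bullet> 1 + b f' (g - g') \<bullet> 1"
    using f g by (simp add: b(2) inner_add_left)
  also have "\<dots> \<le> norm (f - f') * norm g * norm v + norm f' * norm (g - g') * norm v"
    using d f g by (intro add_mono V0_bilinear_le[OF b]) auto
  also have "\<dots> \<le> norm (f - f') * 1 * norm v + 1 * norm (g - g') * norm v"
    using f g by (intro add_mono mult_right_mono mult_left_mono) auto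
  finally show "ev v (pt f g) - ev v (pt f' g') \<le> (norm (f - f') + norm (g - g')) * norm v"
    by (simp add: algebra_simps)
qed

text \<open>These are the real parts of the elementary tensors of the predual, the members of
  \<open>V\<close> with which tensors are tested when the approximation property is applied.\<close>

definition eval_bfun :: "'a \<Rightarrow> 'b \<Rightarrow> (('a \<Rightarrow> 'k) \<times> ('b \<Rightarrow> 'k)) bfun" where
  "eval_bfun x y = to_bfun (\<lambda>k. if k \<in> K then (fst k x * snd k y) \<bullet> 1 else 0)"

lemma ev_eval_bfun: "ev (eval_bfun x y) k = (if k \<in> K then (fst k x * snd k y) \<bullet> 1 else 0)"
  unfolding eval_bfun_def
proof (rule ev_to_bfun[of _ "norm x * norm y"])
  fix k
  show "\<bar>if k \<in> K then (fst k x * snd k y) \<bullet> 1 else 0\<bar> \<le> norm x * norm y"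
  proof (cases "k \<in> K")
    case True
    then obtain f g where k: "f \<in> E" "norm f \<le> 1" "g \<in> F" "norm g \<le> 1" "k = pt f g" by (rule K_cases)
    have "norm (blinfun_apply f x) \<le> norm x" "norm (blinfun_apply g y) \<le> norm y"
      using k(2,4) by (auto intro!: order_trans[OF norm_blinfun] mult_left_le_one_le)
    then have "norm (blinfun_apply f x * blinfun_apply g y) \<le> norm x * norm y"
      by (simp add: norm_mult mult_mono)
    then show ?thesis using True abs_inner_one_le_norm[of "blinfun_apply f x * blinfun_apply g y"]
      by (simp add: k(5) pt_def)
  qed simp
qed

lemma eval_bfun_V: "eval_bfun x y \<in> V"
proof -
  have "eval_bfun x y \<in> V0" unfolding V0_def
  proof (intro CollectI conjI allI impI exI[of _ "\<lambda>f g. blinfun_apply f x * blinfun_apply g y"] ballI)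
    show "bilinear_map_on dual_scale dual_scale (*) E F (\<lambda>f g. blinfun_apply f x * blinfun_apply g y)"
      by (simp add: bilinear_map_on_def linear_map_on_def blinfun.add_left dual_scale_apply algebra_simps)
    have "continuous_on K (\<lambda>k. (fst k x * snd k y) \<bullet> 1)"
      by (intro continuous_intros continuous_on_product_then_coordinatewise)
    then show "continuous_on K (ev (eval_bfun x y))" by (simp add: ev_eval_bfun cong: continuous_on_cong)
    fix f g assume "f \<in> E" "g \<in> F" "norm f \<le> 1" "norm g \<le> 1"
    then have "pt f g \<in> K" by (simp add: pt_in_K)
    then show "ev (eval_bfun x y) (pt f g) = (blinfun_apply f x * blinfun_apply g y) \<bullet> 1"
      by (simp add: ev_eval_bfun) (simp add: pt_def)
  qed (simp add: ev_eval_bfun)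
  then show ?thesis unfolding V_def using closure_subset by blast
qed

text \<open>\<open>p\<close> acts on all bounded functions and depends on the chosen series; only
  its restriction to \<open>V\<close> is determined by \<open>z\<close>, by
  \<open>represents_le\<close> applied to a difference. The relation spares a proof that the action
  is well defined.\<close>

definition represents :: "'c \<Rightarrow> ((('a \<Rightarrow> 'k) \<times> ('b \<Rightarrow> 'k)) bfun \<Rightarrow> real) \<Rightarrow> bool" where
  "represents z p \<longleftrightarrow> (\<exists>c a. (\<forall>n::nat. a n \<in> K) \<and> summable (\<lambda>n. \<bar>c n\<bar>) \<and>
     (\<lambda>n. c n *\<^sub>R tau (a n)) sums z \<and> (\<forall>w. (\<lambda>n. c n * ev w (a n)) sums p w))"

lemma represents_bounded_linear:
  assumes "represents z p"
  shows "bounded_linear p"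
proof -
  obtain c a where ca: "\<And>n::nat. a n \<in> K" "summable (\<lambda>n. \<bar>c n\<bar>)" "\<And>w. (\<lambda>n. c n * ev w (a n)) sums p w"
    using assms unfolding represents_def by blast
  show ?thesis
  proof (rule bounded_linear_intro[of _ "\<Sum>n. \<bar>c n\<bar>"])
    fix u v r
    have "(\<lambda>n. c n * ev (u + v) (a n)) sums (p u + p v)"
      using sums_add[OF ca(3)[of u] ca(3)[of v]] by (simp add: algebra_simps)
    from sums_unique2[OF ca(3) this] show "p (u + v) = p u + p v" .
    have "(\<lambda>n. c n * ev (r *\<^sub>R u) (a n)) sums (r * p u)"
      using sums_mult[OF ca(3)[of u], of r] by (simp add: algebra_simps)
    from sums_unique2[OF ca(3) this] show "p (r *\<^sub>R u) = r *\<^sub>R p u" by simp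
    have "norm (\<Sum>n. c n * ev u (a n)) \<le> (\<Sum>n. \<bar>c n\<bar> * norm u)"
      by (rule norm_suminf_le) (auto simp: abs_mult intro!: mult_left_mono abs_ev_le summable_mult2 ca(2))
    then show "norm (p u) \<le> norm u * (\<Sum>n. \<bar>c n\<bar>)"
      using suminf_mult2[OF ca(2), of "norm u"] sums_unique[OF ca(3), of u] by (simp add: mult.commute)
  qed
qed

lemma represents_diff:
  assumes "represents z p" "represents z' p'"
  shows "represents (z - z') (\<lambda>w. p w - p' w)"
proof -
  obtain c a where ca: "\<And>n::nat. a n \<in> K" "summable (\<lambda>n. \<bar>c n\<bar>)" "(\<lambda>n. c n *\<^sub>R tau (a n)) sums z" "\<And>w. (\<lambda>n. c n * ev w (a n)) sums p w"
    using assms(1) unfolding represents_def by blast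
  obtain c' a' where ca': "\<And>n::nat. a' n \<in> K" "summable (\<lambda>n. \<bar>c' n\<bar>)" "(\<lambda>n. c' n *\<^sub>R tau (a' n)) sums z'" "\<And>w. (\<lambda>n. c' n * ev w (a' n)) sums p' w"
    using assms(2) unfolding represents_def by blast
  define C where "C n = (if even n then c (n div 2) else - c' (n div 2))" for n
  define A where "A n = (if even n then a (n div 2) else a' (n div 2))" for n
  have "A n \<in> K" for n using ca(1) ca'(1) by (simp add: A_def)
  moreover have "summable (\<lambda>n. \<bar>C n\<bar>)"
    using sums_summable[OF sums_interleave[OF summable_sums[OF ca(2)] summable_sums[OF ca'(2)]]]
    by (simp add: C_def if_distrib[of abs] cong: if_cong)
  moreover have "(\<lambda>n. C n *\<^sub>R tau (A n)) sums (z + - z')"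
  proof -
    have "(\<lambda>n. C n *\<^sub>R tau (A n)) = (\<lambda>n. if even n then c (n div 2) *\<^sub>R tau (a (n div 2)) else - (c' (n div 2) *\<^sub>R tau (a' (n div 2))))"
      by (auto simp: C_def A_def)
    then show ?thesis using sums_interleave[OF ca(3) sums_minus[OF ca'(3)]] by simp
  qed
  moreover have "(\<lambda>n. C n * ev w (A n)) sums (p w + - p' w)" for w
  proof -
    have "(\<lambda>n. C n * ev w (A n)) = (\<lambda>n. if even n then c (n div 2) * ev w (a (n div 2)) else - (c' (n div 2) * ev w (a' (n div 2))))"
      by (auto simp: C_def A_def)
    then show ?thesis using sums_interleave[OF ca(4)[of w] sums_minus[OF ca'(4)[of w]]] by simp
  qed
  ultimately show ?thesis unfolding represents_def
    by (intro exI[of _ C] exI[of _ A]) simp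
qed

lemma represents_finite:
  fixes n :: nat
  assumes "\<And>i. i < n \<Longrightarrow> a i \<in> K"
  shows "represents (\<Sum>i<n. l i *\<^sub>R tau (a i)) (\<lambda>w. \<Sum>i<n. l i * ev w (a i))"
proof -
  define c where "c i = (if i < n then l i else 0)" for i
  define a' where "a' i = (if i < n then a i else pt 0 0)" for i
  have eq: "(\<lambda>i. c i *\<^sub>R tau (a' i)) = (\<lambda>i. if i < n then l i *\<^sub>R tau (a i) else 0)"
    "(\<lambda>i. \<bar>c i\<bar>) = (\<lambda>i. if i < n then \<bar>l i\<bar> else 0)"
    "(\<lambda>i. c i * ev w (a' i)) = (\<lambda>i. if i < n then l i * ev w (a i) else 0)" for w
    by (auto simp: c_def a'_def)
  show ?thesis unfolding represents_def
  proof (intro exI[of _ c] exI[of _ a'] conjI allI)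
    show "a' i \<in> K" for i using assms zero_in_K by (simp add: a'_def)
    show "summable (\<lambda>i. \<bar>c i\<bar>)" unfolding eq by (rule sums_summable[OF sums_if_lessThan])
    show "(\<lambda>i. c i *\<^sub>R tau (a' i)) sums (\<Sum>i<n. l i *\<^sub>R tau (a i))"
      unfolding eq by (rule sums_if_lessThan)
    show "(\<lambda>i. c i * ev w (a' i)) sums (\<Sum>i<n. l i * ev w (a i))" for w
      unfolding eq by (rule sums_if_lessThan)
  qed
qed

text \<open>For a bilinear form \<open>b\<close>, the universal property gives a linear
  \<open>\<phi>\<close> on the algebraic tensors. Almost optimal representations bound its real part
  by \<open>norm w * norm v\<close>, and the partial sums of the series carry this bound to
  \<open>z\<close>.\<close>

lemma represents_le:
  assumes R: "represents z p" and v: "v \<in> V"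
  shows "\<bar>p v\<bar> \<le> norm z * norm v"
proof -
  obtain c a where ca: "\<And>n::nat. a n \<in> K" "(\<lambda>n. c n *\<^sub>R tau (a n)) sums z" "\<And>w. (\<lambda>n. c n * ev w (a n)) sums p w"
    using R unfolding represents_def by blast
  interpret p: bounded_linear p by (rule represents_bounded_linear[OF R])
  have le: "p v \<le> norm z * norm v" if v: "v \<in> V" for v
  proof (rule V_closure_induct[OF v])
    show "closed {v. p v \<le> norm z * norm v}"
      by (intro closed_Collect_le linear_continuous_on[OF p.bounded_linear_axioms] continuous_intros)
    fix v assume "v \<in> V0"
    then obtain b where b: "bilinear_map_on dual_scale dual_scale (*) E F b"
      "\<And>f g. f \<in> E \<Longrightarrow> g \<in> F \<Longrightarrow> norm f \<le> 1 \<Longrightarrow> norm g \<le> 1 \<Longrightarrow> ev v (pt f g) = b f g \<bullet> 1"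
      by (rule V0E) (rule that, blast+)
    obtain \<phi> where \<phi>: "Vector_Spaces.linear sT (*) \<phi>" "\<And>x y. x \<in> E \<Longrightarrow> y \<in> F \<Longrightarrow> \<phi> (t x y) = b x y"
      using tensor b(1) unfolding is_projective_tensor_product_def by blast
    interpret \<phi>: Vector_Spaces.linear sT "(*)" \<phi> by (rule \<phi>(1))
    have \<phi>_scaleR: "\<phi> (r *\<^sub>R w) \<bullet> 1 = r * (\<phi> w \<bullet> 1)" for r w
      using \<phi>.scale[of "of_real r" w] by (simp add: sT.scale_of_real flip: scaleR_conv_of_real)
    have \<phi>le: "\<phi> w \<bullet> 1 \<le> norm w * norm v" if w: "w \<in> alg" for w
    proof (rule field_le_epsilon)
      fix e :: real assume e: "0 < e"
      define d where "d = e / (norm v + 1)"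
      have pos: "0 < norm v + 1" by (simp add: add_nonneg_pos)
      then have d: "0 < d" using e by (simp add: d_def)
      have dv: "d * norm v \<le> e" using mult_left_mono[of "norm v" "norm v + 1" d] d pos by (simp add: d_def)
      obtain n :: nat and x y where xy: "\<And>i. i < n \<Longrightarrow> x i \<in> E \<and> y i \<in> F" "w = (\<Sum>i<n. t (x i) (y i))"
        "(\<Sum>i<n. norm (x i) * norm (y i)) < norm w + d"
        using alg_near[OF w d] by blast
      have "\<phi> w \<bullet> 1 = (\<Sum>i<n. b (x i) (y i) \<bullet> 1)"
        using xy(1) by (simp add: xy(2) \<phi>.sum inner_sum_left \<phi>(2))
      also have "\<dots> \<le> (\<Sum>i<n. norm (x i) * norm (y i) * norm v)"
        using xy(1) by (intro sum_mono V0_bilinear_le[OF b]) auto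
      also have "\<dots> = (\<Sum>i<n. norm (x i) * norm (y i)) * norm v" by (simp add: sum_distrib_right)
      also have "\<dots> \<le> (norm w + d) * norm v" using xy(3) by (intro mult_right_mono) auto
      also have "\<dots> \<le> norm w * norm v + e" using dv by (simp add: algebra_simps)
      finally show "\<phi> w \<bullet> 1 \<le> norm w * norm v + e" .
    qed
    have tau: "\<phi> (tau k) \<bullet> 1 = ev v k" if "k \<in> K" for k
      using that by (rule K_cases) (simp add: \<phi>(2) b(2))
    show "p v \<le> norm z * norm v"
    proof (rule LIMSEQ_le)
      show "(\<lambda>N. \<Sum>n<N. c n * ev v (a n)) \<longlonglongrightarrow> p v" using ca(3)[of v] by (simp add: sums_def)
      show "(\<lambda>N. norm (\<Sum>n<N. c n *\<^sub>R tau (a n)) * norm v) \<longlonglongrightarrow> norm z * norm v"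
        using ca(2) unfolding sums_def by (intro tendsto_mult tendsto_norm tendsto_const)
      have "(\<Sum>n<N. c n * ev v (a n)) \<le> norm (\<Sum>n<N. c n *\<^sub>R tau (a n)) * norm v" for N
      proof -
        have "(\<Sum>n<N. c n *\<^sub>R tau (a n)) \<in> alg"
          by (intro sT.subspace_sum[OF alg_subspace] scaleR_alg tau_alg ca(1))
        then have "\<phi> (\<Sum>n<N. c n *\<^sub>R tau (a n)) \<bullet> 1 \<le> norm (\<Sum>n<N. c n *\<^sub>R tau (a n)) * norm v"
          by (rule \<phi>le)
        then show ?thesis by (simp add: \<phi>.sum inner_sum_left \<phi>_scaleR tau[OF ca(1)])
      qed
      then show "\<exists>M. \<forall>N\<ge>M. (\<Sum>n<N. c n * ev v (a n)) \<le> norm (\<Sum>n<N. c n *\<^sub>R tau (a n)) * norm v" by blast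
    qed
  qed
  have "- v \<in> V" using subspace_V v by (metis subspace_neg)
  then show ?thesis using le[OF v] le[of "- v"] by (simp add: p.neg abs_le_iff)
qed

lemma alg_near_tau:
  assumes w: "w \<in> alg" and \<eta>: "0 < \<eta>"
  shows "\<exists>(n::nat) l a. (\<forall>i<n. 0 \<le> l i \<and> a i \<in> K) \<and> w = (\<Sum>i<n. l i *\<^sub>R tau (a i)) \<and> (\<Sum>i<n. l i) < norm w + \<eta>"
proof -
  obtain n :: nat and x y where xy: "\<And>i. i < n \<Longrightarrow> x i \<in> E \<and> y i \<in> F" "w = (\<Sum>i<n. t (x i) (y i))"
    "(\<Sum>i<n. norm (x i) * norm (y i)) < norm w + \<eta>"
    using alg_near[OF w \<eta>] by blast
  have "w = (\<Sum>i<n. (norm (x i) * norm (y i)) *\<^sub>R tau (pt (sgn (x i)) (sgn (y i))))"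
    unfolding xy(2) using xy(1) norm_mult_tau_sgn by (intro sum.cong refl) (metis lessThan_iff)
  then show ?thesis using xy(1,3) sgn_in_K
    by (intro exI[of _ n] exI[of _ "\<lambda>i. norm (x i) * norm (y i)"] exI[of _ "\<lambda>i. pt (sgn (x i)) (sgn (y i))"]) auto
qed

text \<open>A rapidly convergent sequence of algebraic tensors is turned into a telescoping series,
  each term is written almost optimally with points of \<open>K\<close>, and the double series is
  flattened. Only absolute summability of the coefficients is aimed at, not a sharp bound.\<close>

lemma represents_exists:
  assumes z: "z \<in> Z"
  shows "\<exists>p. represents z p"
proof -
  have "\<forall>m::nat. \<exists>w\<in>alg. dist w z < (1/2)^m"
    using z unfolding projective_tensors_def closure_approachable by simp
  then obtain e where e: "\<And>m::nat. e m \<in> alg" "\<And>m. dist (e m) z < (1/2)^m" by metis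
  \<comment> \<open>The first difference is \<open>e 0\<close> itself, whose size is not geometric;
    hence the shift by \<open>Suc\<close> in the summability argument.\<close>
  define d where "d m = (case m of 0 \<Rightarrow> e 0 | Suc k \<Rightarrow> e (Suc k) - e k)" for m
  have d_alg: "d m \<in> alg" for m
    using e(1) sT.subspace_diff[OF alg_subspace] by (auto simp: d_def split: nat.split)
  have sum_d: "(\<Sum>i<Suc n. d i) = e n" for n by (induct n) (simp_all add: d_def)
  have elim: "e \<longlonglongrightarrow> z"
  proof (rule metric_LIMSEQ_I)
    fix r :: real assume "0 < r"
    then obtain n where n: "(1/2)^n < r" using real_arch_pow_inv[of r "1/2"] by auto
    have "dist (e m) z < r" if "m \<ge> n" for m
    proof -
      have "dist (e m) z < (1/2)^m" by (rule e(2))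
      also have "\<dots> \<le> (1/2)^n" using that by (intro power_decreasing) auto
      finally show ?thesis using n by simp
    qed
    then show "\<exists>no. \<forall>n\<ge>no. dist (e n) z < r" by blast
  qed
  have d_sums: "d sums z"
    unfolding sums_def by (rule LIMSEQ_imp_Suc) (simp only: sum_d elim)
  have d_norm: "norm (d (Suc k)) \<le> 2 * (1/2)^k" for k
  proof -
    have "norm (d (Suc k)) \<le> dist (e (Suc k)) z + dist (e k) z"
      by (simp add: d_def dist_norm) (metis dist_norm dist_triangle2)
    also have "\<dots> \<le> (1/2)^Suc k + (1/2)^k" by (intro add_mono less_imp_le e(2))
    also have "\<dots> \<le> 2 * (1/2)^k" by simp
    finally show ?thesis .
  qed
  define good where "good m n l a \<longleftrightarrow> (\<forall>i<n. 0 \<le> l i \<and> a i \<in> K) \<and>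
      d m = (\<Sum>i<n. l i *\<^sub>R tau (a i)) \<and> (\<Sum>i<n. l i) < norm (d m) + (1/2)^m" for m and n :: nat and l a
  have "\<forall>m. \<exists>n l a. good m n l a"
    unfolding good_def by (intro allI alg_near_tau d_alg) simp
  then obtain N l a where "\<And>m. good m (N m) (l m) (a m)" by metis
  then have la: "\<And>m i. i < N m \<Longrightarrow> 0 \<le> l m i \<and> a m i \<in> K"
    "\<And>m. d m = (\<Sum>i<N m. l m i *\<^sub>R tau (a m i))" "\<And>m. (\<Sum>i<N m. l m i) < norm (d m) + (1/2)^m"
    unfolding good_def by blast+
  define s where "s m = (\<Sum>i<N m. l m i)" for m
  have s0: "0 \<le> s m" for m unfolding s_def using la(1) by (intro sum_nonneg) auto
  have "summable (\<lambda>k. s (Suc k))"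
  proof (rule summable_comparison_test'[where N=0])
    show "summable (\<lambda>k. 3 * (1/2::real)^k)" by (intro summable_mult summable_geometric) simp
    fix k
    have "s (Suc k) \<le> 2 * (1/2)^k + (1/2)^Suc k"
      using la(3)[of "Suc k"] d_norm[of k] unfolding s_def by linarith
    also have "\<dots> \<le> 3 * (1/2)^k" by simp
    finally show "norm (s (Suc k)) \<le> 3 * (1/2)^k" using s0 by simp
  qed
  then have s_summable: "summable s" by (simp add: summable_Suc_iff)
  \<comment> \<open>Finite rows are padded with coefficient 0 at the point \<open>pt 0 0\<close>, so
    that the double sequence is indexed by all pairs.\<close>
  define c where "c x = (if snd x < N (fst x) then l (fst x) (snd x) else 0)" for x
  define A where "A x = (if snd x < N (fst x) then a (fst x) (snd x) else pt 0 0)" for x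
  define f where "f x = c x *\<^sub>R tau (A x)" for x
  have c0: "0 \<le> c x" for x using la(1) by (simp add: c_def)
  have AK: "A x \<in> K" for x using la(1) zero_in_K by (simp add: A_def)
  have c_inner: "(\<lambda>i. c (m, i)) sums s m" for m
    unfolding c_def s_def fst_conv snd_conv by (rule sums_if_lessThan)
  \<comment> \<open>Absolute convergence licenses both summation by rows, which gives
    \<open>z\<close>, and the enumeration by \<open>prod_decode\<close>.\<close>
  have "c summable_on (UNIV \<times> UNIV)"
  proof (rule summable_on_SigmaI)
    show "((\<lambda>i. c (m, i)) has_sum s m) UNIV" for m by (rule sums_nonneg_imp_has_sum[OF c_inner c0])
    show "s summable_on UNIV" by (rule norm_summable_imp_summable_on) (simp add: s0 s_summable)
  qed (rule c0)
  then have c_on: "c summable_on UNIV" by simp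
  have f_le: "norm (f x) \<le> c x" for x
    using mult_left_le[OF norm_tau_le[OF AK] c0] c0 by (simp add: f_def)
  have "(\<lambda>x. norm (c x)) summable_on UNIV" using c_on c0 by simp
  then have f_abs: "(\<lambda>x. norm (f x)) summable_on UNIV"
    by (rule Infinite_Sum.abs_summable_on_comparison_test) (use f_le c0 in simp)
  have f_inner: "(\<lambda>i. f (m, i)) sums d m" for m
  proof -
    have "(\<lambda>i. f (m, i)) = (\<lambda>i. if i < N m then l m i *\<^sub>R tau (a m i) else 0)" by (auto simp: f_def c_def A_def)
    then show ?thesis using sums_if_lessThan[of "N m" "\<lambda>i. l m i *\<^sub>R tau (a m i)"] la(2)[of m] by simp
  qed
  have "(f has_sum z) (UNIV \<times> UNIV)"
  proof (rule has_sum_SigmaI)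
    show "((\<lambda>i. f (m, i)) has_sum d m) UNIV" for m
    proof (rule norm_summable_imp_has_sum[OF _ f_inner])
      show "summable (\<lambda>i. norm (f (m, i)))"
        by (rule summable_comparison_test'[OF sums_summable[OF c_inner[of m]], of 0]) (simp add: f_le)
    qed
    have "norm (d m) \<le> s m" for m unfolding la(2) s_def
      using la(1) by (intro order_trans[OF norm_sum] sum_mono) (auto intro!: mult_left_le norm_tau_le)
    then have "summable (\<lambda>m. norm (d m))"
      by (intro summable_comparison_test'[OF s_summable, of 0]) simp
    then show "(d has_sum z) UNIV" by (rule norm_summable_imp_has_sum[OF _ d_sums])
    show "f summable_on UNIV \<times> UNIV" using Infinite_Sum.abs_summable_summable[OF f_abs] by simp
  qed
  then have "((\<lambda>n. f (prod_decode n)) has_sum z) UNIV"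
    using has_sum_reindex_bij_betw[of prod_decode UNIV UNIV f z] bij_prod_decode by simp
  then have fz: "(\<lambda>n. f (prod_decode n)) sums z" by (rule has_sum_imp_sums)
  have "(\<lambda>n. c (prod_decode n)) summable_on UNIV"
    using summable_on_reindex_bij_betw[of prod_decode UNIV UNIV c] bij_prod_decode c_on by simp
  then have cs: "summable (\<lambda>n. c (prod_decode n))"
    unfolding summable_on_def using has_sum_imp_sums sums_summable by blast
  have "summable (\<lambda>n. c (prod_decode n) * ev w (A (prod_decode n)))" for w
  proof (rule summable_comparison_test'[OF summable_mult2[OF cs, of "norm w"], of 0])
    fix n
    show "norm (c (prod_decode n) * ev w (A (prod_decode n))) \<le> c (prod_decode n) * norm w"
      using mult_left_mono[OF abs_ev_le c0] c0[of "prod_decode n"] by (simp add: abs_mult)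
  qed
  then have "represents z (\<lambda>w. \<Sum>n. c (prod_decode n) * ev w (A (prod_decode n)))"
    unfolding represents_def using AK cs fz abs_of_nonneg[OF c0]
    by (intro exI[of _ "\<lambda>n. c (prod_decode n)"] exI[of _ "\<lambda>n. A (prod_decode n)"])
      (simp add: f_def summable_sums)
  then show ?thesis by blast
qed

lemma represents_in_Z:
  assumes "represents z p"
  shows "z \<in> Z"
proof -
  obtain c a where ca: "\<And>n::nat. a n \<in> K" "(\<lambda>n. c n *\<^sub>R tau (a n)) sums z"
    using assms unfolding represents_def by blast
  have "(\<Sum>n<N. c n *\<^sub>R tau (a n)) \<in> alg" for N
    by (intro sT.subspace_sum[OF alg_subspace] scaleR_alg tau_alg ca(1))
  then show ?thesis
    using ca(2) unfolding projective_tensors_def closure_sequential sums_def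
    by (intro exI[of _ "\<lambda>N. \<Sum>n<N. c n *\<^sub>R tau (a n)"]) simp
qed

text \<open>The first coordinates are fragmented by \<open>U1\<close>, then the second coordinates
  of those points whose first coordinate already lies in \<open>U1\<close>. This order ensures that
  the box \<open>U1 \<times> U2\<close> meets \<open>G\<close>; each factor contributes
  \<open>e / 2\<close>.\<close>

lemma fragmented_K:
  assumes rnpX: "radon_nikodym_property E" and rnpY: "radon_nikodym_property F"
    and G: "G \<subseteq> K" "G \<noteq> {}" and e: "0 < e"
  shows "\<exists>U. open U \<and> G \<inter> U \<noteq> {} \<and>
    (\<forall>k\<in>G \<inter> U. \<forall>k'\<in>G \<inter> U. \<forall>v\<in>V. \<bar>ev v k - ev v k'\<bar> \<le> e * norm v)"
proof -
  define S1 where "S1 = {f \<in> E. norm f \<le> 1 \<and> (\<exists>g\<in>F. norm g \<le> 1 \<and> pt f g \<in> G)}"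
  obtain k0 where k0: "k0 \<in> G" using G(2) by blast
  then obtain f0 g0 where "f0 \<in> E" "norm f0 \<le> 1" "g0 \<in> F" "norm g0 \<le> 1" "k0 = pt f0 g0"
    using G(1) K_cases by blast
  then have "S1 \<noteq> {}" using k0 unfolding S1_def by blast
  moreover have "S1 \<subseteq> E" "\<And>f. f \<in> S1 \<Longrightarrow> norm f \<le> 1" by (auto simp: S1_def)
  ultimately obtain U1 where U1: "open U1" "\<exists>f\<in>S1. blinfun_apply f \<in> U1"
    "\<forall>f\<in>S1. \<forall>f'\<in>S1. blinfun_apply f \<in> U1 \<longrightarrow> blinfun_apply f' \<in> U1 \<longrightarrow> norm (f - f') \<le> e / 2"
    using dual_rnp_fragmented[OF sX rnpX, of S1 "e / 2"] e by auto
  define S2 where "S2 = {g \<in> F. norm g \<le> 1 \<and> (\<exists>f\<in>E. norm f \<le> 1 \<and> blinfun_apply f \<in> U1 \<and> pt f g \<in> G)}"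
  have "S2 \<noteq> {}" using U1(2) unfolding S1_def S2_def by blast
  moreover have "S2 \<subseteq> F" "\<And>f. f \<in> S2 \<Longrightarrow> norm f \<le> 1" by (auto simp: S2_def)
  ultimately obtain U2 where U2: "open U2" "\<exists>g\<in>S2. blinfun_apply g \<in> U2"
    "\<forall>g\<in>S2. \<forall>g'\<in>S2. blinfun_apply g \<in> U2 \<longrightarrow> blinfun_apply g' \<in> U2 \<longrightarrow> norm (g - g') \<le> e / 2"
    using dual_rnp_fragmented[OF sY rnpY, of S2 "e / 2"] e by auto
  have le: "ev v k - ev v k' \<le> e * norm v"
    if k: "k \<in> G \<inter> (U1 \<times> U2)" and k': "k' \<in> G \<inter> (U1 \<times> U2)" and v: "v \<in> V" for k k' v
  proof -
    obtain f g where fg: "f \<in> E" "norm f \<le> 1" "g \<in> F" "norm g \<le> 1" "k = pt f g"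
      using k G(1) K_cases by blast
    obtain f' g' where fg': "f' \<in> E" "norm f' \<le> 1" "g' \<in> F" "norm g' \<le> 1" "k' = pt f' g'"
      using k' G(1) K_cases by blast
    have "f \<in> S1" "f' \<in> S1" "g \<in> S2" "g' \<in> S2"
      using k k' fg fg' unfolding S1_def S2_def by (auto simp: pt_def)
    moreover have "blinfun_apply f \<in> U1" "blinfun_apply f' \<in> U1" "blinfun_apply g \<in> U2" "blinfun_apply g' \<in> U2"
      using k k' fg(5) fg'(5) by (auto simp: pt_def)
    ultimately have "norm (f - f') + norm (g - g') \<le> e / 2 + e / 2"
      using U1(3) U2(3) by (intro add_mono) blast+
    then have "(norm (f - f') + norm (g - g')) * norm v \<le> e * norm v" by (intro mult_right_mono) auto
    then show ?thesis using V_lipschitz[OF v fg(1,2) fg'(1,2) fg(3,4) fg'(3,4)] fg(5) fg'(5) by simp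
  qed
  have "\<exists>k. k \<in> G \<inter> (U1 \<times> U2)" using U2(2) unfolding S2_def by (auto simp: pt_def)
  moreover have "\<bar>ev v k - ev v k'\<bar> \<le> e * norm v"
    if "k \<in> G \<inter> (U1 \<times> U2)" "k' \<in> G \<inter> (U1 \<times> U2)" "v \<in> V" for k k' v
    using le[OF that] le[OF that(2,1,3)] by (simp add: abs_le_iff)
  ultimately show ?thesis using open_Times[OF U1(1) U2(1)] by (intro exI[of _ "U1 \<times> U2"]) blast
qed

section \<open>From functionals on \<open>V\<close> back to tensors\<close>

lemma face_approx:
  assumes rnpX: "radon_nikodym_property E" and rnpY: "radon_nikodym_property F"
    and F0: "F0 \<subseteq> K" "closed F0" and p: "linear p"
    and pF: "\<And>v c. v \<in> V \<Longrightarrow> \<forall>k\<in>F0. ev v k \<le> c \<Longrightarrow> p v \<le> c" and e: "0 < e"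
  shows "\<exists>(n::nat) l a. (\<forall>i<n. 0 \<le> l i \<and> a i \<in> F0) \<and> (\<Sum>i<n. l i) \<le> 1 \<and>
      (\<forall>v\<in>V. \<bar>p v - (\<Sum>i<n. l i * ev v (a i))\<bar> \<le> e * norm v)"
proof -
  have "\<exists>(n::nat) l a. (\<forall>i<n. 0 \<le> l i \<and> a i \<in> F0) \<and> (\<Sum>i<n. l i) \<le> 1 \<and>
      (\<forall>v\<in>V. \<bar>p v - (\<Sum>i<n. l i * ev v (a i))\<bar> \<le> (e / 2 + e / 2) * norm v)"
    by (rule fragmented_functional_approx[OF subspace_V compact_K closed_K V_continuous
          fragmented_K[OF rnpX rnpY] F0 p pF]) (use e in auto)
  then show ?thesis by simp
qed

text \<open>Testing with \<open>eval_bfun\<close> shows that the series of products of point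
  evaluations vanishes, which is the hypothesis of \<open>approximation_property_null\<close>. If
  the second dual is the one with the approximation property, the factors are exchanged.\<close>

lemma represents_zero_imp_zero:
  assumes ap: "approximation_property dual_scale E \<or> approximation_property dual_scale F"
    and R: "represents z p" and p0: "\<And>v. v \<in> V \<Longrightarrow> p v = 0"
  shows "z = 0"
proof -
  obtain c a where ca: "\<And>n::nat. a n \<in> K" "summable (\<lambda>n. \<bar>c n\<bar>)" "(\<lambda>n. c n *\<^sub>R tau (a n)) sums z"
    "\<And>w. (\<lambda>n. c n * ev w (a n)) sums p w"
    using R unfolding represents_def by blast
  have "\<exists>f g. f \<in> E \<and> norm f \<le> 1 \<and> g \<in> F \<and> norm g \<le> 1 \<and> a n = pt f g" for n
    using K_cases[OF ca(1)] by metis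
  then obtain h g where h: "\<And>n. h n \<in> E" "\<And>n. norm (h n) \<le> 1" and g: "\<And>n. g n \<in> F" "\<And>n. norm (g n) \<le> 1"
    and a: "\<And>n. a n = pt (h n) (g n)" by metis
  define f where "f n = c n *\<^sub>R h n" for n
  have f: "f n \<in> E" for n unfolding f_def by (rule scaleR_E[OF h(1)])
  have fg_le: "norm (f n) * norm (g n) \<le> \<bar>c n\<bar>" for n
  proof -
    have "norm (f n) * norm (g n) = \<bar>c n\<bar> * (norm (h n) * norm (g n))" by (simp add: f_def)
    also have "\<dots> \<le> \<bar>c n\<bar> * (1 * 1)" by (intro mult_left_mono mult_mono h g) auto
    finally show ?thesis by simp
  qed
  have fg: "summable (\<lambda>n. norm (f n) * norm (g n))"
    by (rule summable_comparison_test'[OF ca(2), of 0]) (simp add: fg_le)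
  have z: "(\<lambda>n. t (f n) (g n)) sums z"
    using ca(3) by (simp add: f_def a t_scaleR h(1) g(1))
  have null: "(\<lambda>n. blinfun_apply (f n) x * blinfun_apply (g n) y) sums 0" for x y
  proof -
    have "summable (\<lambda>n. norm (blinfun_apply (f n) x * blinfun_apply (g n) y))"
    proof (rule summable_comparison_test'[OF summable_mult2[OF fg, of "norm x * norm y"], of 0])
      fix n
      have "norm (blinfun_apply (f n) x) * norm (blinfun_apply (g n) y) \<le> (norm (f n) * norm x) * (norm (g n) * norm y)"
        by (intro mult_mono norm_blinfun) auto
      then show "norm (norm (blinfun_apply (f n) x * blinfun_apply (g n) y)) \<le> norm (f n) * norm (g n) * (norm x * norm y)"
        by (simp add: norm_mult algebra_simps)
    qed
    then have "summable (\<lambda>n. blinfun_apply (f n) x * blinfun_apply (g n) y)" by (rule summable_norm_cancel)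
    then obtain s where s: "(\<lambda>n. blinfun_apply (f n) x * blinfun_apply (g n) y) sums s" by blast
    \<comment> \<open>\<open>p\<close> sees only real parts; rotating by \<open>u\<close> and moving
      \<open>u\<close> into the vector \<open>sX u x\<close> recovers the full scalar sum
      \<open>s\<close>.\<close>
    obtain u where u: "norm u = 1" "u * s = of_real (norm s)" using rotate_to_norm by blast
    have "(\<lambda>n. (u * (blinfun_apply (f n) x * blinfun_apply (g n) y)) \<bullet> 1) sums ((u * s) \<bullet> 1)"
      by (intro bounded_linear.sums[OF bounded_linear_inner_left] sums_mult s)
    moreover have "(u * (blinfun_apply (f n) x * blinfun_apply (g n) y)) \<bullet> 1 = c n * ev (eval_bfun (sX u x) y) (a n)" for n
      using ca(1)[of n] h(1)[of n]
      by (simp add: ev_eval_bfun) (simp add: a pt_def f_def dual_space_def blinfun.scaleR_left mult.assoc)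
    ultimately have "(\<lambda>n. c n * ev (eval_bfun (sX u x) y) (a n)) sums ((u * s) \<bullet> 1)" by simp
    from sums_unique2[OF this ca(4)] have "(u * s) \<bullet> 1 = p (eval_bfun (sX u x) y)" .
    then have "s = 0" using p0[OF eval_bfun_V] u(2) by simp
    then show ?thesis using s by simp
  qed
  from ap show ?thesis
  proof
    assume apE: "approximation_property dual_scale E"
    show ?thesis
      by (rule approximation_property_null[OF sX sT.banach_over_axioms bil norm_t_le apE f g(1) fg z null])
  next
    assume apF: "approximation_property dual_scale F"
    have bil': "bilinear_map_on dual_scale dual_scale sT F E (\<lambda>g f. t f g)"
      using bil by (simp add: bilinear_map_on_def)
    have le': "norm (t f g) \<le> norm g * norm f" if "g \<in> F" "f \<in> E" for f g
      using norm_t_le[OF that(2,1)] by (simp add: mult.commute)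
    have fg': "summable (\<lambda>n. norm (g n) * norm (f n))" using fg by (simp add: mult.commute)
    have null': "(\<lambda>n. blinfun_apply (g n) y * blinfun_apply (f n) x) sums 0" for x y
      using null[of x y] by (simp add: mult.commute)
    show ?thesis
      by (rule approximation_property_null[OF sY sT.banach_over_axioms bil' le' apF g(1) f fg' z null'])
  qed
qed

lemma ev_zero_pt: "v \<in> V \<Longrightarrow> ev v (pt 0 0) = 0"
  using V_neg[of v 0 0] E.subspace_0[OF subE] F.subspace_0[OF subF] by simp

text \<open>Since \<open>K\<close> norms \<open>V\<close>, the functional \<open>q / D\<close> is
  dominated by the supremum over \<open>K\<close>, and the exhaustion with tolerance 1/2 replaces it
  by points of \<open>K\<close> of total mass at most 1. Multiplied by \<open>D\<close>, these give
  the tensor to subtract.\<close>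

lemma halving_step:
  assumes rnpX: "radon_nikodym_property E" and rnpY: "radon_nikodym_property F"
    and R: "represents y q" and D: "0 < D" and q: "\<And>v. v \<in> V \<Longrightarrow> \<bar>q v\<bar> \<le> D * norm v"
  shows "\<exists>y' q'. represents y' q' \<and> (\<forall>v\<in>V. \<bar>q' v\<bar> \<le> D / 2 * norm v) \<and> norm (y - y') \<le> D"
proof -
  interpret q: bounded_linear q by (rule represents_bounded_linear[OF R])
  have "\<exists>(n::nat) l a. (\<forall>i<n. 0 \<le> l i \<and> a i \<in> K) \<and> (\<Sum>i<n. l i) \<le> 1 \<and>
      (\<forall>v\<in>V. \<bar>q v / D - (\<Sum>i<n. l i * ev v (a i))\<bar> \<le> 1 / 2 * norm v)"
  proof (rule face_approx[OF rnpX rnpY subset_refl closed_K])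
    show "linear (\<lambda>v. q v / D)"
      by (rule linearI) (simp_all add: q.add q.scaleR add_divide_distrib)
    fix v c assume v: "v \<in> V" "\<forall>k\<in>K. ev v k \<le> c"
    \<comment> \<open>Every \<open>v\<close> in \<open>V\<close> vanishes at the pair of zero
      functionals, so an upper bound on \<open>K\<close> is nonnegative, as \<open>V_norming\<close>
      requires.\<close>
    have "0 \<le> c" using v zero_in_K ev_zero_pt by force
    then have "norm v \<le> c" using V_norming v by blast
    then have "D * norm v \<le> D * c" using D by (intro mult_left_mono) auto
    then have "q v \<le> D * c" using q[OF v(1)] by linarith
    then show "q v / D \<le> c" using D by (simp add: divide_le_eq mult.commute)
  qed simp
  then obtain n :: nat and l a where la: "\<And>i. i < n \<Longrightarrow> 0 \<le> l i \<and> a i \<in> K" "(\<Sum>i<n. l i) \<le> 1"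
    "\<And>v. v \<in> V \<Longrightarrow> \<bar>q v / D - (\<Sum>i<n. l i * ev v (a i))\<bar> \<le> 1 / 2 * norm v"
    by blast
  define w where "w = (\<Sum>i<n. (D * l i) *\<^sub>R tau (a i))"
  have "represents w (\<lambda>v. \<Sum>i<n. (D * l i) * ev v (a i))"
    unfolding w_def using la(1) by (intro represents_finite) auto
  then have "represents (y - w) (\<lambda>v. q v - (\<Sum>i<n. (D * l i) * ev v (a i)))"
    by (rule represents_diff[OF R])
  moreover have "\<bar>q v - (\<Sum>i<n. (D * l i) * ev v (a i))\<bar> \<le> D / 2 * norm v" if v: "v \<in> V" for v
  proof -
    have "q v - (\<Sum>i<n. (D * l i) * ev v (a i)) = D * (q v / D - (\<Sum>i<n. l i * ev v (a i)))"
      using D by (simp add: right_diff_distrib sum_distrib_left mult.assoc)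
    then have "\<bar>q v - (\<Sum>i<n. (D * l i) * ev v (a i))\<bar> = D * \<bar>q v / D - (\<Sum>i<n. l i * ev v (a i))\<bar>"
      using D by (simp add: abs_mult)
    also have "\<dots> \<le> D * (1 / 2 * norm v)" using D la(3)[OF v] by (intro mult_left_mono) auto
    finally show ?thesis by simp
  qed
  moreover have "norm (y - (y - w)) \<le> D"
  proof -
    have "norm w \<le> (\<Sum>i<n. D * l i)" unfolding w_def
      using la(1) D by (intro order_trans[OF norm_sum] sum_mono) (auto simp: abs_mult intro!: mult_left_le norm_tau_le)
    also have "\<dots> \<le> D * 1" unfolding sum_distrib_left[symmetric] using D la(2) by (intro mult_left_mono) auto
    finally show ?thesis by simp
  qed
  ultimately show ?thesis by blast
qed

text \<open>The corrections from iterated halving sum to a tensor \<open>S\<close> with norm at most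
  \<open>C\<close> times 1 + 1/2 + 1/4 + ... . What remains acts as 0 on \<open>V\<close> and is
  therefore 0.\<close>

lemma norm_le_of_represents:
  assumes rnpX: "radon_nikodym_property E" and rnpY: "radon_nikodym_property F"
    and ap: "approximation_property dual_scale E \<or> approximation_property dual_scale F"
    and R: "represents z p" and C: "0 < C" and p: "\<And>v. v \<in> V \<Longrightarrow> \<bar>p v\<bar> \<le> C * norm v"
  shows "norm z \<le> 2 * C"
proof -
  \<comment> \<open>The clause for \<open>n = 0\<close> pins the start of the dependent choice to
    the given pair.\<close>
  define P where "P n x \<longleftrightarrow> represents (fst x) (snd x) \<and> (\<forall>v\<in>V. \<bar>snd x v\<bar> \<le> C * (1/2)^n * norm v) \<and> (n = 0 \<longrightarrow> x = (z, p))"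
    for n :: nat and x
  define Q where "Q n x x' \<longleftrightarrow> norm (fst x - fst x') \<le> C * (1/2)^n"
    for n :: nat and x x' :: "'c \<times> ((('a \<Rightarrow> 'k) \<times> ('b \<Rightarrow> 'k)) bfun \<Rightarrow> real)"
  have "\<exists>s. \<forall>n. P n (s n) \<and> Q n (s n) (s (Suc n))"
  proof (rule dependent_nat_choice)
    show "\<exists>x. P 0 x" using R p by (auto simp: P_def)
    fix x n assume "P n x"
    then have "\<exists>y' q'. represents y' q' \<and> (\<forall>v\<in>V. \<bar>q' v\<bar> \<le> C * (1/2)^n / 2 * norm v) \<and> norm (fst x - y') \<le> C * (1/2)^n"
      using C by (intro halving_step[OF rnpX rnpY]) (auto simp: P_def)
    then show "\<exists>y. P (Suc n) y \<and> Q n x y" by (auto simp: P_def Q_def)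
  qed
  then obtain s where s: "\<And>n. P n (s n)" "\<And>n. Q n (s n) (s (Suc n))" by blast
  define y where "y n = fst (s n)" for n
  define q where "q n = snd (s n)" for n
  have y0: "y 0 = z" using s(1)[of 0] by (simp add: P_def y_def)
  have Ry: "represents (y n) (q n)" for n using s(1)[of n] by (simp add: P_def y_def q_def)
  have qle: "\<bar>q n v\<bar> \<le> C * (1/2)^n * norm v" if "v \<in> V" for n v
    using s(1)[of n] that by (simp add: P_def q_def)
  have step: "norm (y n - y (Suc n)) \<le> C * (1/2)^n" for n using s(2)[of n] by (simp add: Q_def y_def)
  have geo: "summable (\<lambda>n. C * (1/2::real)^n)" by (intro summable_mult summable_geometric) simp
  have sm: "summable (\<lambda>n. y n - y (Suc n))"
    by (rule summable_comparison_test'[OF geo, of 0]) (rule step)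
  define S where "S = (\<Sum>n. y n - y (Suc n))"
  have "norm S \<le> (\<Sum>n. C * (1/2)^n)" unfolding S_def by (rule norm_suminf_le[OF step geo])
  also have "\<dots> = 2 * C" by (simp add: suminf_mult suminf_geometric)
  finally have S_le: "norm S \<le> 2 * C" .
  have "(\<lambda>n. \<Sum>i<n. y i - y (Suc i)) \<longlonglongrightarrow> S" using summable_sums[OF sm] by (simp add: sums_def S_def)
  then have "(\<lambda>n. z - (\<Sum>i<n. y i - y (Suc i))) \<longlonglongrightarrow> z - S" by (intro tendsto_diff tendsto_const)
  moreover have "z - (\<Sum>i<n. y i - y (Suc i)) = y n" for n
    using sum_lessThan_telescope'[of y n] y0 by simp
  ultimately have ylim: "y \<longlonglongrightarrow> z - S" by simp
  have "z - S \<in> Z"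
    using closed_sequentially[OF _ represents_in_Z[OF Ry] ylim] by (simp add: projective_tensors_def)
  \<comment> \<open>The limit receives a representation of its own, unrelated to the series behind
    \<open>q n\<close>; \<open>represents_diff\<close> and \<open>represents_le\<close> compare the
    two on \<open>V\<close>.\<close>
  then obtain r where r: "represents (z - S) r" using represents_exists by blast
  have "r v = 0" if v: "v \<in> V" for v
  proof -
    have "\<bar>r v\<bar> \<le> norm (y n - (z - S)) * norm v + C * (1/2)^n * norm v" for n
      using represents_le[OF represents_diff[OF Ry[of n] r] v] qle[OF v, of n] by linarith
    moreover have "(\<lambda>n. norm (y n - (z - S)) * norm v + C * (1/2)^n * norm v) \<longlonglongrightarrow> norm ((z - S) - (z - S)) * norm v + C * 0 * norm v"
      by (intro tendsto_intros ylim LIMSEQ_power_zero) auto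
    ultimately have "\<bar>r v\<bar> \<le> 0" by (intro LIMSEQ_le_const) auto
    then show ?thesis by simp
  qed
  then have "z - S = 0" by (rule represents_zero_imp_zero[OF ap r])
  then show ?thesis using S_le by simp
qed

text \<open>All points lie where \<open>v1\<close> equals 1, so the action on \<open>v1\<close> is
  the sum of the coefficients. This bounds the norm from below by the cost of the representation;
  the triangle inequality gives the converse.\<close>

lemma face_combination_attains:
  fixes n :: nat
  assumes v1: "v1 \<in> V" "norm v1 \<le> 1" and la: "\<And>i. i < n \<Longrightarrow> 0 \<le> l i \<and> a i \<in> K \<and> ev v1 (a i) = 1"
  shows "(\<Sum>i<n. l i *\<^sub>R tau (a i)) \<in> norm_attaining_tensors sT E F t"
proof -
  define w where "w = (\<Sum>i<n. l i *\<^sub>R tau (a i))"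
  have R: "represents w (\<lambda>v. \<Sum>i<n. l i * ev v (a i))"
    unfolding w_def using la by (intro represents_finite) auto
  have "(\<Sum>i<n. l i) = (\<Sum>i<n. l i * ev v1 (a i))" using la by (intro sum.cong) auto
  also have "\<dots> \<le> norm w * norm v1" using represents_le[OF R v1(1)] by simp
  also have "\<dots> \<le> norm w" using v1(2) by (simp add: mult_left_le)
  finally have ge: "(\<Sum>i<n. l i) \<le> norm w" .
  have "\<exists>f g. f \<in> E \<and> norm f \<le> 1 \<and> g \<in> F \<and> norm g \<le> 1 \<and> a i = pt f g" if "i < n" for i
    using K_cases[of "a i"] la[OF that] by metis
  then obtain f g where fg: "\<And>i. i < n \<Longrightarrow> f i \<in> E \<and> norm (f i) \<le> 1 \<and> g i \<in> F \<and> norm (g i) \<le> 1 \<and> a i = pt (f i) (g i)"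
    by metis
  \<comment> \<open>The coefficients go into the first factor, and both sequences are continued by 0
    to give the infinite bounded sequence that the definition asks for.\<close>
  define x where "x i = (if i < n then l i *\<^sub>R f i else 0)" for i
  define y where "y i = (if i < n then g i else 0)" for i
  have xE: "x i \<in> E" for i using fg scaleR_E E.subspace_0[OF subE] by (simp add: x_def)
  have yF: "y i \<in> F" for i using fg F.subspace_0[OF subF] by (simp add: y_def)
  have txy: "t (x i) (y i) = (if i < n then l i *\<^sub>R tau (a i) else 0)" for i
  proof (cases "i < n")
    case True
    then show ?thesis using fg[OF True] t_scaleR(1)[of "f i" "g i" "l i"] by (simp add: x_def y_def)
  next
    case False
    then show ?thesis using t_scaleR(1)[of 0 0 0] E.subspace_0[OF subE] F.subspace_0[OF subF] by (simp add: x_def y_def)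
  qed
  have nxy: "norm (x i) * norm (y i) = (if i < n then norm (x i) * norm (y i) else 0)" for i
    by (simp add: x_def)
  have sum_eq: "(\<Sum>i<n. norm (x i) * norm (y i)) = norm w"
  proof (rule antisym)
    have "(\<Sum>i<n. norm (x i) * norm (y i)) \<le> (\<Sum>i<n. l i)"
    proof (rule sum_mono)
      fix i assume "i \<in> {..<n}"
      then have i: "i < n" by simp
      have "norm (x i) * norm (y i) = l i * (norm (f i) * norm (g i))" using i la[OF i] by (simp add: x_def y_def)
      also have "\<dots> \<le> l i * (1 * 1)" using la[OF i] fg[OF i] by (intro mult_left_mono mult_mono) auto
      finally show "norm (x i) * norm (y i) \<le> l i" by simp
    qed
    then show "(\<Sum>i<n. norm (x i) * norm (y i)) \<le> norm w" using ge by simp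
    have "w = (\<Sum>i<n. t (x i) (y i))" unfolding w_def by (intro sum.cong) (auto simp: txy)
    then show "norm w \<le> (\<Sum>i<n. norm (x i) * norm (y i))"
      by (simp only:) (intro order_trans[OF norm_sum] sum_mono norm_t_le xE yF)
  qed
  have s: "(\<lambda>i. norm (x i) * norm (y i)) sums norm w"
    unfolding sum_eq[symmetric] by (subst nxy) (rule sums_if_lessThan)
  have "range (\<lambda>i. (x i, y i)) \<subseteq> insert (0, 0) ((\<lambda>i. (x i, y i)) ` {..<n})"
    by (auto simp: x_def y_def)
  then have "bounded (range (\<lambda>i. (x i, y i)))"
    by (rule bounded_subset[rotated]) (intro finite_imp_bounded, simp)
  moreover have "(\<lambda>i. t (x i) (y i)) sums w"
    unfolding w_def txy by (rule sums_if_lessThan)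
  moreover have "norm w = (\<Sum>i. norm (x i) * norm (y i))" using s by (rule sums_unique)
  ultimately have "w \<in> norm_attaining_tensors sT E F t"
    unfolding norm_attaining_tensors_def using represents_in_Z[OF R] xE yF sums_summable[OF s] by blast
  then show ?thesis by (simp add: w_def)
qed

lemma norm_attaining_dense:
  assumes rnpX: "radon_nikodym_property E" and rnpY: "radon_nikodym_property F"
    and ap: "approximation_property dual_scale E \<or> approximation_property dual_scale F"
  shows "closure (norm_attaining_tensors sT E F t) = Z"
proof
  have "norm_attaining_tensors sT E F t \<subseteq> Z" by (auto simp: norm_attaining_tensors_def)
  then show "closure (norm_attaining_tensors sT E F t) \<subseteq> Z"
    by (rule closure_minimal) (simp add: projective_tensors_def)
  show "Z \<subseteq> closure (norm_attaining_tensors sT E F t)"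
  proof
    fix z assume "z \<in> Z"
    then obtain p where R: "represents z p" using represents_exists by blast
    interpret p: bounded_linear p by (rule represents_bounded_linear[OF R])
    show "z \<in> closure (norm_attaining_tensors sT E F t)"
      unfolding closure_approachable
    proof (intro allI impI)
      fix e :: real assume e: "0 < e"
      \<comment> \<open>Two errors of size \<open>d\<close>, from the perturbation and from the
        exhaustion, are doubled on passing to the projective norm, and
        \<open>4 * d = e / 2\<close>.\<close>
      define d where "d = e / 8"
      have d: "0 < d" using e by (simp add: d_def)
      define B where "B = V \<inter> cball 0 1"
      have "closed B" "convex B" "0 \<in> B"
        unfolding B_def using subspace_V
        by (auto intro: closed_Int closed_V convex_Int subspace_imp_convex subspace_0)
      moreover from this have "B \<noteq> {}" by blast
      moreover have "p v \<le> norm z" if "v \<in> B" for v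
        using represents_le[OF R, of v] that mult_left_le[of "norm v" "norm z"] by (auto simp: B_def)
      ultimately obtain q v1 where q: "linear q" "\<And>w. \<bar>q w\<bar> \<le> d * norm w" and v1: "v1 \<in> B"
        and max: "\<And>v. v \<in> B \<Longrightarrow> p v - q v \<le> p v1 - q v1"
        using bishop_phelps[of B p "norm z" d] p.bounded_linear_axioms d by blast
      define r where "r v = p v - q v" for v
      have r: "linear r" unfolding r_def
        by (rule linearI) (simp_all add: p.add p.scaleR linear_add[OF q(1)] linear_scale[OF q(1)] algebra_simps)
      define M where "M = r v1"
      have M0: "0 \<le> M" using max[OF \<open>0 \<in> B\<close>] linear_0[OF r] by (simp add: M_def r_def)
      have rM: "r v \<le> M * norm v" if v: "v \<in> V" for v
      proof (cases "v = 0")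
        case False
        have "(1 / norm v) *\<^sub>R v \<in> B"
          using False v subspace_scale[OF subspace_V] by (simp add: B_def)
        then have "r ((1 / norm v) *\<^sub>R v) \<le> M" using max by (simp add: M_def r_def)
        then have "r v / norm v \<le> M" using linear_scale[OF r] by simp
        then show ?thesis using False by (simp add: divide_le_eq)
      qed (simp add: linear_0[OF r])
      have v1V: "v1 \<in> V" "norm v1 \<le> 1" using v1 by (auto simp: B_def)
      show "\<exists>w\<in>norm_attaining_tensors sT E F t. dist w z < e"
      proof (cases "M = 0")
        case True
        \<comment> \<open>The perturbed functional vanishes on \<open>V\<close>, so \<open>p\<close>
          agrees there with the small \<open>q\<close>, and the zero tensor, which attains its norm,
          is close to \<open>z\<close>.\<close>
        have "\<bar>p v\<bar> \<le> d * norm v" if v: "v \<in> V" for v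
        proof -
          have "- v \<in> V" using subspace_neg[OF subspace_V v] .
          then have "r v = 0" using rM[OF v] rM[of "- v"] True linear_neg[OF r, of v] by simp
          then show ?thesis using q(2)[of v] by (simp add: r_def)
        qed
        then have "norm z \<le> 2 * d" by (rule norm_le_of_represents[OF rnpX rnpY ap R d])
        moreover have "0 \<in> norm_attaining_tensors sT E F t"
          using face_combination_attains[OF v1V, of 0] by simp
        ultimately show ?thesis using e by (intro bexI[of _ 0]) (auto simp: d_def)
      next
        case False
        then have M: "0 < M" using M0 by simp
        define F0 where "F0 = {k \<in> K. ev v1 k = 1}"
        have F0: "F0 \<subseteq> K" "closed F0"
          unfolding F0_def using continuous_closed_preimage_constant[OF V_continuous[OF v1V(1)] closed_K, of 1]
          by auto
        \<comment> \<open>Divided by \<open>M\<close>, the functional is dominated by the supremum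
          over the face; multiplying back turns the tolerance \<open>d / M\<close> into
          \<open>d\<close>.\<close>
        have "\<exists>(n::nat) l a. (\<forall>i<n. 0 \<le> l i \<and> a i \<in> F0) \<and> (\<Sum>i<n. l i) \<le> 1 \<and>
            (\<forall>v\<in>V. \<bar>r v / M - (\<Sum>i<n. l i * ev v (a i))\<bar> \<le> d / M * norm v)"
        proof (rule face_approx[OF rnpX rnpY F0])
          show "linear (\<lambda>v. r v / M)"
            by (rule linearI) (simp_all add: linear_add[OF r] linear_scale[OF r] add_divide_distrib)
          fix v c assume v: "v \<in> V" "\<forall>k\<in>F0. ev v k \<le> c"
          have "r v \<le> M * c"
            using norm_attained_face[OF subspace_V compact_K closed_K V_continuous V_norming r rM v1V M_def[symmetric] v(1) v(2)[unfolded F0_def] M0] .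
          then show "r v / M \<le> c" using M by (simp add: divide_le_eq mult.commute)
        qed (use d M in simp)
        then obtain n :: nat and l a where la: "\<And>i. i < n \<Longrightarrow> 0 \<le> l i \<and> a i \<in> F0"
          "\<And>v. v \<in> V \<Longrightarrow> \<bar>r v / M - (\<Sum>i<n. l i * ev v (a i))\<bar> \<le> d / M * norm v"
          by blast
        define w where "w = (\<Sum>i<n. (M * l i) *\<^sub>R tau (a i))"
        have w: "w \<in> norm_attaining_tensors sT E F t"
          unfolding w_def using la(1) M by (intro face_combination_attains[OF v1V]) (auto simp: F0_def)
        have "represents w (\<lambda>v. \<Sum>i<n. (M * l i) * ev v (a i))"
          unfolding w_def using la(1) F0(1) by (intro represents_finite) auto
        then have Rw: "represents (z - w) (\<lambda>v. p v - (\<Sum>i<n. (M * l i) * ev v (a i)))"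
          by (rule represents_diff[OF R])
        have "\<bar>p v - (\<Sum>i<n. (M * l i) * ev v (a i))\<bar> \<le> 2 * d * norm v" if v: "v \<in> V" for v
        proof -
          have "p v - (\<Sum>i<n. (M * l i) * ev v (a i)) = q v + M * (r v / M - (\<Sum>i<n. l i * ev v (a i)))"
          proof -
            have "M * (r v / M) = p v - q v" using M by (simp add: r_def)
            then show ?thesis by (simp only: right_diff_distrib) (simp add: sum_distrib_left mult.assoc)
          qed
          moreover have "\<bar>M * (r v / M - (\<Sum>i<n. l i * ev v (a i)))\<bar> \<le> M * (d / M * norm v)"
            unfolding abs_mult using la(2)[OF v] M by (intro mult_mono) auto
          ultimately show ?thesis using q(2)[of v] M by simp
        qed
        then have "norm (z - w) \<le> 2 * (2 * d)"
          by (intro norm_le_of_represents[OF rnpX rnpY ap Rw]) (use d in auto)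
        then show ?thesis using w e by (intro bexI[of _ w]) (auto simp: d_def dist_norm norm_minus_commute)
      qed
    qed
  qed
qed

end

theorem corollary4p6:
  fixes sX :: "'k::{real_normed_field,euclidean_space} \<Rightarrow> 'a::banach \<Rightarrow> 'a"
    and sY :: "'k \<Rightarrow> 'b::banach \<Rightarrow> 'b"
    and sT :: "'k \<Rightarrow> 'c::banach \<Rightarrow> 'c"
    and t :: "('a \<Rightarrow>\<^sub>L 'k) \<Rightarrow> ('b \<Rightarrow>\<^sub>L 'k) \<Rightarrow> 'c"
  assumes "banach_over sX"
    and "banach_over sY"
    and "radon_nikodym_property (dual_space sX)"
    and "radon_nikodym_property (dual_space sY)"
    and "approximation_property dual_scale (dual_space sX) \<or>
         approximation_property dual_scale (dual_space sY)"
    and "is_projective_tensor_product dual_scale (dual_space sX) dual_scale (dual_space sY) sT t"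
  shows "closure (norm_attaining_tensors sT (dual_space sX) (dual_space sY) t) =
         projective_tensors sT (dual_space sX) (dual_space sY) t"
  by (rule dual_tensor_product.norm_attaining_dense[OF dual_tensor_product.intro[OF assms(1,2,6)] assms(3-5)])

end
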